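(* Let $M$ be a complete $n$-dimensional Riemannian manifold ($n \geq 2$), with no curvature assumption. If the Sobolev inequalities $$\|f\|_p \leq C_1 \|\nabla f\|_q, \quad \forall f \in C_0^\infty(M), \quad 1 \leq q < n, \quad \frac{1}{p} = \frac{1}{q} - \frac{1}{n},$$ are satisfied on $M$, where the positive constant $C_1$ satisfies $C_1 > C_0$, then the geodesic ball in $M$ has maximal volume growth, namely $$\lim_{r \to +\infty} \frac{V(x_0, r)}{V_0(r)} \geq C,$$ where the positive constant $C$ depends only on $n$ and $q$.
   Context: $C_0^\infty(M)$ is the space of smooth functions with compact support in $M$; $dv$ and $\nabla$ are the Riemannian volume element and the gradient operator of $M$; $\|f\|_p = (\int_M |f|^p\, dv)^{1/p}$ denotes the $L^p$ norm of $f$, and $\|\nabla f\|_q = (\int_M |\nabla f|^q\, dv)^{1/q}$. $C_0$ is the optimal constant in $\mathbb{R}^n$ for the same Sobolev inequality, i.e. the smallest constant such that $\|f\|_p \leq C_0 \|\nabla f\|_q$ for all $f \in C_0^\infty(\mathbb{R}^n)$. $V(x_0, r)$ denotes the volume of the geodesic ball $B(x_0, r)$ of $M$ of radius $r$ with center $x_0 \in M$, and $V_0(r)$ denotes the volume of the Euclidean ball of radius $r$ in $\mathbb{R}^n$.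
   Formalization: C may depend on C_1 as well as n and q (cones of small angle show no C independent of C_1 exists); the limit, which need not exist, is read as liminf; C is chosen for manifolds with points in one fixed set type, which suffices since every manifold has a copy with points among the reals. *)

theory Defs
  imports "HOL-Analysis.Analysis"
begin

section \<open>Smooth maps between normed spaces\<close>

text \<open>Used for open sets only, where differentiability of class \<open>C\<^sup>k\<close> is the existence and
  continuity of all iterated directional derivatives of order at most \<open>k\<close>.\<close>

primrec Ck_on :: "nat \<Rightarrow> 'a::real_normed_vector set \<Rightarrow> ('a \<Rightarrow> 'b::real_normed_vector) \<Rightarrow> bool" where
  "Ck_on 0 = (\<lambda>S f. continuous_on S f)"
| "Ck_on (Suc k) = (\<lambda>S f. (\<forall>x\<in>S. f differentiable (at x)) \<and>
      (\<forall>v. Ck_on k S (\<lambda>x. frechet_derivative f (at x) v)))"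

definition smooth_on :: "'a::real_normed_vector set \<Rightarrow> ('a \<Rightarrow> 'b::real_normed_vector) \<Rightarrow> bool" where
  "smooth_on S f \<longleftrightarrow> (\<forall>k. Ck_on k S f)"


section \<open>Riemannian manifolds\<close>

text \<open>A chart is a pair of its domain and its coordinate map; the values of the map outside
  the domain are irrelevant.\<close>

type_synonym ('m, 'n) chart = "'m set \<times> ('m \<Rightarrow> real ^ 'n)"

text \<open>The points are the elements of \<open>topspace (mtop M)\<close>, not the whole type. The matrix
  \<open>gmat M c x\<close> holds the components of the metric tensor at \<open>x\<close> in the coordinates of the chart
  \<open>c\<close>; it is meaningful for \<open>c \<in> atlas M\<close> and \<open>x \<in> fst c\<close> only.\<close>

record ('m, 'n) rmanifold =
  mtop :: "'m topology"
  atlas :: "('m, 'n) chart set"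
  gmat :: "('m, 'n) chart \<Rightarrow> 'm \<Rightarrow> real ^ 'n ^ 'n"

abbreviation points :: "('m, 'n::finite) rmanifold \<Rightarrow> 'm set" where
  "points M \<equiv> topspace (mtop M)"

definition cinv :: "('m, 'n::finite) chart \<Rightarrow> real ^ 'n \<Rightarrow> 'm" where
  "cinv c = inv_into (fst c) (snd c)"

definition is_chart :: "'m topology \<Rightarrow> ('m, 'n::finite) chart \<Rightarrow> bool" where
  "is_chart X c \<longleftrightarrow> openin X (fst c) \<and> open (snd c ` fst c) \<and>
     homeomorphic_map (subtopology X (fst c)) (top_of_set (snd c ` fst c)) (snd c)"

definition smooth_manifold :: "('m, 'n::finite) rmanifold \<Rightarrow> bool" where
  "smooth_manifold M \<longleftrightarrow>
     Hausdorff_space (mtop M) \<and> second_countable (mtop M) \<and> connected_space (mtop M) \<and>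
     (\<forall>c\<in>atlas M. is_chart (mtop M) c) \<and> (\<Union>c\<in>atlas M. fst c) = points M \<and>
     (\<forall>c\<in>atlas M. \<forall>c'\<in>atlas M. smooth_on (snd c ` (fst c \<inter> fst c')) (snd c' \<circ> cinv c))"

definition jacobian :: "('m, 'n::finite) chart \<Rightarrow> ('m, 'n) chart \<Rightarrow> 'm \<Rightarrow> real ^ 'n ^ 'n" where
  "jacobian c c' x = matrix (frechet_derivative (snd c' \<circ> cinv c) (at (snd c x)))"

definition riemannian_manifold :: "('m, 'n::finite) rmanifold \<Rightarrow> bool" where
  "riemannian_manifold M \<longleftrightarrow> smooth_manifold M \<and>
     (\<forall>c\<in>atlas M. smooth_on (snd c ` fst c) (\<lambda>y. gmat M c (cinv c y))) \<and>
     (\<forall>c\<in>atlas M. \<forall>x\<in>fst c. transpose (gmat M c x) = gmat M c x \<and>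
        (\<forall>v. v \<noteq> 0 \<longrightarrow> v \<bullet> (gmat M c x *v v) > 0)) \<and>
     (\<forall>c\<in>atlas M. \<forall>c'\<in>atlas M. \<forall>x\<in>fst c \<inter> fst c'.
        gmat M c x = transpose (jacobian c c' x) ** gmat M c' x ** jacobian c c' x)"

text \<open>Pointwise notions below are computed in an arbitrary chart around the point; the
  transformation law for \<open>gmat\<close> makes them independent of that choice.\<close>

definition chart_at :: "('m, 'n::finite) rmanifold \<Rightarrow> 'm \<Rightarrow> ('m, 'n) chart" where
  "chart_at M x = (SOME c. c \<in> atlas M \<and> x \<in> fst c)"

definition gnorm :: "('m, 'n::finite) rmanifold \<Rightarrow> ('m, 'n) chart \<Rightarrow> 'm \<Rightarrow> real ^ 'n \<Rightarrow> real" where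
  "gnorm M c x v = sqrt (v \<bullet> (gmat M c x *v v))"


subsection \<open>Riemannian distance and completeness\<close>

definition C1_curve_on :: "('m, 'n::finite) rmanifold \<Rightarrow> real \<Rightarrow> real \<Rightarrow> (real \<Rightarrow> 'm) \<Rightarrow> bool" where
  "C1_curve_on M a b \<gamma> \<longleftrightarrow> continuous_map (top_of_set {a..b}) (mtop M) \<gamma> \<and>
     (\<forall>c\<in>atlas M. \<exists>D. continuous_on {t\<in>{a..b}. \<gamma> t \<in> fst c} D \<and>
        (\<forall>t\<in>{a..b}. \<gamma> t \<in> fst c \<longrightarrow>
           ((snd c \<circ> \<gamma>) has_vector_derivative D t) (at t within {a..b})))"

definition piecewise_C1_curve :: "('m, 'n::finite) rmanifold \<Rightarrow> (real \<Rightarrow> 'm) \<Rightarrow> bool" where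
  "piecewise_C1_curve M \<gamma> \<longleftrightarrow>
     (\<exists>k. \<exists>s::nat \<Rightarrow> real. s 0 = 0 \<and> s k = 1 \<and>
        (\<forall>i<k. s i < s (Suc i) \<and> C1_curve_on M (s i) (s (Suc i)) \<gamma>))"

definition speed :: "('m, 'n::finite) rmanifold \<Rightarrow> (real \<Rightarrow> 'm) \<Rightarrow> real \<Rightarrow> real" where
  "speed M \<gamma> t = (let c = chart_at M (\<gamma> t)
                  in gnorm M c (\<gamma> t) (vector_derivative (snd c \<circ> \<gamma>) (at t)))"

definition curve_length :: "('m, 'n::finite) rmanifold \<Rightarrow> (real \<Rightarrow> 'm) \<Rightarrow> real" where
  "curve_length M \<gamma> = integral {0..1} (speed M \<gamma>)"

text \<open>The value \<open>0\<close> off the manifold only serves to make \<open>rdist M\<close> nonnegative and symmetric on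
  the whole type, as the locale \<open>Metric_space\<close> requires.\<close>

definition rdist :: "('m, 'n::finite) rmanifold \<Rightarrow> 'm \<Rightarrow> 'm \<Rightarrow> real" where
  "rdist M x y =
     (if x \<in> points M \<and> y \<in> points M
      then Inf {curve_length M \<gamma> | \<gamma>. piecewise_C1_curve M \<gamma> \<and> \<gamma> 0 = x \<and> \<gamma> 1 = y}
      else 0)"

definition complete_riemannian :: "('m, 'n::finite) rmanifold \<Rightarrow> bool" where
  "complete_riemannian M \<longleftrightarrow>
     riemannian_manifold M \<and> Metric_space.mcomplete (points M) (rdist M)"

definition geodesic_ball :: "('m, 'n::finite) rmanifold \<Rightarrow> 'm \<Rightarrow> real \<Rightarrow> 'm set" where
  "geodesic_ball M = Metric_space.mball (points M) (rdist M)"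


subsection \<open>Riemannian volume\<close>

text \<open>The Riemannian volume is the unique Borel measure that has density \<open>sqrt (det g)\<close> with
  respect to Lebesgue measure in every chart.\<close>

definition borel_sigma :: "'m topology \<Rightarrow> 'm measure" where
  "borel_sigma X = sigma (topspace X) {U. openin X U}"

definition rvol :: "('m, 'n::finite) rmanifold \<Rightarrow> 'm measure" where
  "rvol M = (THE \<mu>. space \<mu> = points M \<and> sets \<mu> = sets (borel_sigma (mtop M)) \<and>
     (\<forall>c\<in>atlas M. \<forall>A\<in>sets \<mu>. A \<subseteq> fst c \<longrightarrow>
        emeasure \<mu> A =
          (\<integral>\<^sup>+ y\<in>snd c ` A. ennreal (sqrt (det (gmat M c (cinv c y)))) \<partial>lborel)))"


subsection \<open>Test functions, gradients and Sobolev inequalities\<close>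

definition test_functions :: "('m, 'n::finite) rmanifold \<Rightarrow> ('m \<Rightarrow> real) set" where
  "test_functions M =
     {f. (\<forall>c\<in>atlas M. smooth_on (snd c ` fst c) (f \<circ> cinv c)) \<and>
         compactin (mtop M) (mtop M closure_of {x \<in> points M. f x \<noteq> 0})}"

definition differential :: "('m, 'n::finite) chart \<Rightarrow> ('m \<Rightarrow> real) \<Rightarrow> 'm \<Rightarrow> real ^ 'n" where
  "differential c f x = (\<chi> i. frechet_derivative (f \<circ> cinv c) (at (snd c x)) (axis i 1))"

definition gradient ::
  "('m, 'n::finite) rmanifold \<Rightarrow> ('m, 'n) chart \<Rightarrow> ('m \<Rightarrow> real) \<Rightarrow> 'm \<Rightarrow> real ^ 'n" where
  "gradient M c f x = matrix_inv (gmat M c x) *v differential c f x"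

definition grad_norm :: "('m, 'n::finite) rmanifold \<Rightarrow> ('m \<Rightarrow> real) \<Rightarrow> 'm \<Rightarrow> real" where
  "grad_norm M f x = (let c = chart_at M x in gnorm M c x (gradient M c f x))"

definition Lp_norm :: "'m measure \<Rightarrow> real \<Rightarrow> ('m \<Rightarrow> real) \<Rightarrow> real" where
  "Lp_norm \<mu> p f = (\<integral>x. \<bar>f x\<bar> powr p \<partial>\<mu>) powr (1 / p)"

definition sobolev_inequality ::
  "('m, 'n::finite) rmanifold \<Rightarrow> real \<Rightarrow> real \<Rightarrow> real \<Rightarrow> bool" where
  "sobolev_inequality M p q C \<longleftrightarrow>
     (\<forall>f\<in>test_functions M. Lp_norm (rvol M) p f \<le> C * Lp_norm (rvol M) q (grad_norm M f))"

definition optimal_sobolev_constant :: "('m, 'n::finite) rmanifold \<Rightarrow> real \<Rightarrow> real \<Rightarrow> real" where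
  "optimal_sobolev_constant M p q = (LEAST C. sobolev_inequality M p q C)"

definition euclidean_manifold :: "(real ^ 'n, 'n::finite) rmanifold" where
  "euclidean_manifold =
     \<lparr>mtop = euclidean, atlas = {(UNIV, \<lambda>x. x)}, gmat = (\<lambda>_ _. mat 1)\<rparr>"

end

theory Submission
  imports Defs
begin


text \<open>
  Let \<open>V r\<close> be the volume of the ball of radius \<open>r\<close> around \<open>x\<^sub>0\<close> and \<open>n\<close> the dimension. Testing the Sobolev
  inequality with a cut-off function that is \<open>1\<close> on the ball of radius \<open>r / 2\<close>, vanishes outside the
  ball of radius \<open>r\<close> and has gradient at most \<open>A / r\<close> gives
  \<open>V (r / 2) powr (1 / p) \<le> C\<^sub>1 * A / r * V r powr (1 / q)\<close> (\<open>sobolev_balls\<close>). For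
  \<open>W r = V r / r ^ n\<close> this says \<open>W r \<ge> \<kappa> * W (r / 2) powr a\<close> with \<open>a = q / p = 1 - q / n\<close>, because the
  powers of \<open>r\<close> cancel exactly for the Sobolev exponent. As \<open>0 < a < 1\<close>, iterating towards small
  radii damps any lower bound for \<open>W\<close> near \<open>0\<close> to the power \<open>0\<close>, and \<open>W r \<ge> \<kappa> powr (1 / (1 - a))\<close>
  remains for every \<open>r\<close> (\<open>growth_of_doubling\<close>). All that is needed near \<open>0\<close> is that \<open>W\<close> is bounded
  below by some positive number, possibly depending on the manifold (\<open>small_ball_volume\<close>).

  The constant must not depend on the manifold, so neither may \<open>A\<close>, and the cut-off function must be
  smooth with compact support. Compactness of its support is where completeness enters: in a length
  space that is complete and locally compact, closed balls are compact (\<open>compact_mcball\<close>). Smoothness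
  requires a smooth replacement for the distance from \<open>x\<^sub>0\<close>, which is only Lipschitz
  (\<open>smooth_approximation\<close>): in a small coordinate ball around any point the metric differs from a
  constant one by a factor at most \<open>2\<close>, convolution with a bump respects Lipschitz bounds for a
  constant metric (\<open>mollify\<close>), and the local approximations are glued by a partition of unity. The
  gluing costs only the differentials of the weights times the errors of the approximations, and
  these errors can be made as small as desired after the weights have been chosen.

  Distance and volume are handled from their definitions. The distance is a metric that induces the
  manifold topology (\<open>rdist_Metric_space\<close>, \<open>mtopology_eq\<close>), because a curve that leaves a coordinate
  ball has a length proportional to the radius. The volume exists and is unique (\<open>rvol_is_vol\<close>): the
  candidate measures on overlapping charts agree by the change of variables formula
  (\<open>cvol_chart_indep\<close>), and countably many charts cover the manifold.
\<close>



section \<open>Calculus of smooth maps\<close>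

lemma Ck_on_subset: "Ck_on k S f \<Longrightarrow> T \<subseteq> S \<Longrightarrow> Ck_on k T f"
  by (induction k arbitrary: f) (auto intro: continuous_on_subset)

lemma frechet_derivative_cong_open:
  assumes "open S" "x \<in> S" "\<And>y. y \<in> S \<Longrightarrow> f y = g y"
  shows "frechet_derivative f (at x) = frechet_derivative g (at x)"
proof -
  have "(f has_derivative F) (at x) \<longleftrightarrow> (g has_derivative F) (at x)" for F
    using has_derivative_transform_within_open[of f F x UNIV S g]
      has_derivative_transform_within_open[of g F x UNIV S f] assms by auto
  then show ?thesis by (simp add: frechet_derivative_def)
qed

lemma Ck_on_cong:
  assumes "open S" "Ck_on k S f" "\<And>y. y \<in> S \<Longrightarrow> f y = g y"
  shows "Ck_on k S g"
  using assms(2,3)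
proof (induction k arbitrary: f g)
  case 0
  have "continuous_on S f = continuous_on S g" using 0 by (intro continuous_on_cong) auto
  then show ?case using 0 by simp
next
  case (Suc k)
  have "g differentiable (at x)" if "x \<in> S" for x
  proof -
    have "(f has_derivative frechet_derivative f (at x)) (at x)"
      using Suc.prems that frechet_derivative_works by auto
    then show ?thesis
      using differentiableI[OF has_derivative_transform_within_open[of f _ x UNIV S g, OF _ assms(1) that Suc.prems(2)]] by blast
  qed
  moreover have "Ck_on k S (\<lambda>x. frechet_derivative g (at x) v)" for v
  proof (rule Suc.IH[of "\<lambda>x. frechet_derivative f (at x) v"])
    show "Ck_on k S (\<lambda>x. frechet_derivative f (at x) v)"
      using Suc.prems by simp
    show "\<And>y. y \<in> S \<Longrightarrow> frechet_derivative f (at y) v = frechet_derivative g (at y) v"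
      using frechet_derivative_cong_open[OF assms(1) _ Suc.prems(2)] by simp
  qed
  ultimately show ?case by simp
qed

text \<open>\<^const>\<open>Ck_on\<close> speaks of \<^const>\<open>frechet_derivative\<close>, while the differentiation rules produce
  some derivative. Uniqueness of the derivative bridges the two, so that the closure properties below
  follow from the rules by induction on the order.\<close>

lemma Ck_on_SucI:
  assumes "open S" "\<And>x. x \<in> S \<Longrightarrow> (f has_derivative F x) (at x)"
    "\<And>v. Ck_on k S (\<lambda>x. F x v)"
  shows "Ck_on (Suc k) S f"
proof -
  have "frechet_derivative f (at x) = F x" if "x \<in> S" for x
    using assms(2)[OF that] frechet_derivative_at by metis
  then have "Ck_on k S (\<lambda>x. frechet_derivative f (at x) v)" for v
    using Ck_on_cong[OF assms(1) assms(3)[of v]] by simp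
  then show ?thesis using assms(2) by (auto intro: differentiableI)
qed

lemma Ck_on_SucD:
  assumes "Ck_on (Suc k) S f"
  shows "\<And>x. x \<in> S \<Longrightarrow> (f has_derivative frechet_derivative f (at x)) (at x)"
    "\<And>v. Ck_on k S (\<lambda>x. frechet_derivative f (at x) v)"
  using assms frechet_derivative_works by auto

lemma Ck_on_lower: "Ck_on (Suc k) S f \<Longrightarrow> Ck_on k S f"
proof (induction k arbitrary: f)
  case 0
  then have "\<And>x. x \<in> S \<Longrightarrow> isCont f x"
    using differentiable_imp_continuous_within by auto
  then show ?case
    by (simp add: continuous_at_imp_continuous_on)
next
  case (Suc k)
  then show ?case by auto
qed

lemma Ck_on_imp_continuous: "Ck_on k S f \<Longrightarrow> continuous_on S f"
  by (induction k) (use Ck_on_lower in auto)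

lemma Ck_on_const: "Ck_on k S (\<lambda>x. c)"
proof (induction k arbitrary: c)
  case (Suc k)
  show ?case using Suc by simp
qed simp

lemma Ck_on_linear:
  assumes "bounded_linear f"
  shows "Ck_on k S f"
proof (cases k)
  case 0
  then show ?thesis using assms by (simp add: linear_continuous_on)
next
  case (Suc j)
  have "f differentiable at x" for x
    by (simp add: assms bounded_linear_imp_differentiable)
  moreover have "frechet_derivative f (at x) = f" for x
    using assms bounded_linear_imp_has_derivative frechet_derivative_at by metis
  ultimately show ?thesis
    using Suc by (simp add: Ck_on_const)
qed

lemma Ck_on_add:
  assumes "open S" "Ck_on k S f" "Ck_on k S g"
  shows "Ck_on k S (\<lambda>x. f x + g x)"
  using assms(2,3)
proof (induction k arbitrary: f g)
  case 0
  then show ?case by (simp add: continuous_on_add)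
next
  case (Suc k)
  show ?case
    by (rule Ck_on_SucI[OF assms(1) has_derivative_add[OF Ck_on_SucD(1)[OF Suc.prems(1)] Ck_on_SucD(1)[OF Suc.prems(2)]]])
       (use Suc Ck_on_SucD in blast)+
qed

lemma Ck_on_bilinear:
  assumes "bounded_bilinear h" "open S" "Ck_on k S f" "Ck_on k S g"
  shows "Ck_on k S (\<lambda>x. h (f x) (g x))"
  using assms(3,4)
proof (induction k arbitrary: f g)
  case 0
  then show ?case using bounded_bilinear.continuous_on[OF assms(1)] by simp
next
  case (Suc k)
  show ?case
  proof (rule Ck_on_SucI[OF assms(2)])
    show "((\<lambda>x. h (f x) (g x)) has_derivative
       (\<lambda>v. h (f x) (frechet_derivative g (at x) v) + h (frechet_derivative f (at x) v) (g x))) (at x)"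
      if "x \<in> S" for x
      by (intro bounded_bilinear.FDERIV[OF assms(1)] Ck_on_SucD(1)[OF Suc.prems(1)] Ck_on_SucD(1)[OF Suc.prems(2)] that)
    show "Ck_on k S (\<lambda>x. h (f x) (frechet_derivative g (at x) v) + h (frechet_derivative f (at x) v) (g x))" for v
      by (intro Ck_on_add assms Suc.IH Ck_on_lower[OF Suc.prems(1)] Ck_on_lower[OF Suc.prems(2)] Suc.prems Ck_on_SucD(2)[OF Suc.prems(1)] Ck_on_SucD(2)[OF Suc.prems(2)])
  qed
qed

lemmas Ck_on_mult = Ck_on_bilinear[OF bounded_bilinear_mult]
lemmas Ck_on_scaleR = Ck_on_bilinear[OF bounded_bilinear_scaleR]
lemmas Ck_on_inner = Ck_on_bilinear[OF bounded_bilinear_inner]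

lemma Ck_on_uminus:
  assumes "open S" "Ck_on k S f"
  shows "Ck_on k S (\<lambda>x. - f x)"
  using Ck_on_scaleR[OF assms(1) Ck_on_const[of k S "-1"] assms(2)] by simp

lemma Ck_on_diff:
  assumes "open S" "Ck_on k S f" "Ck_on k S g"
  shows "Ck_on k S (\<lambda>x. f x - g x)"
  using Ck_on_add[OF assms(1,2) Ck_on_uminus[OF assms(1,3)]] by simp

lemma Ck_on_sum:
  assumes "open S" "\<And>i. i \<in> I \<Longrightarrow> Ck_on k S (f i)"
  shows "Ck_on k S (\<lambda>x. \<Sum>i\<in>I. f i x)"
proof (cases "finite I")
  case True
  then show ?thesis using assms(2)
  proof (induction I rule: finite_induct)
    case empty
    show ?case using Ck_on_const[of k S 0] by simp
  next
    case (insert i I)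
    have "Ck_on k S (\<lambda>x. f i x + (\<Sum>i\<in>I. f i x))"
      by (rule Ck_on_add[OF assms(1)]) (use insert in blast)+
    then show ?case using insert.hyps by simp
  qed
next
  case False
  then show ?thesis using Ck_on_const[of k S 0] by simp
qed

lemma Ck_on_inverse:
  fixes f :: "'a::real_normed_vector \<Rightarrow> real"
  assumes "open S" "Ck_on k S f" "\<And>x. x \<in> S \<Longrightarrow> f x \<noteq> 0"
  shows "Ck_on k S (\<lambda>x. inverse (f x))"
  using assms(2,3)
proof (induction k arbitrary: f)
  case 0
  then show ?case using continuous_on_inverse[of S f] by simp
next
  case (Suc k)
  show ?case
  proof (rule Ck_on_SucI[OF assms(1)])
    show "((\<lambda>x. inverse (f x)) has_derivative
       (\<lambda>v. - (inverse (f x) * frechet_derivative f (at x) v * inverse (f x)))) (at x)"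
      if "x \<in> S" for x
      using Suc.prems(2) that by (intro Deriv.has_derivative_inverse Ck_on_SucD(1)[OF Suc.prems(1)]) auto
    have "Ck_on k S (\<lambda>x. inverse (f x))"
      using Suc.IH[OF Ck_on_lower[OF Suc.prems(1)]] Suc.prems(2) by blast
    then show "Ck_on k S (\<lambda>x. - (inverse (f x) * frechet_derivative f (at x) v * inverse (f x)))" for v
      using Ck_on_SucD(2)[OF Suc.prems(1), of v] by (intro Ck_on_uminus Ck_on_mult assms(1))
  qed
qed

text \<open>The directional derivative of \<open>g \<circ> f\<close> is \<open>Dg\<close> applied to a direction that moves with the
  point. Expanding that direction in the standard basis turns it into a sum of products of functions
  to which the induction hypothesis applies.\<close>

lemma Ck_on_compose:
  fixes f :: "'a::real_normed_vector \<Rightarrow> 'b::euclidean_space"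
  assumes "open S" "open T" "f ` S \<subseteq> T" "Ck_on k T g" "Ck_on k S f"
  shows "Ck_on k S (\<lambda>x. g (f x))"
  using assms(4,5)
proof (induction k arbitrary: g)
  case 0
  then show ?case using continuous_on_compose2[of T g S f] assms(3) by simp
next
  case (Suc k)
  note gd = Ck_on_SucD[OF Suc.prems(1)] and fd = Ck_on_SucD[OF Suc.prems(2)]
  show ?case
  proof (rule Ck_on_SucI[OF assms(1)])
    fix x assume x: "x \<in> S"
    have "(g has_derivative frechet_derivative g (at (f x))) (at (f x))"
      using gd x assms(3) by auto
    from has_derivative_compose[OF fd(1)[OF x] this]
    have 1: "((\<lambda>x. g (f x)) has_derivative
       (\<lambda>v. frechet_derivative g (at (f x)) (frechet_derivative f (at x) v))) (at x)" .
    have lin: "linear (frechet_derivative g (at (f x)))"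
      using gd(1) x assms(3) has_derivative_linear by blast
    have "frechet_derivative g (at (f x)) w = (\<Sum>b\<in>Basis. (w \<bullet> b) *\<^sub>R frechet_derivative g (at (f x)) b)" for w
    proof -
      have "frechet_derivative g (at (f x)) w = frechet_derivative g (at (f x)) (\<Sum>b\<in>Basis. (w \<bullet> b) *\<^sub>R b)"
        by (simp add: euclidean_representation)
      also have "\<dots> = (\<Sum>b\<in>Basis. (w \<bullet> b) *\<^sub>R frechet_derivative g (at (f x)) b)"
        by (simp only: linear_sum[OF lin] linear_scale[OF lin])
      finally show ?thesis .
    qed
    then show "((\<lambda>x. g (f x)) has_derivative
       (\<lambda>v. \<Sum>b\<in>Basis. (frechet_derivative f (at x) v \<bullet> b) *\<^sub>R frechet_derivative g (at (f x)) b)) (at x)"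
      by (intro has_derivative_eq_rhs[OF 1] ext)
  next
    fix v
    show "Ck_on k S (\<lambda>x. \<Sum>b\<in>Basis. (frechet_derivative f (at x) v \<bullet> b) *\<^sub>R frechet_derivative g (at (f x)) b)"
      using fd(2) gd(2) Suc.IH[of "\<lambda>y. frechet_derivative g (at y) _"] Ck_on_lower[OF Suc.prems(2)]
      by (intro Ck_on_sum[OF assms(1)] Ck_on_scaleR[OF assms(1)] Ck_on_inner[OF assms(1)] Ck_on_const) auto
  qed
qed

lemma smooth_on_subset: "smooth_on S f \<Longrightarrow> T \<subseteq> S \<Longrightarrow> smooth_on T f"
  unfolding smooth_on_def using Ck_on_subset[of _ S f T] by simp

lemma smooth_on_cong:
  assumes "open S" "smooth_on S f" "\<And>y. y \<in> S \<Longrightarrow> f y = g y"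
  shows "smooth_on S g"
  unfolding smooth_on_def
proof
  fix k
  show "Ck_on k S g"
    by (rule Ck_on_cong[of S k f g]) (use assms in \<open>simp_all add: smooth_on_def\<close>)
qed

lemma smooth_on_compose:
  fixes f :: "'a::real_normed_vector \<Rightarrow> 'b::euclidean_space"
  assumes "open S" "open T" "f ` S \<subseteq> T" "smooth_on T g" "smooth_on S f"
  shows "smooth_on S (\<lambda>x. g (f x))"
  unfolding smooth_on_def
  by (rule allI, rule Ck_on_compose[OF assms(1-3)]) (use assms(4,5) in \<open>simp_all add: smooth_on_def\<close>)

lemma smooth_on_const: "smooth_on S (\<lambda>x. c)"
  and smooth_on_linear: "bounded_linear l \<Longrightarrow> smooth_on S l"
  and smooth_on_add: "open S \<Longrightarrow> smooth_on S f \<Longrightarrow> smooth_on S g \<Longrightarrow> smooth_on S (\<lambda>x. f x + g x)"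
  and smooth_on_diff: "open S \<Longrightarrow> smooth_on S f \<Longrightarrow> smooth_on S g \<Longrightarrow> smooth_on S (\<lambda>x. f x - g x)"
  and smooth_on_inner: "open S \<Longrightarrow> smooth_on S u \<Longrightarrow> smooth_on S w \<Longrightarrow> smooth_on S (\<lambda>x. u x \<bullet> w x)"
  and smooth_on_sum: "open S \<Longrightarrow> (\<And>i. i \<in> I \<Longrightarrow> smooth_on S (h i)) \<Longrightarrow> smooth_on S (\<lambda>x. \<Sum>i\<in>I. h i x)"
  by (simp_all add: smooth_on_def Ck_on_const Ck_on_linear Ck_on_add Ck_on_diff Ck_on_inner Ck_on_sum)

lemma smooth_on_mult:
  fixes f g :: "'a::real_normed_vector \<Rightarrow> real"
  shows "open S \<Longrightarrow> smooth_on S f \<Longrightarrow> smooth_on S g \<Longrightarrow> smooth_on S (\<lambda>x. f x * g x)"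
  by (simp add: smooth_on_def Ck_on_mult)

lemma smooth_on_divide:
  fixes f g :: "'a::real_normed_vector \<Rightarrow> real"
  shows "open S \<Longrightarrow> smooth_on S f \<Longrightarrow> smooth_on S g \<Longrightarrow> (\<And>x. x \<in> S \<Longrightarrow> g x \<noteq> 0) \<Longrightarrow>
    smooth_on S (\<lambda>x. f x / g x)"
  by (simp add: smooth_on_def divide_inverse Ck_on_mult Ck_on_inverse)

lemma smooth_on_imp_continuous_on: "smooth_on S f \<Longrightarrow> continuous_on S f"
  unfolding smooth_on_def using Ck_on_imp_continuous[of 0 S f] by blast

lemma smooth_on_has_derivative:
  "smooth_on S f \<Longrightarrow> x \<in> S \<Longrightarrow> (f has_derivative frechet_derivative f (at x)) (at x)"
  unfolding smooth_on_def using Ck_on_SucD(1)[of 0 S f x] by blast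

lemma smooth_on_derivative: "smooth_on S f \<Longrightarrow> smooth_on S (\<lambda>x. frechet_derivative f (at x) v)"
  unfolding smooth_on_def by (rule allI, rule Ck_on_SucD(2)[of _ S f v], erule spec)

lemma smooth_on_locally:
  assumes "\<And>x. x \<in> S \<Longrightarrow> \<exists>T. x \<in> T \<and> open T \<and> smooth_on T f"
  shows "smooth_on S f"
proof -
  have "Ck_on k S f" if "\<And>x. x \<in> S \<Longrightarrow> \<exists>T. x \<in> T \<and> open T \<and> Ck_on k T f" for k
    using that
  proof (induction k arbitrary: f)
    case 0
    have "isCont f x" if "x \<in> S" for x
    proof -
      obtain T where "x \<in> T" "open T" "continuous_on T f" using 0 \<open>x \<in> S\<close> by auto
      then show ?thesis by (simp add: continuous_on_eq_continuous_at)
    qed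
    then show ?case by (simp add: continuous_at_imp_continuous_on)
  next
    case (Suc k)
    have *: "\<exists>T. x \<in> T \<and> open T \<and> f differentiable at x \<and> (\<forall>v. Ck_on k T (\<lambda>x. frechet_derivative f (at x) v))"
      if "x \<in> S" for x
      using Suc.prems[OF that] by auto
    have "Ck_on k S (\<lambda>x. frechet_derivative f (at x) v)" for v
      using * by (intro Suc.IH) blast
    then show ?case using * by auto
  qed
  note Ck = this
  have "Ck_on k S f" for k
  proof (rule Ck)
    fix x assume "x \<in> S"
    from assms[OF this] show "\<exists>T. x \<in> T \<and> open T \<and> Ck_on k T f"
      unfolding smooth_on_def by blast
  qed
  then show ?thesis by (simp only: smooth_on_def simp_thms)
qed


section \<open>Bump functions and mollification\<close>

text \<open>The functions \<open>s\<^sup>-\<^sup>k exp (-1/s)\<close>, continued by \<open>0\<close>. Their powers of \<open>1/s\<close> are there to make the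
  family closed under differentiation.\<close>

definition flat :: "nat \<Rightarrow> real \<Rightarrow> real" where
  "flat k s = (if s > 0 then inverse s ^ k * exp (- inverse s) else 0)"

lemma flat_tendsto_0: "(flat k \<longlongrightarrow> 0) (at 0)"
proof -
  have "((\<lambda>x::real. inverse x ^ k / exp (inverse x)) \<longlongrightarrow> 0) (at_right 0)"
    by (rule filterlim_compose[OF tendsto_power_div_exp_0 filterlim_inverse_at_top_right])
  moreover have "\<forall>\<^sub>F x in at_right (0::real). inverse x ^ k / exp (inverse x) = flat k x"
    using eventually_at_right_less[of "0::real"] by eventually_elim (simp add: flat_def exp_minus divide_inverse)
  ultimately have "(flat k \<longlongrightarrow> 0) (at_right 0)"
    using tendsto_cong by force
  moreover have "(flat k \<longlongrightarrow> 0) (at_left 0)"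
  proof (rule tendsto_eventually)
    show "\<forall>\<^sub>F x in at_left 0. flat k x = 0"
      using eventually_at_left_real[of "-1" "0::real"] by (simp add: eventually_mono flat_def)
  qed
  ultimately show ?thesis using filterlim_split_at by blast
qed

text \<open>At the origin the difference quotient of \<open>flat k\<close> is \<open>flat (k + 1)\<close>, which tends to \<open>0\<close>.\<close>

lemma flat_derivative:
  "(flat k has_real_derivative - real k * flat (Suc k) s + flat (Suc (Suc k)) s) (at s)"
proof -
  consider "s > 0" | "s < 0" | "s = 0" by linarith
  then show ?thesis
  proof cases
    case 1
    have inv: "(inverse has_real_derivative - (inverse s ^ 2)) (at s)"
      using DERIV_inverse[of s] 1 by (simp add: numeral_2_eq_2)
    have "((\<lambda>s. inverse s ^ k) has_real_derivative - real k * inverse s ^ Suc k) (at s)"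
      using DERIV_power[OF inv, of k] by (cases k) (simp_all add: power2_eq_square algebra_simps)
    moreover have "((\<lambda>s. exp (- inverse s)) has_real_derivative exp (- inverse s) * inverse s ^ 2) (at s)"
      using DERIV_fun_exp[OF DERIV_minus[OF inv]] by simp
    ultimately have "((\<lambda>s. inverse s ^ k * exp (- inverse s)) has_real_derivative
        - real k * inverse s ^ Suc k * exp (- inverse s) + exp (- inverse s) * inverse s ^ 2 * inverse s ^ k) (at s)"
      by (rule DERIV_mult)
    then have "((\<lambda>s. inverse s ^ k * exp (- inverse s)) has_real_derivative
        - real k * flat (Suc k) s + flat (Suc (Suc k)) s) (at s)"
      using 1 by (simp add: flat_def power2_eq_square mult_ac)
    then show ?thesis
      by (rule has_field_derivative_transform_within_open[where S = "{0<..}"]) (use 1 in \<open>auto simp: flat_def\<close>)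
  next
    case 2
    have "((\<lambda>s. 0) has_real_derivative - real k * flat (Suc k) s + flat (Suc (Suc k)) s) (at s)"
      using 2 by (simp add: flat_def)
    then show ?thesis
      by (rule has_field_derivative_transform_within_open[where S = "{..<0}"]) (use 2 in \<open>auto simp: flat_def\<close>)
  next
    case 3
    have "flat (Suc k) = (\<lambda>y. (flat k y - flat k 0) / (y - 0))"
      by (rule ext) (simp add: flat_def divide_inverse)
    then have "((\<lambda>y. (flat k y - flat k 0) / (y - 0)) \<longlongrightarrow> 0) (at 0)"
      using flat_tendsto_0[of "Suc k"] by (simp only:)
    then show ?thesis
      using 3 by (simp add: has_field_derivative_iff flat_def)
  qed
qed

lemma smooth_flat: "smooth_on UNIV (flat k)"
proof -
  have "Ck_on j UNIV (flat k)" for j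
  proof (induction j arbitrary: k)
    case 0
    have "isCont (flat k) x" for x
      using flat_derivative DERIV_isCont by blast
    then show ?case by (simp add: continuous_at_imp_continuous_on)
  next
    case (Suc j)
    show ?case
    proof (rule Ck_on_SucI)
      show "(flat k has_derivative (\<lambda>v. (- real k * flat (Suc k) x + flat (Suc (Suc k)) x) * v)) (at x)" for x
        using flat_derivative[of k x] by (simp add: has_field_derivative_def)
      have "Ck_on j UNIV (\<lambda>x. - real k * flat (Suc k) x)"
        by (rule Ck_on_mult[OF open_UNIV Ck_on_const Suc])
      from Ck_on_add[OF open_UNIV this Suc]
      have *: "Ck_on j UNIV (\<lambda>x. - real k * flat (Suc k) x + flat (Suc (Suc k)) x)" .
      show "Ck_on j UNIV (\<lambda>x. (- real k * flat (Suc k) x + flat (Suc (Suc k)) x) * v)" for v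
        by (rule Ck_on_mult[OF open_UNIV * Ck_on_const])
    qed simp
  qed
  then show ?thesis by (simp only: smooth_on_def simp_thms)
qed

text \<open>The standard bump \<open>exp (-1 / (\<rho>\<^sup>2 - |y - y0|\<^sup>2))\<close>, continued by \<open>0\<close> outside the ball of radius \<open>\<rho>\<close>.\<close>

definition bump :: "'a::euclidean_space \<Rightarrow> real \<Rightarrow> 'a \<Rightarrow> real" where
  "bump y0 \<rho> y = flat 0 (\<rho>\<^sup>2 - (y - y0) \<bullet> (y - y0))"

lemma smooth_bump: "smooth_on UNIV (bump y0 \<rho>)"
proof -
  have 1: "smooth_on UNIV (\<lambda>y. y - y0)"
    by (rule smooth_on_diff[OF open_UNIV smooth_on_linear[OF bounded_linear_ident] smooth_on_const])
  have "smooth_on UNIV (\<lambda>y. \<rho>\<^sup>2 - (y - y0) \<bullet> (y - y0))"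
    by (rule smooth_on_diff[OF open_UNIV smooth_on_const smooth_on_inner[OF open_UNIV 1 1]])
  from smooth_on_compose[OF open_UNIV open_UNIV _ smooth_flat[of 0] this]
  show ?thesis by (simp add: bump_def[abs_def])
qed

lemma bump_nonneg: "0 \<le> bump y0 \<rho> y"
  by (simp add: bump_def flat_def)

lemma bump_pos_iff:
  assumes "0 < \<rho>"
  shows "0 < bump y0 \<rho> y \<longleftrightarrow> dist y0 y < \<rho>"
proof -
  have "norm (y - y0) ^ 2 < \<rho>\<^sup>2 \<longleftrightarrow> norm (y - y0) < \<rho>"
    using power2_less_imp_less[of "norm (y - y0)" \<rho>] power_strict_mono[of "norm (y - y0)" \<rho> 2] assms by auto
  then show ?thesis
    by (simp add: bump_def flat_def dist_norm norm_minus_commute power2_norm_eq_inner)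
qed

lemma bump_eq_0: "0 < \<rho> \<Longrightarrow> \<rho> \<le> dist y0 y \<Longrightarrow> bump y0 \<rho> y = 0"
  using bump_pos_iff[of \<rho> y0 y] bump_nonneg[of y0 \<rho> y] by linarith

text \<open>The bound \<open>L\<close> exists because the derivative is continuous on \<open>{0..1}\<close> and vanishes elsewhere. It
  is an absolute constant: the same step is used on all manifolds and at all scales.\<close>

lemma smooth_step:
  obtains \<sigma> :: "real \<Rightarrow> real" and L where "L > 0" "smooth_on UNIV \<sigma>"
    "\<And>s. s \<le> 0 \<Longrightarrow> \<sigma> s = 0" "\<And>s. s \<ge> 1 \<Longrightarrow> \<sigma> s = 1" "\<And>s. 0 \<le> \<sigma> s \<and> \<sigma> s \<le> 1"
    "\<And>s v. \<bar>frechet_derivative \<sigma> (at s) v\<bar> \<le> L * \<bar>v\<bar>"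
proof -
  define \<sigma> where "\<sigma> = (\<lambda>s. flat 0 s / (flat 0 s + flat 0 (1 - s)))"
  have pos: "flat 0 s + flat 0 (1 - s) > 0" for s
    by (cases "s > 0") (auto simp: flat_def add_pos_nonneg add_nonneg_pos)
  have "smooth_on UNIV (\<lambda>s::real. 1 - s)"
    by (rule smooth_on_diff[OF open_UNIV smooth_on_const smooth_on_linear[OF bounded_linear_ident]])
  from smooth_on_compose[OF open_UNIV open_UNIV _ smooth_flat[of 0] this]
  have 1: "smooth_on UNIV (\<lambda>s. flat 0 (1 - s))" by simp
  have sm: "smooth_on UNIV \<sigma>"
    unfolding \<sigma>_def
  proof (rule smooth_on_divide[OF open_UNIV smooth_flat smooth_on_add[OF open_UNIV smooth_flat 1]])
    show "flat 0 s + flat 0 (1 - s) \<noteq> 0" for s using pos[of s] by linarith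
  qed
  have s0: "\<sigma> s = 0" if "s \<le> 0" for s using that by (simp add: \<sigma>_def flat_def)
  have s1: "\<sigma> s = 1" if "s \<ge> 1" for s using that by (simp add: \<sigma>_def flat_def)
  have rng: "0 \<le> \<sigma> s \<and> \<sigma> s \<le> 1" for s
    using pos[of s] by (simp add: \<sigma>_def flat_def divide_simps)
  let ?D = "\<lambda>s. frechet_derivative \<sigma> (at s)"
  have "continuous_on {0..1} (\<lambda>s. ?D s 1)"
    by (rule continuous_on_subset[OF smooth_on_imp_continuous_on[OF smooth_on_derivative[OF sm]]]) simp
  then have "bounded ((\<lambda>s. ?D s 1) ` {0..1})"
    by (intro compact_imp_bounded compact_continuous_image) auto
  then obtain B where "\<forall>d\<in>(\<lambda>s. ?D s 1) ` {0..1}. norm d \<le> B"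
    unfolding bounded_iff by blast
  then have B: "\<bar>?D s 1\<bar> \<le> B" if "s \<in> {0..1}" for s
    using that by auto
  have flat_out: "?D s = (\<lambda>v. 0)" if "s < 0 \<or> s > 1" for s
  proof -
    have "?D s = frechet_derivative (\<lambda>_. if s < 0 then 0 else 1) (at s)"
    proof (rule frechet_derivative_cong_open[of "if s < 0 then {..<0} else {1<..}"])
      show "\<sigma> y = (if s < 0 then 0 else 1)" if "y \<in> (if s < 0 then {..<0} else {1<..})" for y
        using that s0[of y] s1[of y] by (auto split: if_splits)
    qed (use that in auto)
    then show ?thesis by (simp add: frechet_derivative_const)
  qed
  have D1: "\<bar>?D s 1\<bar> \<le> max B 1" for s
    using B[of s] flat_out[of s] by (cases "s \<in> {0..1}") (auto simp: max_def)
  have "\<bar>?D s v\<bar> \<le> max B 1 * \<bar>v\<bar>" for s v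
  proof -
    have "linear (?D s)"
      using smooth_on_has_derivative[OF sm] has_derivative_linear by blast
    from linear_scale[OF this, of v 1] have "?D s v = v * ?D s 1" by simp
    then show ?thesis using mult_left_mono[OF D1[of s], of "\<bar>v\<bar>"] by (simp add: abs_mult mult.commute)
  qed
  then show ?thesis using that[of "max B 1" \<sigma>] sm s0 s1 rng by auto
qed

text \<open>Every derivative of a convolution can be moved to the smooth factor \<open>\<eta>\<close>, so \<open>u\<close> need only be
  continuous. The induction on the order is over all \<open>\<eta>\<close>.\<close>

lemma smooth_convolution:
  fixes u \<eta> :: "'a::euclidean_space \<Rightarrow> real"
  assumes "smooth_on UNIV \<eta>" "continuous_on (cbox a b) u"
  shows "smooth_on UNIV (\<lambda>y. integral (cbox a b) (\<lambda>t. \<eta> (y - t) * u t))"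
proof -
  have "Ck_on k UNIV (\<lambda>y. integral (cbox a b) (\<lambda>t. \<eta> (y - t) * u t))" if "smooth_on UNIV \<eta>" for k \<eta>
    using that
  proof (induction k arbitrary: \<eta>)
    case 0
    have c: "continuous_on UNIV \<eta>" using 0 by (rule smooth_on_imp_continuous_on)
    have "continuous_on (UNIV \<times> cbox a b) (\<lambda>(y, t). \<eta> (y - t) * u t)"
      unfolding split_beta
      by (intro continuous_intros continuous_on_compose2[OF c] continuous_on_compose2[OF assms(2)]) auto
    from integral_continuous_on_param[OF this] show ?case by simp
  next
    case (Suc k)
    have c: "continuous_on UNIV \<eta>" using Suc.prems by (rule smooth_on_imp_continuous_on)
    let ?D = "\<lambda>y. frechet_derivative \<eta> (at y)"
    have cD: "continuous_on UNIV (\<lambda>y. ?D y v)" for v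
      by (rule smooth_on_imp_continuous_on[OF smooth_on_derivative[OF Suc.prems]])
    have bl: "bounded_linear (\<lambda>v. ?D y v * c)" for y c
      by (rule bounded_linear_mult_const[OF has_derivative_bounded_linear[OF smooth_on_has_derivative[OF Suc.prems]]]) simp
    let ?fx = "\<lambda>y t. Blinfun (\<lambda>v. ?D (y - t) v * u t)"
    have fx: "blinfun_apply (?fx y t) v = ?D (y - t) v * u t" for y t v
      by (simp add: bounded_linear_Blinfun_apply[OF bl])
    have cf: "continuous_on (UNIV \<times> cbox a b) (\<lambda>(y, t). ?fx y t)"
      unfolding split_beta
    proof (rule continuous_on_blinfun_componentwise)
      fix i :: 'a
      show "continuous_on (UNIV \<times> cbox a b) (\<lambda>x. blinfun_apply (?fx (fst x) (snd x)) i)"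
        unfolding fx
        by (intro continuous_intros continuous_on_compose2[OF cD] continuous_on_compose2[OF assms(2)]) auto
    qed
    show ?case
    proof (rule Ck_on_SucI)
      fix y :: 'a
      have "((\<lambda>y. integral (cbox a b) (\<lambda>t. \<eta> (y - t) * u t)) has_derivative
          blinfun_apply (integral (cbox a b) (?fx y))) (at y within UNIV)"
      proof (rule leibniz_rule[where U = UNIV, OF _ _ cf])
        fix y t assume "t \<in> cbox a b"
        have "((\<lambda>y. y - t) has_derivative (\<lambda>v. v)) (at y)"
          by (auto intro!: derivative_eq_intros)
        from has_derivative_compose[OF this smooth_on_has_derivative[OF Suc.prems]]
        have "((\<lambda>y. \<eta> (y - t)) has_derivative (\<lambda>v. ?D (y - t) v)) (at y)" by simp
        then have "((\<lambda>y. \<eta> (y - t) * u t) has_derivative (\<lambda>v. ?D (y - t) v * u t)) (at y)"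
          by (rule has_derivative_mult_left)
        then show "((\<lambda>y. \<eta> (y - t) * u t) has_derivative blinfun_apply (?fx y t)) (at y within UNIV)"
          by (simp add: fx[abs_def])
      next
        fix y :: 'a
        show "(\<lambda>t. \<eta> (y - t) * u t) integrable_on cbox a b"
          by (intro integrable_continuous continuous_intros continuous_on_compose2[OF c] assms(2)) auto
      qed auto
      moreover have "blinfun_apply (integral (cbox a b) (?fx y)) v =
          integral (cbox a b) (\<lambda>t. ?D (y - t) v * u t)" for v
      proof -
        have "continuous_on (cbox a b) (?fx y)"
          using continuous_on_compose2[OF cf continuous_on_Pair[OF continuous_on_const[of "cbox a b" y] continuous_on_id]]
          by auto
        then have "?fx y integrable_on cbox a b" by (rule integrable_continuous)
        from blinfun_apply_integral[OF this] show ?thesis by (simp add: fx)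
      qed
      ultimately show "((\<lambda>y. integral (cbox a b) (\<lambda>t. \<eta> (y - t) * u t)) has_derivative
          (\<lambda>v. integral (cbox a b) (\<lambda>t. ?D (y - t) v * u t))) (at y)"
        by (rule has_derivative_eq_rhs[OF _ ext])
    next
      show "Ck_on k UNIV (\<lambda>y. integral (cbox a b) (\<lambda>t. ?D (y - t) v * u t))" for v
        by (rule Suc.IH[OF smooth_on_derivative[OF Suc.prems]])
    qed simp
  qed
  then show ?thesis using assms(1) by (simp only: smooth_on_def simp_thms)
qed

text \<open>\<open>N\<close> stands for the norm given by a metric tensor at a fixed point; by its homogeneity the bound on
  differences passes to the limit of the difference quotients.\<close>

lemma has_derivative_bound:
  fixes h :: "'a::real_normed_vector \<Rightarrow> real"
  assumes h: "(h has_derivative F) (at y)" and S: "open S" "y \<in> S"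
    and bd: "\<And>z. z \<in> S \<Longrightarrow> \<bar>h z - h y\<bar> \<le> N (z - y)"
    and N: "\<And>t v. N (t *\<^sub>R v) = \<bar>t\<bar> * N v"
  shows "\<bar>F v\<bar> \<le> N v"
proof -
  have "((\<lambda>t. y + t *\<^sub>R v) has_derivative (\<lambda>t. t *\<^sub>R v)) (at (0::real))"
    by (auto intro!: derivative_eq_intros)
  from has_derivative_compose[OF this, of h F] h
  have "((\<lambda>t. h (y + t *\<^sub>R v)) has_derivative (\<lambda>t. F (t *\<^sub>R v))) (at 0)" by simp
  moreover have "(\<lambda>t. F (t *\<^sub>R v)) = (*) (F v)"
    using linear_scale[OF has_derivative_linear[OF h]] by (auto simp: mult.commute)
  ultimately have "((\<lambda>t. h (y + t *\<^sub>R v)) has_real_derivative F v) (at 0)"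
    by (simp add: has_field_derivative_def)
  then have lim: "((\<lambda>t. \<bar>(h (y + t *\<^sub>R v) - h y) / t\<bar>) \<longlongrightarrow> \<bar>F v\<bar>) (at 0)"
    by (intro tendsto_rabs) (simp add: has_field_derivative_iff)
  have "((\<lambda>t. y + t *\<^sub>R v) \<longlongrightarrow> y + 0 *\<^sub>R v) (at (0::real))"
    by (intro tendsto_intros)
  then have "\<forall>\<^sub>F t in at (0::real). y + t *\<^sub>R v \<in> S"
    using topological_tendstoD[of _ y "at 0" S] S by simp
  then have "\<forall>\<^sub>F t in at 0. \<bar>(h (y + t *\<^sub>R v) - h y) / t\<bar> \<le> N v"
    using eventually_neq_at_within[of 0 "0::real" UNIV]
  proof eventually_elim
    case (elim t)
    have "\<bar>h (y + t *\<^sub>R v) - h y\<bar> \<le> \<bar>t\<bar> * N v"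
      using bd[OF elim(1)] N[of t v] by simp
    then show ?case using elim(2) by (simp add: divide_simps mult.commute)
  qed
  then show ?thesis
    using tendsto_upperbound[OF lim] by simp
qed

lemma has_integral_abs_le:
  fixes f g :: "'a::euclidean_space \<Rightarrow> real"
  assumes "(f has_integral i) S" "(g has_integral j) S" "\<And>x. x \<in> S \<Longrightarrow> \<bar>f x\<bar> \<le> g x"
  shows "\<bar>i\<bar> \<le> j"
proof -
  have "i \<le> j" using has_integral_le[OF assms(1,2)] assms(3) by force
  moreover have "- i \<le> j" using has_integral_le[OF has_integral_neg[OF assms(1)] assms(2)] assms(3) by force
  ultimately show ?thesis by linarith
qed

text \<open>Convolution with a bump is an average of translates of \<open>u\<close>, so it inherits every bound on
  the differences of \<open>u\<close>, whatever the norm \<open>N\<close> that measures them.\<close>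

lemma mollify:
  fixes u N :: "'a::euclidean_space \<Rightarrow> real"
  assumes \<rho>: "\<rho> > 0" and box: "cball y0 (2 * \<rho>) \<subseteq> cbox a b"
    and lip: "\<And>y z. y \<in> cbox a b \<Longrightarrow> z \<in> cbox a b \<Longrightarrow> \<bar>u y - u z\<bar> \<le> N (y - z)"
    and N: "\<And>t v. N (t *\<^sub>R v) = \<bar>t\<bar> * N v" and NK: "\<And>v. N v \<le> K * norm v" and e: "e > 0"
  obtains h where "smooth_on UNIV h" "\<And>y. y \<in> ball y0 \<rho> \<Longrightarrow> \<bar>h y - u y\<bar> \<le> e"
    "\<And>y v. y \<in> ball y0 \<rho> \<Longrightarrow> \<bar>frechet_derivative h (at y) v\<bar> \<le> N v"
proof -
  define K' where "K' = max K 1"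
  have NK': "N v \<le> K' * norm v" for v
    using NK[of v] mult_right_mono[of K K' "norm v"] by (auto simp: K'_def)
  have K': "K' > 0" by (auto simp: K'_def)
  have cu: "continuous_on (cbox a b) u"
    unfolding continuous_on_iff
  proof (intro ballI allI impI)
    fix x and \<epsilon> :: real assume x: "x \<in> cbox a b" and "\<epsilon> > 0"
    have "dist (u x') (u x) < \<epsilon>" if "x' \<in> cbox a b" "dist x' x < \<epsilon> / K'" for x'
    proof -
      have "K' * norm (x' - x) < \<epsilon>"
        using that(2) K' by (simp add: dist_norm pos_less_divide_eq mult.commute)
      then show ?thesis
        unfolding dist_norm real_norm_def using lip[OF that(1) x] NK'[of "x' - x"] by linarith
    qed
    then show "\<exists>d>0. \<forall>x'\<in>cbox a b. dist x' x < d \<longrightarrow> dist (u x') (u x) < \<epsilon>"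
      using \<open>\<epsilon> > 0\<close> K' by (meson divide_pos_pos)
  qed
  (* Translates by less than \<rho> stay inside the box, and translating by \<delta> changes u by at most e. *)
  define \<delta> where "\<delta> = min \<rho> (e / K')"
  have \<delta>: "\<delta> > 0" "\<delta> \<le> \<rho>" "K' * \<delta> \<le> e"
    using \<rho> e K' by (auto simp: \<delta>_def min_def field_simps)
  define \<eta> where "\<eta> = bump (0::'a) \<delta>"
  define Q where "Q = cbox (- \<delta> *\<^sub>R One) (\<delta> *\<^sub>R One :: 'a)"
  have \<eta>0: "\<eta> s \<ge> 0" for s by (simp add: \<eta>_def bump_nonneg)
  have \<eta>supp: "norm s < \<delta>" if "\<eta> s \<noteq> 0" for s
    using that bump_eq_0[OF \<delta>(1), of 0 s] by (force simp: \<eta>_def)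
  have inQ: "s \<in> Q" if "norm s < \<delta>" for s
    using that Basis_le_norm[of _ s] by (force simp: Q_def mem_box abs_le_iff)
  have c\<eta>: "continuous_on A \<eta>" for A
    using continuous_on_subset[OF smooth_on_imp_continuous_on[OF smooth_bump]] by (auto simp: \<eta>_def)
  define Z where "Z = integral Q \<eta>"
  have IZ: "(\<eta> has_integral Z) Q"
    unfolding Z_def Q_def by (intro integrable_integral integrable_continuous c\<eta>)
  have "Z \<ge> 0" unfolding Z_def by (rule integral_nonneg) (use IZ \<eta>0 in auto)
  moreover have "Z \<noteq> 0"
  proof
    assume "Z = 0"
    have 0: "(0::'a) \<in> box (- \<delta> *\<^sub>R One) (\<delta> *\<^sub>R One)" using \<delta>(1) by (simp add: mem_box)
    then have "\<eta> 0 = 0"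
      using has_integral_0_cbox_imp_0[of "- \<delta> *\<^sub>R One" "\<delta> *\<^sub>R One" \<eta> 0] IZ \<eta>0 \<open>Z = 0\<close> c\<eta> box_subset_cbox
      unfolding Q_def by blast
    moreover have "\<eta> 0 > 0" using \<delta>(1) bump_pos_iff[of \<delta> 0 0] by (simp add: \<eta>_def)
    ultimately show False by simp
  qed
  ultimately have Z: "Z > 0" by simp
  define u' where "u' = (\<lambda>t. if t \<in> cbox a b then u t else 0)"
  define G where "G = (\<lambda>y. integral (cbox a b) (\<lambda>t. \<eta> (y - t) * u t))"
  have smG: "smooth_on UNIV G"
    unfolding G_def \<eta>_def by (rule smooth_convolution[OF smooth_bump cu])
  (* Substituting s = y - t turns the convolution into an average of translates of u. *)
  have shift: "((\<lambda>s. \<eta> s * u' (y - s)) has_integral G y) Q" for y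
  proof -
    let ?f = "\<lambda>t. \<eta> (y - t) * u' t"
    have "((\<lambda>t. \<eta> (y - t) * u t) has_integral G y) (cbox a b)"
      unfolding G_def
      by (intro integrable_integral integrable_continuous continuous_intros continuous_on_compose2[OF c\<eta>] cu) auto
    then have "(?f has_integral G y) (cbox a b)"
      by (rule has_integral_eq[rotated]) (simp add: u'_def)
    then have U: "(?f has_integral G y) UNIV"
      by (rule has_integral_on_superset) (auto simp: u'_def)
    let ?P = "cbox (y - \<delta> *\<^sub>R One) (y + \<delta> *\<^sub>R One)"
    have "?f t = 0" if "t \<notin> ?P" for t
    proof (rule ccontr)
      assume "?f t \<noteq> 0"
      then have "y - t \<in> Q" using \<eta>supp inQ by auto
      then have "t \<in> ?P" by (force simp: Q_def mem_box algebra_simps)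
      then show False using that by simp
    qed
    then have "(\<lambda>t. if t \<in> ?P then ?f t else 0) = ?f" by auto
    then have "(?f has_integral G y) ?P"
      using U has_integral_restrict_UNIV[of ?P ?f "G y"] by simp
    from has_integral_affinity[OF this, of "-1" y]
    have "((\<lambda>s. ?f (- s + y)) has_integral G y) ((\<lambda>s. - s + y) ` ?P)" by simp
    moreover have "(\<lambda>s. - s + y) ` ?P = Q"
    proof
      show "(\<lambda>s. - s + y) ` ?P \<subseteq> Q" by (force simp: Q_def mem_box algebra_simps)
      show "Q \<subseteq> (\<lambda>s. - s + y) ` ?P"
      proof
        fix s assume "s \<in> Q"
        then have "y - s \<in> ?P" by (force simp: Q_def mem_box algebra_simps)
        then show "s \<in> (\<lambda>s. - s + y) ` ?P" by (rule image_eqI[rotated]) simp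
      qed
    qed
    ultimately show ?thesis by simp
  qed
  have near: "y - s \<in> cbox a b" if "y \<in> ball y0 \<rho>" "norm s \<le> \<delta>" for y s
  proof -
    have "dist y0 (y - s) \<le> dist y0 y + dist y (y - s)" by (rule dist_triangle)
    then have "y - s \<in> cball y0 (2 * \<rho>)" using that \<delta>(2) by (auto simp: dist_norm)
    then show ?thesis using box by blast
  qed
  have near0: "y \<in> cbox a b" if "y \<in> ball y0 \<rho>" for y
    using near[OF that, of 0] \<delta>(1) by simp
  have lipG: "\<bar>G y - G z\<bar> \<le> N (y - z) * Z" if yz: "y \<in> ball y0 \<rho>" "z \<in> ball y0 \<rho>" for y z
  proof (rule has_integral_abs_le)
    show "((\<lambda>s. \<eta> s * u' (y - s) - \<eta> s * u' (z - s)) has_integral G y - G z) Q"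
      by (intro has_integral_diff shift)
    show "((\<lambda>s. N (y - z) * \<eta> s) has_integral N (y - z) * Z) Q"
      by (rule has_integral_mult_right[OF IZ])
    fix s
    show "\<bar>\<eta> s * u' (y - s) - \<eta> s * u' (z - s)\<bar> \<le> N (y - z) * \<eta> s"
    proof (cases "\<eta> s = 0")
      case False
      then have "norm s \<le> \<delta>" using \<eta>supp by force
      then have "\<bar>u' (y - s) - u' (z - s)\<bar> \<le> N (y - z)"
        using near[OF yz(1)] near[OF yz(2)] lip[of "y - s" "z - s"] by (simp add: u'_def)
      then have "\<eta> s * \<bar>u' (y - s) - u' (z - s)\<bar> \<le> \<eta> s * N (y - z)"
        by (rule mult_left_mono[OF _ \<eta>0])
      moreover have "\<bar>\<eta> s * u' (y - s) - \<eta> s * u' (z - s)\<bar> = \<eta> s * \<bar>u' (y - s) - u' (z - s)\<bar>"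
        using \<eta>0[of s] by (simp add: abs_mult right_diff_distrib[symmetric])
      ultimately show ?thesis by (simp add: mult.commute)
    qed simp
  qed
  have apprG: "\<bar>G y - u y * Z\<bar> \<le> e * Z" if y: "y \<in> ball y0 \<rho>" for y
  proof (rule has_integral_abs_le)
    show "((\<lambda>s. \<eta> s * u' (y - s) - u y * \<eta> s) has_integral G y - u y * Z) Q"
      by (intro has_integral_diff shift has_integral_mult_right[OF IZ])
    show "((\<lambda>s. e * \<eta> s) has_integral e * Z) Q"
      by (rule has_integral_mult_right[OF IZ])
    fix s
    show "\<bar>\<eta> s * u' (y - s) - u y * \<eta> s\<bar> \<le> e * \<eta> s"
    proof (cases "\<eta> s = 0")
      case False
      then have s: "norm s \<le> \<delta>" using \<eta>supp by force
      have "\<bar>u' (y - s) - u y\<bar> \<le> N (- s)"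
        using near[OF y s] near0[OF y] lip[of "y - s" y] by (simp add: u'_def)
      also have "\<dots> \<le> K' * norm s" using NK'[of "- s"] by simp
      also have "\<dots> \<le> e" using \<delta>(3) mult_left_mono[OF s, of K'] K' by linarith
      finally have "\<eta> s * \<bar>u' (y - s) - u y\<bar> \<le> \<eta> s * e"
        by (rule mult_left_mono[OF _ \<eta>0])
      moreover have "\<bar>\<eta> s * u' (y - s) - u y * \<eta> s\<bar> = \<eta> s * \<bar>u' (y - s) - u y\<bar>"
        using \<eta>0[of s] by (simp add: abs_mult right_diff_distrib[symmetric] mult.commute[of "u y"])
      ultimately show ?thesis by (simp add: mult.commute)
    qed simp
  qed
  define h where "h = (\<lambda>y. (1 / Z) * G y)"
  have smh: "smooth_on UNIV h"
    unfolding h_def by (rule smooth_on_mult[OF open_UNIV smooth_on_const smG])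
  show ?thesis
  proof (rule that[OF smh])
    fix y assume y: "y \<in> ball y0 \<rho>"
    have "\<bar>h y - u y\<bar> = \<bar>G y - u y * Z\<bar> / Z"
      using Z by (simp add: h_def field_simps abs_divide flip: abs_mult) 
    then have "\<bar>h y - u y\<bar> \<le> e * Z / Z"
      using divide_right_mono[OF apprG[OF y], of Z] Z by simp
    then show "\<bar>h y - u y\<bar> \<le> e" using Z by simp
    fix v
    show "\<bar>frechet_derivative h (at y) v\<bar> \<le> N v"
    proof (rule has_derivative_bound[OF smooth_on_has_derivative[OF smh UNIV_I] open_ball y _ N])
      fix z assume z: "z \<in> ball y0 \<rho>"
      have "\<bar>h z - h y\<bar> = \<bar>G z - G y\<bar> / Z"
        using Z by (simp add: h_def abs_divide flip: diff_divide_distrib)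
      also have "\<dots> \<le> N (z - y) * Z / Z"
        using divide_right_mono[OF lipG[OF z y], of Z] Z by simp
      finally show "\<bar>h z - h y\<bar> \<le> N (z - y)" using Z by simp
    qed
  qed
qed


section \<open>Charts\<close>

lemma norm_matrix_vector_mult_le:
  fixes A :: "real ^ 'n ^ 'm"
  shows "norm (A *v v) \<le> norm A * norm v"
proof -
  have "norm ((A *v v) $ i) \<le> norm (A $ i) * norm v" for i
  proof -
    have "(A *v v) $ i = A $ i \<bullet> v"
      by (simp add: matrix_vector_mult_def inner_vec_def)
    then show ?thesis using Cauchy_Schwarz_ineq2[of "A $ i" v] by simp
  qed
  then have "L2_set (\<lambda>i. norm ((A *v v) $ i)) UNIV \<le> L2_set (\<lambda>i. norm (A $ i) * norm v) UNIV"
    by (intro L2_set_mono) auto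
  also have "\<dots> = norm A * norm v"
    by (simp add: L2_set_left_distrib norm_vec_def)
  finally show ?thesis by (simp add: norm_vec_def)
qed

text \<open>Along the segment from the identity the determinant of a positive definite matrix never
  vanishes, so it keeps the sign that it has at the identity.\<close>

lemma det_positive_definite:
  fixes A :: "real ^ 'n ^ 'n"
  assumes "\<And>v. v \<noteq> 0 \<Longrightarrow> v \<bullet> (A *v v) > 0"
  shows "det A > 0"
proof (rule ccontr)
  assume neg: "\<not> det A > 0"
  define f where "f = (\<lambda>t::real. det ((1 - t) *\<^sub>R mat 1 + t *\<^sub>R A))"
  have "continuous_on {0..1} f"
    unfolding f_def det_def by (intro continuous_intros continuous_on_component)
  moreover have "f 1 \<le> 0" "f 0 = 1" using neg by (auto simp: f_def)
  ultimately obtain t where t: "0 \<le> t" "t \<le> 1" "f t = 0"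
    using IVT2'[of f 1 0 0] by auto
  let ?B = "(1 - t) *\<^sub>R mat 1 + t *\<^sub>R A"
  have "\<not> invertible ?B" using t(3) by (simp add: f_def invertible_det_nz)
  then obtain v where v: "v \<noteq> 0" "?B *v v = 0"
    using matrix_left_invertible_ker[of ?B] invertible_left_inverse[of ?B] by auto
  have "v \<bullet> (?B *v v) = (1 - t) * (v \<bullet> v) + t * (v \<bullet> (A *v v))"
    by (simp add: matrix_vector_mult_add_rdistrib inner_add_right scaleR_matrix_vector_assoc[symmetric])
  moreover have "0 < (1 - t) * (v \<bullet> v) + t * (v \<bullet> (A *v v))"
  proof (cases "t = 0")
    case False
    then have "t * (v \<bullet> (A *v v)) > 0" using t(1) assms[OF v(1)] by simp
    then show ?thesis using t(2) by (simp add: add_nonneg_pos)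
  qed (use v(1) in simp)
  ultimately show False using v(2) by simp
qed

locale riemannian =
  fixes M :: "('m, 'n::finite) rmanifold"
  assumes riemannian: "riemannian_manifold M"
begin

abbreviation T where "T \<equiv> mtop M"

lemma smooth_manifold: "smooth_manifold M"
  using riemannian by (simp add: riemannian_manifold_def)

lemma Hausdorff: "Hausdorff_space T" and second_countable: "second_countable T"
  and connected: "connected_space T" and atlas_cover: "(\<Union>c\<in>atlas M. fst c) = points M"
  using smooth_manifold by (auto simp: smooth_manifold_def)

lemma is_chart: "c \<in> atlas M \<Longrightarrow> is_chart T c"
  using smooth_manifold by (auto simp: smooth_manifold_def)

lemma chart_open: "c \<in> atlas M \<Longrightarrow> openin T (fst c)"
  and image_open: "c \<in> atlas M \<Longrightarrow> open (snd c ` fst c)"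
  and chart_homeo: "c \<in> atlas M \<Longrightarrow>
    homeomorphic_map (subtopology T (fst c)) (top_of_set (snd c ` fst c)) (snd c)"
  using is_chart by (auto simp: is_chart_def)

lemma topspace_chart: "c \<in> atlas M \<Longrightarrow> topspace (subtopology T (fst c)) = fst c"
  using openin_subset[OF chart_open[of c]] by (auto simp: topspace_subtopology)

lemma chart_inj: "c \<in> atlas M \<Longrightarrow> inj_on (snd c) (fst c)"
  using homeomorphic_imp_injective_map[OF chart_homeo[of c]] topspace_chart[of c] by simp

lemma cinv_snd: "c \<in> atlas M \<Longrightarrow> x \<in> fst c \<Longrightarrow> cinv c (snd c x) = x"
  using chart_inj by (simp add: cinv_def)

lemma snd_cinv: "y \<in> snd c ` fst c \<Longrightarrow> snd c (cinv c y) = y"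
  and cinv_in: "y \<in> snd c ` fst c \<Longrightarrow> cinv c y \<in> fst c"
  by (simp_all add: cinv_def f_inv_into_f inv_into_into)

lemma snd_image_cinv: "V \<subseteq> snd c ` fst c \<Longrightarrow> snd c ` (cinv c ` V) = V"
  by (simp add: cinv_def image_inv_into_cancel)

lemma in_cinv_image_iff:
  "c \<in> atlas M \<Longrightarrow> V \<subseteq> snd c ` fst c \<Longrightarrow> x \<in> cinv c ` V \<longleftrightarrow> x \<in> fst c \<and> snd c x \<in> V"
  using cinv_in[of _ c] snd_cinv[of _ c] cinv_snd[of c x] by (auto simp: subset_iff image_iff) metis

lemma snd_continuous: "c \<in> atlas M \<Longrightarrow> continuous_map (subtopology T (fst c)) euclidean (snd c)"
  using homeomorphic_imp_continuous_map[OF chart_homeo[of c]] by (simp add: continuous_map_in_subtopology)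

lemma open_snd_image:
  assumes "c \<in> atlas M" "openin T U" "U \<subseteq> fst c"
  shows "open (snd c ` U)"
proof -
  have "openin (subtopology T (fst c)) U"
    using assms openin_open_subtopology[OF chart_open[OF assms(1)]] by simp
  then have "openin (top_of_set (snd c ` fst c)) (snd c ` U)"
    using homeomorphic_imp_open_map[OF chart_homeo[OF assms(1)]] by (simp add: open_map_def)
  then show ?thesis using image_open[OF assms(1)] by (meson openin_open_trans)
qed

lemma open_cinv_image:
  assumes c: "c \<in> atlas M" and V: "open V" "V \<subseteq> snd c ` fst c"
  shows "openin T (cinv c ` V)"
proof -
  have "openin (subtopology T (fst c)) {x \<in> topspace (subtopology T (fst c)). snd c x \<in> V}"
    by (rule openin_continuous_map_preimage[OF snd_continuous[OF c]]) (simp add: V(1))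
  moreover have "{x \<in> topspace (subtopology T (fst c)). snd c x \<in> V} = cinv c ` V"
    using in_cinv_image_iff[OF c V(2)] topspace_chart[OF c] by auto
  ultimately show ?thesis using openin_open_subtopology[OF chart_open[OF c]] by simp
qed

lemma cinv_continuous:
  assumes c: "c \<in> atlas M"
  shows "continuous_map (top_of_set (snd c ` fst c)) T (cinv c)"
  unfolding continuous_map
proof (intro conjI allI impI)
  show "cinv c ` topspace (top_of_set (snd c ` fst c)) \<subseteq> topspace T"
    using cinv_in[of _ c] openin_subset[OF chart_open[OF c]] by auto
  fix U assume U: "openin T U"
  then have "openin T (U \<inter> fst c)" using chart_open[OF c] by (rule openin_Int)
  from open_snd_image[OF c this] have "open (snd c ` (U \<inter> fst c))" by simp
  moreover have "{y \<in> topspace (top_of_set (snd c ` fst c)). cinv c y \<in> U} = snd c ` (U \<inter> fst c)"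
    using cinv_snd[OF c] by force
  ultimately show "openin (top_of_set (snd c ` fst c)) {y \<in> topspace (top_of_set (snd c ` fst c)). cinv c y \<in> U}"
    using image_open[OF c] by (auto simp: openin_open_eq)
qed

lemma ex_chart: "x \<in> points M \<Longrightarrow> \<exists>c. c \<in> atlas M \<and> x \<in> fst c"
  using atlas_cover by blast

lemma chart_at: "x \<in> points M \<Longrightarrow> chart_at M x \<in> atlas M \<and> x \<in> fst (chart_at M x)"
  unfolding chart_at_def using someI_ex[OF ex_chart] by blast

lemma chart_points: "c \<in> atlas M \<Longrightarrow> x \<in> fst c \<Longrightarrow> x \<in> points M"
  using atlas_cover by blast


subsection \<open>Transition maps\<close>

abbreviation trans where "trans c c' \<equiv> snd c' \<circ> cinv c"

definition dtrans :: "('m, 'n) chart \<Rightarrow> ('m, 'n) chart \<Rightarrow> 'm \<Rightarrow> real ^ 'n \<Rightarrow> real ^ 'n" where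
  "dtrans c c' x = frechet_derivative (trans c c') (at (snd c x))"

context
  fixes c c' assumes c: "c \<in> atlas M" and c': "c' \<in> atlas M"
begin

lemma trans_smooth: "smooth_on (snd c ` (fst c \<inter> fst c')) (trans c c')"
  using smooth_manifold c c' by (simp add: smooth_manifold_def)

lemma trans_derivative:
  "x \<in> fst c \<Longrightarrow> x \<in> fst c' \<Longrightarrow> (trans c c' has_derivative dtrans c c' x) (at (snd c x))"
  unfolding dtrans_def using smooth_on_has_derivative[OF trans_smooth] by simp

lemma jacobian_mult:
  assumes "x \<in> fst c" "x \<in> fst c'"
  shows "jacobian c c' x *v v = dtrans c c' x v"
  using matrix_vector_mul(2)[OF has_derivative_linear[OF trans_derivative[OF assms]]]
  by (simp add: jacobian_def dtrans_def fun_eq_iff)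

lemma gmat_trans: "x \<in> fst c \<Longrightarrow> x \<in> fst c' \<Longrightarrow>
    gmat M c x = transpose (jacobian c c' x) ** gmat M c' x ** jacobian c c' x"
  using riemannian c c' unfolding riemannian_manifold_def by blast

lemma gnorm_trans:
  assumes "x \<in> fst c" "x \<in> fst c'"
  shows "gnorm M c x v = gnorm M c' x (dtrans c c' x v)"
proof -
  let ?J = "jacobian c c' x"
  have "v \<bullet> (gmat M c x *v v) = v \<bullet> (transpose ?J *v (gmat M c' x *v (?J *v v)))"
    by (simp add: gmat_trans[OF assms] matrix_vector_mul_assoc matrix_mul_assoc)
  also have "\<dots> = (?J *v v) \<bullet> (gmat M c' x *v (?J *v v))"
    by (metis dot_lmul_matrix inner_commute transpose_matrix_vector)
  finally show ?thesis by (simp add: gnorm_def jacobian_mult[OF assms])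
qed

end


subsection \<open>The metric in a chart\<close>

lemma gmat_pos: "c \<in> atlas M \<Longrightarrow> x \<in> fst c \<Longrightarrow> v \<noteq> 0 \<Longrightarrow> v \<bullet> (gmat M c x *v v) > 0"
  using riemannian unfolding riemannian_manifold_def by blast

lemma gmat_nonneg: "c \<in> atlas M \<Longrightarrow> x \<in> fst c \<Longrightarrow> v \<bullet> (gmat M c x *v v) \<ge> 0"
  using gmat_pos[of c x v] by (cases "v = 0") auto

lemma gmat_smooth: "c \<in> atlas M \<Longrightarrow> smooth_on (snd c ` fst c) (\<lambda>y. gmat M c (cinv c y))"
  using riemannian unfolding riemannian_manifold_def by blast

lemma gmat_continuous: "c \<in> atlas M \<Longrightarrow> continuous_on (snd c ` fst c) (\<lambda>y. gmat M c (cinv c y))"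
  by (rule smooth_on_imp_continuous_on[OF gmat_smooth])

lemma gnorm_nonneg: "c \<in> atlas M \<Longrightarrow> x \<in> fst c \<Longrightarrow> gnorm M c x v \<ge> 0"
  using gmat_nonneg by (simp add: gnorm_def)

lemma gnorm_scale: "gnorm M c x (t *\<^sub>R v) = \<bar>t\<bar> * gnorm M c x v"
proof -
  have "(t *\<^sub>R v) \<bullet> (gmat M c x *v (t *\<^sub>R v)) = t\<^sup>2 * (v \<bullet> (gmat M c x *v v))"
    by (simp add: matrix_vector_mult_scaleR power2_eq_square)
  then show ?thesis by (simp add: gnorm_def real_sqrt_mult)
qed

lemma gnorm_continuous:
  assumes "c \<in> atlas M" "continuous_on S g" "f ` S \<subseteq> fst c"
    "continuous_on S (snd c \<circ> f)"
  shows "continuous_on S (\<lambda>t. gnorm M c (f t) (g t))"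
proof -
  have "continuous_on S (\<lambda>t. gmat M c (cinv c ((snd c \<circ> f) t)))"
    by (rule continuous_on_compose2[OF gmat_continuous[OF assms(1)] assms(4)]) (use assms(3) in auto)
  then have "continuous_on S (\<lambda>t. gmat M c (f t))"
    by (rule continuous_on_eq) (use assms(3) cinv_snd[OF assms(1)] in auto)
  then show ?thesis
    unfolding gnorm_def matrix_vector_mult_def inner_vec_def
    by (intro continuous_intros continuous_on_component assms(2)) 
qed

text \<open>By compactness of the unit sphere the metric at \<open>x\<close> is bounded below by a positive multiple of the
  Euclidean one; continuity of the metric tensor then gives the comparison nearby.\<close>

lemma gnorm_compare:
  assumes c: "c \<in> atlas M" and x: "x \<in> fst c"
  obtains \<rho> k K where "\<rho> > 0" "k > 0" "K > 0" "ball (snd c x) \<rho> \<subseteq> snd c ` fst c"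
    "\<And>y v. y \<in> ball (snd c x) \<rho> \<Longrightarrow> k * norm v \<le> gnorm M c (cinv c y) v"
    "\<And>y v. y \<in> ball (snd c x) \<rho> \<Longrightarrow> gnorm M c (cinv c y) v \<le> K * norm v"
    "\<And>y v. y \<in> ball (snd c x) \<rho> \<Longrightarrow> gnorm M c (cinv c y) v \<le> 2 * gnorm M c x v"
    "\<And>y v. y \<in> ball (snd c x) \<rho> \<Longrightarrow> gnorm M c x v \<le> 2 * gnorm M c (cinv c y) v"
proof -
  let ?G = "\<lambda>y. gmat M c (cinv c y)" and ?y0 = "snd c x"
  define Q where "Q = (\<lambda>A (v::real^'n). v \<bullet> (A *v v))"
  have Gx: "?G ?y0 = gmat M c x" by (simp add: cinv_snd[OF c x])
  have Qs: "Q A (t *\<^sub>R v) = t\<^sup>2 * Q A v" for A t v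
    by (simp add: Q_def matrix_vector_mult_scaleR power2_eq_square)
  have "continuous_on (sphere 0 1) (Q (gmat M c x))"
    unfolding Q_def by (intro continuous_intros linear_continuous_on matrix_vector_mul_bounded_linear)
  moreover have "sphere (0::real^'n) 1 \<noteq> {}" by simp
  ultimately obtain v0 where v0: "v0 \<in> sphere 0 1" "\<And>v. v \<in> sphere 0 1 \<Longrightarrow> Q (gmat M c x) v0 \<le> Q (gmat M c x) v"
    using continuous_attains_inf[OF compact_sphere] by metis
  define m where "m = Q (gmat M c x) v0"
  have m: "m > 0" using gmat_pos[OF c x, of v0] v0(1) by (cases "v0 = 0") (auto simp: m_def Q_def)
  have lower: "m * (norm v)\<^sup>2 \<le> Q (gmat M c x) v" for v
  proof (cases "v = 0")
    case False
    have "m \<le> Q (gmat M c x) ((1 / norm v) *\<^sub>R v)"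
      unfolding m_def by (rule v0(2)) (use False in simp)
    then show ?thesis using False by (simp add: Qs field_simps)
  qed (simp add: Q_def)
  have Qle: "\<bar>Q A v\<bar> \<le> norm A * (norm v)\<^sup>2" for A v
  proof -
    have "\<bar>Q A v\<bar> \<le> norm v * norm (A *v v)" unfolding Q_def by (rule Cauchy_Schwarz_ineq2)
    also have "\<dots> \<le> norm v * (norm A * norm v)"
      by (intro mult_left_mono norm_matrix_vector_mult_le) auto
    finally show ?thesis by (simp add: power2_eq_square mult_ac)
  qed
  have io: "open (snd c ` fst c)" "?y0 \<in> snd c ` fst c" using image_open[OF c] x by auto
  have "isCont ?G ?y0"
    using gmat_continuous[OF c] io continuous_on_eq_continuous_at by blast
  then obtain \<rho>1 where \<rho>1: "\<rho>1 > 0" "\<And>y. dist y ?y0 < \<rho>1 \<Longrightarrow> dist (?G y) (?G ?y0) < 3 / 4 * m"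
    unfolding continuous_at_eps_delta using m by (metis mult_pos_pos zero_less_divide_iff zero_less_numeral)
  obtain \<rho>2 where \<rho>2: "\<rho>2 > 0" "ball ?y0 \<rho>2 \<subseteq> snd c ` fst c"
    using io open_contains_ball by blast
  define \<rho> where "\<rho> = min \<rho>1 \<rho>2"
  have near: "\<bar>Q (?G y) v - Q (gmat M c x) v\<bar> \<le> 3 / 4 * Q (gmat M c x) v" if "y \<in> ball ?y0 \<rho>" for y v
  proof -
    have "\<bar>Q (?G y) v - Q (gmat M c x) v\<bar> = \<bar>Q (?G y - ?G ?y0) v\<bar>"
      by (simp add: Q_def Gx matrix_vector_mult_diff_rdistrib inner_diff_right)
    also have "\<dots> \<le> norm (?G y - ?G ?y0) * (norm v)\<^sup>2" by (rule Qle)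
    also have "\<dots> \<le> (3 / 4 * m) * (norm v)\<^sup>2"
      using \<rho>1(2)[of y] that by (intro mult_right_mono) (auto simp: \<rho>_def dist_norm norm_minus_commute)
    also have "\<dots> \<le> 3 / 4 * Q (gmat M c x) v" using lower[of v] by simp
    finally show ?thesis .
  qed
  have N: "gnorm M c z v = sqrt (Q (gmat M c z) v)" for z v by (simp add: gnorm_def Q_def)
  have Q0: "0 \<le> Q (gmat M c x) v" for v using gmat_nonneg[OF c x] by (simp add: Q_def)
  have up: "gnorm M c (cinv c y) v \<le> 2 * gnorm M c x v" if "y \<in> ball ?y0 \<rho>" for y v
  proof -
    have "Q (?G y) v \<le> 2\<^sup>2 * Q (gmat M c x) v" using near[OF that, of v] Q0[of v] unfolding power2_eq_square by linarith
    then show ?thesis unfolding N by (metis real_sqrt_le_mono real_sqrt_mult real_sqrt_abs abs_numeral)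
  qed
  have lo: "gnorm M c x v \<le> 2 * gnorm M c (cinv c y) v" if "y \<in> ball ?y0 \<rho>" for y v
  proof -
    have "Q (gmat M c x) v \<le> 2\<^sup>2 * Q (?G y) v" using near[OF that, of v] Q0[of v] unfolding power2_eq_square by linarith
    then show ?thesis unfolding N by (metis real_sqrt_le_mono real_sqrt_mult real_sqrt_abs abs_numeral)
  qed
  have klow: "sqrt m * norm v \<le> gnorm M c x v" for v
    unfolding N using real_sqrt_le_mono[OF lower[of v]] by (simp add: real_sqrt_mult)
  have Kup: "gnorm M c x v \<le> sqrt (norm (gmat M c x)) * norm v" for v
    unfolding N using real_sqrt_le_mono[of "Q (gmat M c x) v" "norm (gmat M c x) * (norm v)\<^sup>2"] Qle[of "gmat M c x" v]
    by (simp add: real_sqrt_mult)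
  show ?thesis
  proof (rule that)
    show "\<rho> > 0" "ball ?y0 \<rho> \<subseteq> snd c ` fst c" using \<rho>1(1) \<rho>2 by (auto simp: \<rho>_def)
    show "sqrt m / 2 > 0" "2 * sqrt (norm (gmat M c x)) + 1 > 0"
      using m real_sqrt_ge_zero[OF norm_ge_zero[of "gmat M c x"]] by (auto intro: add_nonneg_pos)
    fix y v assume y: "y \<in> ball ?y0 \<rho>"
    show "sqrt m / 2 * norm v \<le> gnorm M c (cinv c y) v" using klow[of v] lo[OF y, of v] by simp
    show "gnorm M c (cinv c y) v \<le> (2 * sqrt (norm (gmat M c x)) + 1) * norm v"
      using Kup[of v] up[OF y, of v] by (simp add: distrib_right) (use norm_ge_zero[of v] in linarith)
  qed (use up lo in auto)
qed

end


context riemannian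
begin

section \<open>Curves and their length\<close>

lemma C1_curve_on_continuous: "C1_curve_on M a b \<gamma> \<Longrightarrow> continuous_map (top_of_set {a..b}) T \<gamma>"
  unfolding C1_curve_on_def by (rule conjunct1)

lemma C1_curve_onE:
  assumes "C1_curve_on M a b \<gamma>" "c \<in> atlas M"
  obtains D where "continuous_on {t\<in>{a..b}. \<gamma> t \<in> fst c} D"
    "\<And>t. t \<in> {a..b} \<Longrightarrow> \<gamma> t \<in> fst c \<Longrightarrow> ((snd c \<circ> \<gamma>) has_vector_derivative D t) (at t within {a..b})"
  using bspec[OF conjunct2[OF assms(1)[unfolded C1_curve_on_def]] assms(2)] by (elim exE conjE) simp

lemma C1_curve_onI:
  assumes "continuous_map (top_of_set {a..b}) T \<gamma>"
    "\<And>c. c \<in> atlas M \<Longrightarrow> \<exists>D. continuous_on {t\<in>{a..b}. \<gamma> t \<in> fst c} D \<and>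
        (\<forall>t\<in>{a..b}. \<gamma> t \<in> fst c \<longrightarrow> ((snd c \<circ> \<gamma>) has_vector_derivative D t) (at t within {a..b}))"
  shows "C1_curve_on M a b \<gamma>"
  unfolding C1_curve_on_def by (rule conjI[OF assms(1)], rule ballI, rule assms(2))

lemma C1_curve_on_subset:
  assumes "C1_curve_on M a b \<gamma>" "a \<le> a'" "b' \<le> b"
  shows "C1_curve_on M a' b' \<gamma>"
proof -
  have sub: "{a'..b'} \<subseteq> {a..b}" using assms by auto
  have "continuous_map (top_of_set {a'..b'}) T \<gamma>"
    by (rule continuous_map_from_subtopology_mono[OF _ sub]) (rule C1_curve_on_continuous[OF assms(1)])
  moreover have "\<exists>D. continuous_on {t\<in>{a'..b'}. \<gamma> t \<in> fst c} D \<and>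
        (\<forall>t\<in>{a'..b'}. \<gamma> t \<in> fst c \<longrightarrow> ((snd c \<circ> \<gamma>) has_vector_derivative D t) (at t within {a'..b'}))"
    if c: "c \<in> atlas M" for c
  proof -
    obtain D where D: "continuous_on {t\<in>{a..b}. \<gamma> t \<in> fst c} D"
      "\<And>t. t \<in> {a..b} \<Longrightarrow> \<gamma> t \<in> fst c \<Longrightarrow> ((snd c \<circ> \<gamma>) has_vector_derivative D t) (at t within {a..b})"
      using C1_curve_onE[OF assms(1) c] by blast
    have "continuous_on {t\<in>{a'..b'}. \<gamma> t \<in> fst c} D"
      by (rule continuous_on_subset[OF D(1)]) (use sub in auto)
    moreover have "((snd c \<circ> \<gamma>) has_vector_derivative D t) (at t within {a'..b'})"
      if "t \<in> {a'..b'}" "\<gamma> t \<in> fst c" for t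
      by (rule has_vector_derivative_within_subset[OF _ sub]) (use D(2) that sub in blast)
    ultimately show ?thesis by blast
  qed
  ultimately show ?thesis by (rule C1_curve_onI)
qed

lemma C1_curve_on_affine:
  assumes \<gamma>: "C1_curve_on M a b \<gamma>" and im: "(\<lambda>t. m * t + k) ` {a'..b'} \<subseteq> {a..b}"
  shows "C1_curve_on M a' b' (\<lambda>t. \<gamma> (m * t + k))"
proof -
  let ?l = "\<lambda>t. m * t + k"
  have "continuous_map (top_of_set {a'..b'}) (top_of_set {a..b}) ?l"
    using im by (auto intro!: continuous_intros)
  then have "continuous_map (top_of_set {a'..b'}) T (\<gamma> \<circ> ?l)"
    by (rule continuous_map_compose[OF _ C1_curve_on_continuous[OF \<gamma>]])
  moreover have "\<exists>D. continuous_on {t\<in>{a'..b'}. \<gamma> (?l t) \<in> fst c} D \<and>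
        (\<forall>t\<in>{a'..b'}. \<gamma> (?l t) \<in> fst c \<longrightarrow> ((snd c \<circ> (\<lambda>t. \<gamma> (?l t))) has_vector_derivative D t) (at t within {a'..b'}))"
    if c: "c \<in> atlas M" for c
  proof -
    obtain D where D: "continuous_on {t\<in>{a..b}. \<gamma> t \<in> fst c} D"
      "\<And>t. t \<in> {a..b} \<Longrightarrow> \<gamma> t \<in> fst c \<Longrightarrow> ((snd c \<circ> \<gamma>) has_vector_derivative D t) (at t within {a..b})"
      using C1_curve_onE[OF \<gamma> c] by blast
    have "continuous_on {t\<in>{a'..b'}. \<gamma> (?l t) \<in> fst c} (\<lambda>t. m *\<^sub>R D (?l t))"
      by (rule continuous_on_scaleR[OF continuous_on_const], rule continuous_on_compose2[OF D(1)])
         (use im in \<open>auto intro!: continuous_intros simp: image_subset_iff\<close>)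
    moreover have "((snd c \<circ> (\<lambda>t. \<gamma> (?l t))) has_vector_derivative m *\<^sub>R D (?l t)) (at t within {a'..b'})"
      if "t \<in> {a'..b'}" "\<gamma> (?l t) \<in> fst c" for t
    proof -
      have 1: "(?l has_vector_derivative m) (at t within {a'..b'})"
        by (auto intro!: derivative_eq_intros simp: has_real_derivative_iff_has_vector_derivative[symmetric])
      have "((snd c \<circ> \<gamma>) has_vector_derivative D (?l t)) (at (?l t) within ?l ` {a'..b'})"
        by (rule has_vector_derivative_within_subset[OF _ im]) (use D(2) im that in blast)
      from vector_diff_chain_within[OF 1 this] show ?thesis by (simp add: o_def)
    qed
    ultimately show ?thesis by blast
  qed
  ultimately show ?thesis by (intro C1_curve_onI) (auto simp: o_def)
qed

lemma C1_curve_on_cong: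
  assumes "C1_curve_on M a b \<gamma>" "\<And>t. t \<in> {a..b} \<Longrightarrow> \<gamma>' t = \<gamma> t"
  shows "C1_curve_on M a b \<gamma>'"
proof -
  have "continuous_map (top_of_set {a..b}) T \<gamma>'"
    by (rule continuous_map_eq[of _ _ \<gamma>]) (use assms C1_curve_on_continuous[OF assms(1)] in auto)
  moreover have "\<exists>D. continuous_on {t\<in>{a..b}. \<gamma>' t \<in> fst c} D \<and>
        (\<forall>t\<in>{a..b}. \<gamma>' t \<in> fst c \<longrightarrow> ((snd c \<circ> \<gamma>') has_vector_derivative D t) (at t within {a..b}))"
    if c: "c \<in> atlas M" for c
  proof -
    obtain D where D: "continuous_on {t\<in>{a..b}. \<gamma> t \<in> fst c} D"
      "\<And>t. t \<in> {a..b} \<Longrightarrow> \<gamma> t \<in> fst c \<Longrightarrow> ((snd c \<circ> \<gamma>) has_vector_derivative D t) (at t within {a..b})"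
      using C1_curve_onE[OF assms(1) c] by blast
    have "{t\<in>{a..b}. \<gamma>' t \<in> fst c} = {t\<in>{a..b}. \<gamma> t \<in> fst c}" using assms(2) by auto
    moreover have "((snd c \<circ> \<gamma>') has_vector_derivative D t) (at t within {a..b})"
      if t: "t \<in> {a..b}" "\<gamma>' t \<in> fst c" for t
    proof (rule has_vector_derivative_transform[OF t(1)])
      show "((snd c \<circ> \<gamma>) has_vector_derivative D t) (at t within {a..b})" using D(2) t assms(2) by auto
    qed (use assms(2) in auto)
    ultimately show ?thesis using D(1) by auto
  qed
  ultimately show ?thesis by (rule C1_curve_onI)
qed

lemma C1_curve_on_points: "C1_curve_on M a b \<gamma> \<Longrightarrow> t \<in> {a..b} \<Longrightarrow> \<gamma> t \<in> points M"
  using C1_curve_on_continuous[of a b \<gamma>] by (auto simp: continuous_map_def)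

lemma curve_stays:
  assumes "continuous_map (top_of_set S) T \<gamma>" "openin T U" "t \<in> S" "\<gamma> t \<in> U"
  obtains V where "open V" "t \<in> V" "\<And>s. s \<in> S \<inter> V \<Longrightarrow> \<gamma> s \<in> U"
proof -
  have "openin (top_of_set S) {s \<in> topspace (top_of_set S). \<gamma> s \<in> U}"
    by (rule openin_continuous_map_preimage[OF assms(1,2)])
  then obtain V where "open V" "{s \<in> S. \<gamma> s \<in> U} = S \<inter> V"
    by (auto simp: openin_open)
  then show ?thesis using that[of V] assms(3,4) by blast
qed

text \<open>The differential of the transition map carries the velocity in one chart to the velocity in the
  other, and the metric transforms the same way. So the arbitrary chart in \<^const>\<open>speed\<close> can be
  replaced by a chart that stays fixed along a piece of the curve.\<close>

lemma velocity_chart_indep: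
  assumes \<gamma>: "C1_curve_on M a b \<gamma>" and t: "t \<in> {a..b}" and ab: "a < b"
    and c: "c \<in> atlas M" "\<gamma> t \<in> fst c" and c': "c' \<in> atlas M" "\<gamma> t \<in> fst c'"
  shows "gnorm M c' (\<gamma> t) (vector_derivative (snd c' \<circ> \<gamma>) (at t within {a..b}))
    = gnorm M c (\<gamma> t) (vector_derivative (snd c \<circ> \<gamma>) (at t within {a..b}))"
proof -
  obtain D where D: "((snd c \<circ> \<gamma>) has_vector_derivative D) (at t within {a..b})"
    using C1_curve_onE[OF \<gamma> c(1)] c(2) t by metis
  have ct: "continuous_map (top_of_set {a..b}) T \<gamma>" using C1_curve_on_continuous[OF \<gamma>] .
  obtain V where V: "open V" "t \<in> V" "\<And>s. s \<in> {a..b} \<inter> V \<Longrightarrow> \<gamma> s \<in> fst c"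
    using curve_stays[OF ct chart_open[OF c(1)] t c(2)] by blast
  have "(trans c c' has_derivative dtrans c c' (\<gamma> t)) (at ((snd c \<circ> \<gamma>) t) within (snd c \<circ> \<gamma>) ` {a..b})"
    using trans_derivative[OF c(1) c'(1) c(2) c'(2)] by (auto intro: has_derivative_at_withinI)
  from vector_derivative_diff_chain_within[OF D this]
  have tr: "((trans c c' \<circ> (snd c \<circ> \<gamma>)) has_vector_derivative dtrans c c' (\<gamma> t) D) (at t within {a..b})" .
  obtain d where d: "d > 0" "ball t d \<subseteq> V" using V(1,2) open_contains_ball by blast
  have D': "((snd c' \<circ> \<gamma>) has_vector_derivative dtrans c c' (\<gamma> t) D) (at t within {a..b})"
  proof (rule has_vector_derivative_transform_within[OF tr])
    show "d > 0" "t \<in> {a..b}" by fact+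
    fix s assume "s \<in> {a..b}" "dist s t < d"
    then have "s \<in> {a..b} \<inter> V" using d(2) by (auto simp: dist_commute)
    from V(3)[OF this] show "(trans c c' \<circ> (snd c \<circ> \<gamma>)) s = (snd c' \<circ> \<gamma>) s"
      by (simp add: cinv_snd[OF c(1)])
  qed
  have "vector_derivative (snd c' \<circ> \<gamma>) (at t within {a..b}) = dtrans c c' (\<gamma> t) D"
    by (rule vector_derivative_within_closed_interval[OF ab t D'])
  moreover have "vector_derivative (snd c \<circ> \<gamma>) (at t within {a..b}) = D"
    by (rule vector_derivative_within_closed_interval[OF ab t D])
  ultimately show ?thesis using gnorm_trans[OF c(1) c'(1) c(2) c'(2)] by simp
qed

lemma C1_curve_interior:
  assumes \<gamma>: "C1_curve_on M a b \<gamma>" and t: "a < t" "t < b" and c: "c \<in> atlas M" "\<gamma> t \<in> fst c"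
  obtains D where "((snd c \<circ> \<gamma>) has_vector_derivative D) (at t)" "speed M \<gamma> t = gnorm M c (\<gamma> t) D"
proof -
  have tab: "t \<in> {a..b}" "a < b" using t by auto
  have at: "at t within {a..b} = at t" using t by (rule at_within_Icc_at)
  obtain D where "((snd c \<circ> \<gamma>) has_vector_derivative D) (at t within {a..b})"
    using C1_curve_onE[OF \<gamma> c(1)] c(2) tab by metis
  then have D: "((snd c \<circ> \<gamma>) has_vector_derivative D) (at t)" by (simp add: at)
  have "\<gamma> t \<in> points M" using C1_curve_on_points[OF \<gamma> tab(1)] .
  from velocity_chart_indep[OF \<gamma> tab c chart_at[OF this, THEN conjunct1] chart_at[OF this, THEN conjunct2]]
  have "speed M \<gamma> t = gnorm M c (\<gamma> t) (vector_derivative (snd c \<circ> \<gamma>) (at t))"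
    by (simp add: speed_def Let_def at)
  then show ?thesis using that[OF D] vector_derivative_at[OF D] by simp
qed

text \<open>\<^const>\<open>speed\<close> uses two-sided derivatives, which may fail to exist at the ends of a piece. With
  one-sided derivatives there, it becomes continuous.\<close>

lemma C1_curve_speed_integrable:
  assumes \<gamma>: "C1_curve_on M a b \<gamma>" and ab: "a < b"
  shows "speed M \<gamma> integrable_on {a..b}"
proof -
  let ?v = "\<lambda>c t. gnorm M c (\<gamma> t) (vector_derivative (snd c \<circ> \<gamma>) (at t within {a..b}))"
  define w where "w = (\<lambda>t. ?v (chart_at M (\<gamma> t)) t)"
  have pt: "\<gamma> t \<in> points M" if "t \<in> {a..b}" for t using C1_curve_on_points[OF \<gamma> that] .
  have ct: "continuous_map (top_of_set {a..b}) T \<gamma>" using C1_curve_on_continuous[OF \<gamma>] .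
  have "continuous_on {a..b} w"
    unfolding continuous_on_eq_continuous_within
  proof
    fix t assume t: "t \<in> {a..b}"
    obtain c where c: "c \<in> atlas M" "\<gamma> t \<in> fst c" using ex_chart[OF pt[OF t]] by blast
    obtain V where V: "open V" "t \<in> V" "\<And>s. s \<in> {a..b} \<inter> V \<Longrightarrow> \<gamma> s \<in> fst c"
      using curve_stays[OF ct chart_open[OF c(1)] t c(2)] by blast
    let ?S = "{a..b} \<inter> V"
    obtain D where D: "continuous_on {t\<in>{a..b}. \<gamma> t \<in> fst c} D"
      "\<And>t. t \<in> {a..b} \<Longrightarrow> \<gamma> t \<in> fst c \<Longrightarrow> ((snd c \<circ> \<gamma>) has_vector_derivative D t) (at t within {a..b})"
      using C1_curve_onE[OF \<gamma> c(1)] by blast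
    have "continuous_on ?S (snd c \<circ> \<gamma>)"
      unfolding continuous_on_eq_continuous_within
    proof
      fix s assume s: "s \<in> ?S"
      then have "((snd c \<circ> \<gamma>) has_vector_derivative D s) (at s within {a..b})" using D(2) V(3) by blast
      then have "continuous (at s within {a..b}) (snd c \<circ> \<gamma>)" by (rule has_vector_derivative_continuous)
      then show "continuous (at s within ?S) (snd c \<circ> \<gamma>)" by (rule continuous_within_subset) auto
    qed
    moreover have "continuous_on ?S D" by (rule continuous_on_subset[OF D(1)]) (use V(3) in auto)
    moreover have "\<gamma> ` ?S \<subseteq> fst c" using V(3) by auto
    ultimately have "continuous_on ?S (\<lambda>t. gnorm M c (\<gamma> t) (D t))"
      using gnorm_continuous[OF c(1), of ?S D \<gamma>] by simp
    moreover have "gnorm M c (\<gamma> s) (D s) = w s" if s: "s \<in> ?S" for s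
    proof -
      have s': "s \<in> {a..b}" "\<gamma> s \<in> fst c" using s V(3) by auto
      have "vector_derivative (snd c \<circ> \<gamma>) (at s within {a..b}) = D s"
        by (rule vector_derivative_within_closed_interval[OF ab s'(1)]) (use D(2) s' in blast)
      then show ?thesis
        unfolding w_def using velocity_chart_indep[OF \<gamma> s'(1) ab c(1) s'(2)] chart_at[OF pt[OF s'(1)]] by simp
    qed
    ultimately have "continuous_on ?S w" by (rule continuous_on_eq)
    then have "continuous (at t within ?S) w" using t V(2) by (simp add: continuous_on_eq_continuous_within)
    moreover have "at t within ?S = at t within {a..b}"
      by (rule at_within_nhd[OF V(2,1)]) auto
    ultimately show "continuous (at t within {a..b}) w" by (simp add: continuous_within)
  qed
  then have w: "w integrable_on {a..b}" by (rule integrable_continuous_interval)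
  have "speed M \<gamma> t = w t" if "t \<in> {a..b} - {a, b}" for t
    using that by (simp add: w_def speed_def Let_def at_within_Icc_at)
  then show ?thesis using integrable_spike_finite[of "{a, b}" "{a..b}" "speed M \<gamma>" w] w by simp
qed

text \<open>Piecewise curves on an arbitrary interval, built by appending one piece at a time: the
  inductive form makes concatenation, restriction and reparametrisation inductions.\<close>

inductive pw :: "(real \<Rightarrow> 'm) \<Rightarrow> real \<Rightarrow> real \<Rightarrow> bool" for \<gamma> where
  pw_single: "a < b \<Longrightarrow> C1_curve_on M a b \<gamma> \<Longrightarrow> pw \<gamma> a b"
| pw_snoc: "pw \<gamma> a b \<Longrightarrow> b < c \<Longrightarrow> C1_curve_on M b c \<gamma> \<Longrightarrow> pw \<gamma> a c"

lemma pw_less: "pw \<gamma> a b \<Longrightarrow> a < b"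
  by (induction rule: pw.induct) auto

lemma pw_trans: "pw \<gamma> b c \<Longrightarrow> pw \<gamma> a b \<Longrightarrow> pw \<gamma> a c"
  by (induction rule: pw.induct) (auto intro: pw.intros)

lemma pw_cong: "pw \<gamma> a b \<Longrightarrow> (\<And>t. t \<in> {a..b} \<Longrightarrow> \<gamma>' t = \<gamma> t) \<Longrightarrow> pw \<gamma>' a b"
proof (induction rule: pw.induct)
  case (pw_single a b)
  show ?case by (rule pw.pw_single[OF pw_single(1) C1_curve_on_cong[OF pw_single(2,3)]])
next
  case (pw_snoc a b c)
  have "pw \<gamma>' a b" by (rule pw_snoc.IH) (use pw_snoc in auto)
  moreover have "C1_curve_on M b c \<gamma>'"
    by (rule C1_curve_on_cong[OF pw_snoc(3)]) (use pw_snoc.prems pw_less[OF pw_snoc(1)] in auto)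
  ultimately show ?case using pw.pw_snoc pw_snoc(2) by blast
qed

lemma pw_split: "pw \<gamma> a b \<Longrightarrow> a < t \<Longrightarrow> t < b \<Longrightarrow> pw \<gamma> a t \<and> pw \<gamma> t b"
proof (induction rule: pw.induct)
  case (pw_single a b)
  then show ?case
    using C1_curve_on_subset[OF pw_single(2), of a t] C1_curve_on_subset[OF pw_single(2), of t b]
    by (auto intro: pw.pw_single)
next
  case (pw_snoc a b c)
  consider "t < b" | "t = b" | "t > b" by linarith
  then show ?case
  proof cases
    case 1
    then show ?thesis using pw_snoc pw.pw_snoc by blast
  next
    case 2
    then show ?thesis using pw_snoc pw.pw_single by blast
  next
    case 3
    then show ?thesis
      using C1_curve_on_subset[OF pw_snoc(3), of b t] C1_curve_on_subset[OF pw_snoc(3), of t c] pw_snoc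
      by (auto intro: pw.intros)
  qed
qed

lemma pw_affine:
  assumes "m > 0"
  shows "pw \<gamma> a b \<Longrightarrow> pw (\<lambda>t. \<gamma> (m * t + k)) ((a - k) / m) ((b - k) / m)"
proof (induction rule: pw.induct)
  case (pw_single a b)
  have "C1_curve_on M ((a - k) / m) ((b - k) / m) (\<lambda>t. \<gamma> (m * t + k))"
    by (rule C1_curve_on_affine[OF pw_single(2)]) (use assms in \<open>auto simp: field_simps\<close>)
  then show ?case using pw_single(1) assms by (intro pw.pw_single) (simp add: divide_strict_right_mono)
next
  case (pw_snoc a b c)
  have "C1_curve_on M ((b - k) / m) ((c - k) / m) (\<lambda>t. \<gamma> (m * t + k))"
    by (rule C1_curve_on_affine[OF pw_snoc(3)]) (use assms in \<open>auto simp: field_simps\<close>)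
  moreover have "(b - k) / m < (c - k) / m" using pw_snoc(2) assms by (simp add: divide_strict_right_mono)
  ultimately show ?case using pw_snoc.IH pw.pw_snoc by blast
qed

lemma pw_reverse: "pw \<gamma> a b \<Longrightarrow> pw (\<lambda>t. \<gamma> (- t)) (- b) (- a)"
proof (induction rule: pw.induct)
  case (pw_single a b)
  have "C1_curve_on M (- b) (- a) (\<lambda>t. \<gamma> ((- 1) * t + 0))"
    by (rule C1_curve_on_affine[OF pw_single(2)]) auto
  then show ?case using pw_single(1) by (intro pw.pw_single) auto
next
  case (pw_snoc a b c)
  have "C1_curve_on M (- c) (- b) (\<lambda>t. \<gamma> ((- 1) * t + 0))"
    by (rule C1_curve_on_affine[OF pw_snoc(3)]) auto
  then have "pw (\<lambda>t. \<gamma> (- t)) (- c) (- b)" using pw_snoc(2) by (intro pw.pw_single) auto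
  then show ?case using pw_trans pw_snoc.IH by blast
qed

lemma piecewise_iff_pw: "piecewise_C1_curve M \<gamma> \<longleftrightarrow> pw \<gamma> 0 1"
proof
  assume "piecewise_C1_curve M \<gamma>"
  then obtain k and s :: "nat \<Rightarrow> real" where s: "s 0 = 0" "s k = 1"
    "\<And>i. i < k \<Longrightarrow> s i < s (Suc i) \<and> C1_curve_on M (s i) (s (Suc i)) \<gamma>"
    unfolding piecewise_C1_curve_def by blast
  have "pw \<gamma> (s 0) (s (Suc i))" if "i < k" for i
    using that
  proof (induction i)
    case 0
    then show ?case using s(3) pw_single by blast
  next
    case (Suc i)
    then show ?case using s(3)[of "Suc i"] pw_snoc by simp
  qed
  moreover obtain i where "k = Suc i" using s(1,2) by (cases k) auto
  ultimately show "pw \<gamma> 0 1" using s(1,2) by force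
next
  have "\<exists>k. \<exists>s::nat \<Rightarrow> real. s 0 = a \<and> s k = b \<and>
        (\<forall>i<k. s i < s (Suc i) \<and> C1_curve_on M (s i) (s (Suc i)) \<gamma>)" if "pw \<gamma> a b" for a b
    using that
  proof (induction rule: pw.induct)
    case (pw_single a b)
    then show ?case by (intro exI[of _ 1] exI[of _ "\<lambda>i. if i = 0 then a else b"]) auto
  next
    case (pw_snoc a b c)
    then obtain k and s :: "nat \<Rightarrow> real" where s: "s 0 = a" "s k = b"
        "\<And>i. i < k \<Longrightarrow> s i < s (Suc i) \<and> C1_curve_on M (s i) (s (Suc i)) \<gamma>"
      by blast
    let ?s = "\<lambda>i. if i \<le> k then s i else c"
    have "?s i < ?s (Suc i) \<and> C1_curve_on M (?s i) (?s (Suc i)) \<gamma>" if "i < Suc k" for i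
      using s pw_snoc(2,3) that by (cases "i = k") auto
    then show ?case using s(1) by (intro exI[of _ "Suc k"] exI[of _ ?s]) auto
  qed
  then show "pw \<gamma> 0 1 \<Longrightarrow> piecewise_C1_curve M \<gamma>"
    by (simp add: piecewise_C1_curve_def)
qed

text \<open>Off the finitely many break points the curve is \<open>C\<^sup>1\<close> in a neighbourhood. This is all that
  integration along the curve sees.\<close>

lemma pw_regular:
  "pw \<gamma> a b \<Longrightarrow> \<exists>F. finite F \<and> (\<forall>t\<in>{a..b} - F. \<exists>a' b'. a' < t \<and> t < b' \<and> C1_curve_on M a' b' \<gamma>)"
proof (induction rule: pw.induct)
  case (pw_single a b)
  then show ?case by (intro exI[of _ "{a, b}"]) force
next
  case (pw_snoc a b c)
  then obtain F where "finite F" "\<forall>t\<in>{a..b} - F. \<exists>a' b'. a' < t \<and> t < b' \<and> C1_curve_on M a' b' \<gamma>" by blast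
  then show ?case using pw_snoc(2,3) by (intro exI[of _ "insert b (insert c F)"]) force
qed

lemma pw_continuous: "pw \<gamma> a b \<Longrightarrow> continuous_map (top_of_set {a..b}) T \<gamma>"
proof (induction rule: pw.induct)
  case (pw_single a b)
  show ?case by (rule C1_curve_on_continuous[OF pw_single(2)])
next
  case (pw_snoc a b c)
  have un: "{a..c} = {a..b} \<union> {b..c}" using pw_less[OF pw_snoc(1)] pw_snoc(2) by auto
  have "continuous_map (top_of_set {b..c}) T \<gamma>" using C1_curve_on_continuous[OF pw_snoc(3)] .
  then have 2: "closedin (top_of_set {b..c}) {t \<in> {b..c}. \<gamma> t \<in> C}" if "closedin T C" for C
    using that unfolding continuous_map_closedin by simp
  have 1: "closedin (top_of_set {a..b}) {t \<in> {a..b}. \<gamma> t \<in> C}" if "closedin T C" for C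
    using that pw_snoc.IH unfolding continuous_map_closedin by simp
  show ?case
    unfolding continuous_map_closedin
  proof (intro conjI allI impI)
    show "\<gamma> \<in> topspace (top_of_set {a..c}) \<rightarrow> points M"
      using un pw_snoc.IH \<open>continuous_map (top_of_set {b..c}) T \<gamma>\<close> by (auto simp: continuous_map_def)
  next
    fix C assume C: "closedin T C"
    have "closed {t \<in> {a..b}. \<gamma> t \<in> C}" "closed {t \<in> {b..c}. \<gamma> t \<in> C}"
      using closedin_closed_trans[OF 1[OF C]] closedin_closed_trans[OF 2[OF C]] by auto
    moreover have "{t \<in> {a..c}. \<gamma> t \<in> C} = {t \<in> {a..b}. \<gamma> t \<in> C} \<union> {t \<in> {b..c}. \<gamma> t \<in> C}"
      using un by auto
    ultimately have "closed {t \<in> {a..c}. \<gamma> t \<in> C}" by (simp only: closed_Un)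
    then show "closedin (top_of_set {a..c}) {t \<in> topspace (top_of_set {a..c}). \<gamma> t \<in> C}"
      by (auto simp: closedin_closed_eq)
  qed
qed

lemma pw_points: "pw \<gamma> a b \<Longrightarrow> t \<in> {a..b} \<Longrightarrow> \<gamma> t \<in> points M"
  using pw_continuous[of \<gamma> a b] by (auto simp: continuous_map_def)

definition len :: "(real \<Rightarrow> 'm) \<Rightarrow> real \<Rightarrow> real \<Rightarrow> real" where
  "len \<gamma> a b = integral {a..b} (speed M \<gamma>)"

lemma speed_integrable: "pw \<gamma> a b \<Longrightarrow> speed M \<gamma> integrable_on {a..b}"
proof (induction rule: pw.induct)
  case (pw_single a b)
  show ?case by (rule C1_curve_speed_integrable[OF pw_single(2,1)])
next
  case (pw_snoc a b c)
  then show ?case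
    using Henstock_Kurzweil_Integration.integrable_combine[of a b c] C1_curve_speed_integrable[OF pw_snoc(3,2)] pw_less by fastforce
qed

lemma speed_nonneg: "\<gamma> t \<in> points M \<Longrightarrow> speed M \<gamma> t \<ge> 0"
  using chart_at gnorm_nonneg by (simp add: speed_def Let_def)

lemma len_nonneg: "pw \<gamma> a b \<Longrightarrow> len \<gamma> a b \<ge> 0"
  unfolding len_def using speed_integrable speed_nonneg pw_points by (intro integral_nonneg) blast+

lemma len_split: "pw \<gamma> a b \<Longrightarrow> a < t \<Longrightarrow> t < b \<Longrightarrow> len \<gamma> a b = len \<gamma> a t + len \<gamma> t b"
  unfolding len_def using Henstock_Kurzweil_Integration.integral_combine[of a t b "speed M \<gamma>"] speed_integrable[of \<gamma> a b] by simp

lemma speed_cong_open: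
  assumes "open S" "t \<in> S" "\<And>s. s \<in> S \<Longrightarrow> \<gamma>' s = \<gamma> s"
  shows "speed M \<gamma>' t = speed M \<gamma> t"
proof -
  have "((snd c \<circ> \<gamma>') has_vector_derivative D) (at t) \<longleftrightarrow> ((snd c \<circ> \<gamma>) has_vector_derivative D) (at t)" for c :: "('m,'n) chart" and D
    using has_vector_derivative_transform_within_open[of "snd c \<circ> \<gamma>'" D t S "snd c \<circ> \<gamma>"]
      has_vector_derivative_transform_within_open[of "snd c \<circ> \<gamma>" D t S "snd c \<circ> \<gamma>'"] assms by auto
  then have "vector_derivative (snd c \<circ> \<gamma>') (at t) = vector_derivative (snd c \<circ> \<gamma>) (at t)" for c :: "('m,'n) chart"
    by (simp add: vector_derivative_def)
  then show ?thesis using assms by (simp add: speed_def Let_def)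
qed

lemma len_cong:
  assumes "\<And>t. t \<in> {a<..<b} \<Longrightarrow> \<gamma>' t = \<gamma> t"
  shows "len \<gamma>' a b = len \<gamma> a b"
  unfolding len_def
proof (rule integral_spike[of "{a, b}"])
  show "speed M \<gamma> t = speed M \<gamma>' t" if "t \<in> {a..b} - {a, b}" for t
    by (rule speed_cong_open[of "{a<..<b}"]) (use that assms in auto)
qed simp

lemma len_affine:
  assumes \<gamma>: "pw \<gamma> a b" and m: "m \<noteq> 0" and im: "(\<lambda>t. m * t + k) ` {a'..b'} = {a..b}"
  shows "len (\<lambda>t. \<gamma> (m * t + k)) a' b' = len \<gamma> a b"
proof -
  let ?l = "\<lambda>t. m * t + k"
  obtain F where F: "finite F" "\<And>t. t \<in> {a..b} - F \<Longrightarrow> \<exists>a' b'. a' < t \<and> t < b' \<and> C1_curve_on M a' b' \<gamma>"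
    using pw_regular[OF \<gamma>] by blast
  have "(speed M \<gamma> has_integral len \<gamma> a b) (cbox a b)"
    unfolding len_def using speed_integrable[OF \<gamma>] by (simp add: integrable_integral)
  from has_integral_affinity[OF this m, of k]
  have "((\<lambda>t. speed M \<gamma> (?l t)) has_integral len \<gamma> a b / \<bar>m\<bar>) ((\<lambda>t. (1 / m) *\<^sub>R t + - ((1 / m) *\<^sub>R k)) ` {a..b})"
    by simp
  also have "(\<lambda>t. (1 / m) *\<^sub>R t + - ((1 / m) *\<^sub>R k)) ` {a..b} = {a'..b'}"
    unfolding im[symmetric] image_image using m by (simp add: field_simps)
  finally have "((\<lambda>t. \<bar>m\<bar> * speed M \<gamma> (?l t)) has_integral \<bar>m\<bar> * (len \<gamma> a b / \<bar>m\<bar>)) {a'..b'}"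
    by (rule has_integral_mult_right)
  then have 1: "((\<lambda>t. \<bar>m\<bar> * speed M \<gamma> (?l t)) has_integral len \<gamma> a b) {a'..b'}" using m by simp
  have "((speed M (\<lambda>t. \<gamma> (?l t))) has_integral len \<gamma> a b) {a'..b'}"
  proof (rule has_integral_spike_finite[OF _ _ 1])
    show "finite (?l -` F)" by (rule finite_vimageI[OF F(1)]) (use m in \<open>auto simp: inj_def\<close>)
    fix t assume t: "t \<in> {a'..b'} - ?l -` F"
    then have lt: "?l t \<in> {a..b} - F" using im by blast
    then obtain a1 b1 where C: "a1 < ?l t" "?l t < b1" "C1_curve_on M a1 b1 \<gamma>" using F(2) by blast
    have pt: "\<gamma> (?l t) \<in> points M" using pw_points[OF \<gamma>] lt by blast
    let ?c = "chart_at M (\<gamma> (?l t))"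
    obtain D where D: "((snd ?c \<circ> \<gamma>) has_vector_derivative D) (at (?l t))"
      "speed M \<gamma> (?l t) = gnorm M ?c (\<gamma> (?l t)) D"
      using C1_curve_interior[OF C(3,1,2)] chart_at[OF pt] by blast
    have "(?l has_vector_derivative m) (at t)"
      by (auto intro!: derivative_eq_intros simp: has_real_derivative_iff_has_vector_derivative[symmetric])
    from vector_diff_chain_at[OF this D(1)]
    have "vector_derivative (snd ?c \<circ> (\<lambda>t. \<gamma> (?l t))) (at t) = m *\<^sub>R D"
      by (simp add: o_def vector_derivative_at)
    then show "speed M (\<lambda>t. \<gamma> (?l t)) t = \<bar>m\<bar> * speed M \<gamma> (?l t)"
      using D(2) by (simp add: speed_def Let_def gnorm_scale)
  qed
  then show ?thesis unfolding len_def by (rule integral_unique)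
qed

end


section \<open>The Riemannian distance\<close>

context riemannian
begin

definition joined :: "'m \<Rightarrow> 'm \<Rightarrow> real \<Rightarrow> bool" where
  "joined x y l \<longleftrightarrow> (\<exists>\<gamma>. pw \<gamma> 0 1 \<and> \<gamma> 0 = x \<and> \<gamma> 1 = y \<and> len \<gamma> 0 1 = l)"

lemma joined_pw:
  assumes "pw \<gamma> a b"
  shows "joined (\<gamma> a) (\<gamma> b) (len \<gamma> a b)"
proof -
  let ?\<gamma> = "\<lambda>t. \<gamma> ((b - a) * t + a)"
  have ab: "b - a > 0" using pw_less[OF assms] by simp
  have "pw ?\<gamma> 0 1" using pw_affine[OF ab assms, of a] ab by simp
  moreover have "(\<lambda>t. (b - a) * t + a) ` {0..1} = {a..b}"
    using ab by (simp add: image_affinity_atLeastAtMost)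
  then have "len ?\<gamma> 0 1 = len \<gamma> a b" using len_affine[OF assms] ab by simp
  ultimately show ?thesis unfolding joined_def by (intro exI[of _ ?\<gamma>]) simp
qed

lemma joined_nonneg: "joined x y l \<Longrightarrow> 0 \<le> l"
  unfolding joined_def using len_nonneg by blast

lemma joined_points: "joined x y l \<Longrightarrow> x \<in> points M \<and> y \<in> points M"
  unfolding joined_def using pw_points[of _ 0 1] by force

lemma joined_sym:
  assumes "joined x y l"
  shows "joined y x l"
proof -
  obtain \<gamma> where \<gamma>: "pw \<gamma> 0 1" "\<gamma> 0 = x" "\<gamma> 1 = y" "len \<gamma> 0 1 = l"
    using assms by (auto simp: joined_def)
  have "(\<lambda>t::real. (- 1) * t + 0) ` {-1..0} = {0..1}"
    using image_affinity_atLeastAtMost[of "-1::real" 0 "-1" 0] by simp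
  then have "len (\<lambda>t. \<gamma> (- t)) (- 1) 0 = l"
    using len_affine[OF \<gamma>(1), of "-1" 0 "-1" 0] \<gamma>(4) by simp
  then show ?thesis using joined_pw[OF pw_reverse[OF \<gamma>(1)]] \<gamma> by simp
qed

lemma joined_trans:
  assumes "joined x y l" "joined y z l'"
  shows "joined x z (l + l')"
proof -
  obtain \<gamma>1 where 1: "pw \<gamma>1 0 1" "\<gamma>1 0 = x" "\<gamma>1 1 = y" "len \<gamma>1 0 1 = l"
    using assms(1) by (auto simp: joined_def)
  obtain \<gamma>2 where 2: "pw \<gamma>2 0 1" "\<gamma>2 0 = y" "\<gamma>2 1 = z" "len \<gamma>2 0 1 = l'"
    using assms(2) by (auto simp: joined_def)
  define \<gamma> where "\<gamma> = (\<lambda>t. if t \<le> 1 then \<gamma>1 t else \<gamma>2 (1 * t + - 1))"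
  have 3: "pw (\<lambda>t. \<gamma>2 (1 * t + - 1)) 1 2" using pw_affine[OF zero_less_one 2(1), of "-1"] by simp
  have "pw \<gamma> 0 1" by (rule pw_cong[OF 1(1)]) (simp add: \<gamma>_def)
  moreover have "pw \<gamma> 1 2" by (rule pw_cong[OF 3]) (use 1 2 in \<open>auto simp: \<gamma>_def\<close>)
  ultimately have pw: "pw \<gamma> 0 2" using pw_trans by blast
  have "len \<gamma> 0 1 = l" using len_cong[of 0 1 \<gamma> \<gamma>1] 1(4) by (simp add: \<gamma>_def)
  moreover have "len \<gamma> 1 2 = len (\<lambda>t. \<gamma>2 (1 * t + - 1)) 1 2" by (rule len_cong) (simp add: \<gamma>_def)
  moreover have "(\<lambda>t::real. 1 * t + - 1) ` {1..2} = {0..1}"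
    using image_affinity_atLeastAtMost[of "1::real" "-1" 1 2] by simp
  then have "len (\<lambda>t. \<gamma>2 (1 * t + - 1)) 1 2 = l'" using len_affine[OF 2(1), of 1 "-1" 1 2] 2(4) by simp
  ultimately have "len \<gamma> 0 2 = l + l'" using len_split[OF pw, of 1] by simp
  then show ?thesis using joined_pw[OF pw] 1 2 by (simp add: \<gamma>_def)
qed

text \<open>A coordinate segment is smooth in every chart that it meets, because the transition maps are.\<close>

lemma joined_segment:
  assumes c: "c \<in> atlas M" and S: "convex S" "S \<subseteq> snd c ` fst c" "y \<in> S" "y' \<in> S"
    and B: "\<And>z. z \<in> S \<Longrightarrow> gnorm M c (cinv c z) (y' - y) \<le> B"
  shows "\<exists>l\<le>B. joined (cinv c y) (cinv c y') l"
proof -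
  let ?l = "\<lambda>t. y + t *\<^sub>R (y' - y)"
  let ?\<gamma> = "\<lambda>t. cinv c (?l t)"
  have lS: "?l t \<in> S" if "t \<in> {0..1}" for t
  proof -
    have "(1 - t) *\<^sub>R y + t *\<^sub>R y' \<in> S" using S that by (intro convexD) auto
    moreover have "(1 - t) *\<^sub>R y + t *\<^sub>R y' = ?l t" by (simp add: algebra_simps)
    ultimately show ?thesis by simp
  qed
  then have lim: "?l t \<in> snd c ` fst c" if "t \<in> {0..1}" for t using S(2) that by blast
  have sl: "snd c (?\<gamma> t) = ?l t" "?\<gamma> t \<in> fst c" if "t \<in> {0..1}" for t
    using snd_cinv[OF lim[OF that]] cinv_in[OF lim[OF that]] by auto
  have dl: "(?l has_vector_derivative (y' - y)) (at t within A)" for t A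
    by (auto intro!: derivative_eq_intros)
  have C1: "C1_curve_on M 0 1 ?\<gamma>"
  proof (rule C1_curve_onI)
    have "continuous_map (top_of_set {0..1}) (top_of_set (snd c ` fst c)) ?l"
      using lim by (auto intro!: continuous_intros)
    from continuous_map_compose[OF this cinv_continuous[OF c]]
    show "continuous_map (top_of_set {0..1}) T ?\<gamma>" by (simp add: o_def)
    fix c' assume c': "c' \<in> atlas M"
    let ?A = "{t \<in> {0..1}. ?\<gamma> t \<in> fst c'}"
    let ?D = "\<lambda>t. dtrans c c' (?\<gamma> t) (y' - y)"
    have "continuous_on ?A (\<lambda>t. frechet_derivative (trans c c') (at (?l t)) (y' - y))"
    proof (rule continuous_on_compose2[OF smooth_on_imp_continuous_on[OF smooth_on_derivative[OF trans_smooth[OF c c']]]])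
      show "?l ` ?A \<subseteq> snd c ` (fst c \<inter> fst c')"
      proof safe
        fix t :: real assume "t \<in> {0..1}" "?\<gamma> t \<in> fst c'"
        then show "?l t \<in> snd c ` (fst c \<inter> fst c')" using sl[of t] by (metis IntI image_eqI)
      qed
    qed (auto intro!: continuous_intros)
    then have "continuous_on ?A ?D"
      by (rule continuous_on_eq) (auto simp: dtrans_def sl)
    moreover have "((snd c' \<circ> ?\<gamma>) has_vector_derivative ?D t) (at t within {0..1})"
      if "t \<in> {0..1}" "?\<gamma> t \<in> fst c'" for t
    proof -
      have "(trans c c' has_derivative dtrans c c' (?\<gamma> t)) (at (?l t) within ?l ` {0..1})"
        using trans_derivative[OF c c' sl(2)[OF that(1)] that(2)] sl(1)[OF that(1)]
        by (auto intro: has_derivative_at_withinI)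
      from vector_derivative_diff_chain_within[OF dl this] show ?thesis by (simp add: o_def)
    qed
    ultimately show "\<exists>D. continuous_on ?A D \<and> (\<forall>t\<in>{0..1}. ?\<gamma> t \<in> fst c' \<longrightarrow>
        ((snd c' \<circ> ?\<gamma>) has_vector_derivative D t) (at t within {0..1}))" by blast
  qed
  then have pw: "pw ?\<gamma> 0 1" by (intro pw_single) auto
  have sp: "speed M ?\<gamma> t \<le> B" if t: "t \<in> {0<..<1}" for t
  proof -
    have t': "t \<in> {0..1}" "0 < t" "t < 1" using t by auto
    obtain D where D: "((snd c \<circ> ?\<gamma>) has_vector_derivative D) (at t)" "speed M ?\<gamma> t = gnorm M c (?\<gamma> t) D"
      using C1_curve_interior[OF C1 t'(2,3) c sl(2)[OF t'(1)]] by blast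
    have "((snd c \<circ> ?\<gamma>) has_vector_derivative (y' - y)) (at t)"
      by (rule has_vector_derivative_transform_within_open[OF dl, of "{0<..<1}"]) (use t in \<open>auto simp: sl\<close>)
    then have "D = y' - y" using D(1) vector_derivative_unique_at by blast
    then show ?thesis using D(2) B[OF lS[OF t'(1)]] by simp
  qed
  have "len ?\<gamma> 0 1 \<le> B"
  proof -
    have "((\<lambda>t. if t \<in> {0, 1} then B else speed M ?\<gamma> t) has_integral len ?\<gamma> 0 1) {0..1}"
      by (rule has_integral_spike_finite[of "{0, 1}" _ _ "speed M ?\<gamma>"])
         (use integrable_integral[OF speed_integrable[OF pw]] in \<open>auto simp: len_def\<close>)
    from has_integral_le[OF this has_integral_const_real[of B 0 1]] show ?thesis using sp by auto
  qed
  then show ?thesis using joined_pw[OF pw] by auto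
qed

text \<open>The two comparisons play different roles. The factor \<open>2\<close> relative to the metric at \<open>x\<close> is the same
  for all manifolds and enters the final constant; \<open>k\<close> and \<open>K\<close>, which compare with the Euclidean norm,
  depend on \<open>M\<close> and \<open>x\<close> and serve qualitative purposes only.\<close>

definition good :: "('m, 'n) chart \<Rightarrow> 'm \<Rightarrow> real \<Rightarrow> real \<Rightarrow> real \<Rightarrow> bool" where
  "good c x \<rho> k K \<longleftrightarrow> c \<in> atlas M \<and> x \<in> fst c \<and> \<rho> > 0 \<and> k > 0 \<and> K > 0 \<and> ball (snd c x) \<rho> \<subseteq> snd c ` fst c \<and>
    (\<forall>y\<in>ball (snd c x) \<rho>. \<forall>v. k * norm v \<le> gnorm M c (cinv c y) v \<and> gnorm M c (cinv c y) v \<le> K * norm v \<and>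
      gnorm M c (cinv c y) v \<le> 2 * gnorm M c x v \<and> gnorm M c x v \<le> 2 * gnorm M c (cinv c y) v)"

lemma ex_good_chart: "c \<in> atlas M \<Longrightarrow> x \<in> fst c \<Longrightarrow> \<exists>\<rho> k K. good c x \<rho> k K"
  using gnorm_compare[of c x] unfolding good_def by (metis (no_types, lifting))

lemma ex_good: "x \<in> points M \<Longrightarrow> \<exists>c \<rho> k K. good c x \<rho> k K"
  using ex_chart ex_good_chart by meson

lemma goodD:
  assumes "good c x \<rho> k K"
  shows "c \<in> atlas M" "x \<in> fst c" "\<rho> > 0" "k > 0" "K > 0" "ball (snd c x) \<rho> \<subseteq> snd c ` fst c"
    "cinv c (snd c x) = x" "x \<in> points M"
  using assms cinv_snd[of c x] chart_points[of c x] by (auto simp: good_def)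

lemma good_gnorm:
  assumes "good c x \<rho> k K" "y \<in> ball (snd c x) \<rho>"
  shows "k * norm v \<le> gnorm M c (cinv c y) v" "gnorm M c (cinv c y) v \<le> K * norm v"
    "gnorm M c (cinv c y) v \<le> 2 * gnorm M c x v" "gnorm M c x v \<le> 2 * gnorm M c (cinv c y) v"
  using assms by (auto simp: good_def)

lemma good_joined:
  assumes g: "good c x \<rho> k K" and y: "y \<in> ball (snd c x) \<rho>" "y' \<in> ball (snd c x) \<rho>"
  shows "\<exists>l\<le>2 * gnorm M c x (y' - y). joined (cinv c y) (cinv c y') l"
    "\<exists>l\<le>K * norm (y' - y). joined (cinv c y) (cinv c y') l"
  using joined_segment[OF goodD(1)[OF g] convex_ball goodD(6)[OF g] y] good_gnorm[OF g] by blast+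

lemma good_open: "good c x \<rho> k K \<Longrightarrow> r \<le> \<rho> \<Longrightarrow> openin T (cinv c ` ball (snd c x) r)"
  using open_cinv_image[of c "ball (snd c x) r"] goodD[of c x \<rho> k K] subset_ball[of r \<rho> "snd c x"] by auto

lemma good_mem: "good c x \<rho> k K \<Longrightarrow> 0 < r \<Longrightarrow> x \<in> cinv c ` ball (snd c x) r"
  using goodD(7) by (metis centre_in_ball image_eqI)

lemma good_compact:
  assumes g: "good c x \<rho> k K" and r: "r < \<rho>"
  shows "compactin T (cinv c ` cball (snd c x) r)"
proof (rule image_compactin[OF _ cinv_continuous[OF goodD(1)[OF g]]])
  have "cball (snd c x) r \<subseteq> snd c ` fst c" using goodD(6)[OF g] r by (force simp: subset_iff)
  then show "compactin (top_of_set (snd c ` fst c)) (cball (snd c x) r)"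
    by (simp add: compactin_subtopology)
qed

lemma joined_refl:
  assumes "x \<in> points M"
  shows "joined x x 0"
proof -
  obtain c \<rho> k K where g: "good c x \<rho> k K" using ex_good[OF assms] by blast
  have "snd c x \<in> ball (snd c x) \<rho>" using goodD(3)[OF g] by simp
  from good_joined(2)[OF g this this] obtain l where "l \<le> 0" "joined x x l" using goodD(7)[OF g] by auto
  then show ?thesis using joined_nonneg[of x x l] by auto
qed

text \<open>The points that can be joined to \<open>x\<close>, and those that cannot, form open sets, because any two
  points of a coordinate ball can be joined. Without this lemma the infimum that defines the distance
  could be that of the empty set.\<close>

lemma ex_joined:
  assumes x: "x \<in> points M" and y: "y \<in> points M"
  shows "\<exists>l. joined x y l"
proof -
  let ?U = "{y \<in> points M. \<exists>l. joined x y l}"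
  have nb: "\<exists>N. openin T N \<and> y \<in> N \<and> (\<forall>z\<in>N. \<exists>l. joined y z l)" if y: "y \<in> points M" for y
  proof -
    obtain c \<rho> k K where g: "good c y \<rho> k K" using ex_good[OF y] by blast
    have "\<exists>l. joined y z l" if "z \<in> cinv c ` ball (snd c y) \<rho>" for z
    proof -
      obtain w where w: "z = cinv c w" "w \<in> ball (snd c y) \<rho>" using \<open>z \<in> _\<close> by blast
      have "snd c y \<in> ball (snd c y) \<rho>" using goodD(3)[OF g] by simp
      from good_joined(2)[OF g this w(2)] show ?thesis using goodD(7)[OF g] w(1) by auto
    qed
    then show ?thesis using good_open[OF g order_refl] good_mem[OF g goodD(3)[OF g]] by blast
  qed
  have "openin T ?U"
  proof (subst openin_subopen, rule ballI)
    fix y assume "y \<in> ?U"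
    then obtain l where y: "y \<in> points M" "joined x y l" by blast
    obtain N where N: "openin T N" "y \<in> N" "\<forall>z\<in>N. \<exists>l. joined y z l" using nb[OF y(1)] by blast
    have "N \<subseteq> ?U" using N openin_subset[OF N(1)] joined_trans[OF y(2)] by blast
    then show "\<exists>N. openin T N \<and> y \<in> N \<and> N \<subseteq> ?U" using N by blast
  qed
  moreover have "openin T (points M - ?U)"
  proof (subst openin_subopen, rule ballI)
    fix y assume "y \<in> points M - ?U"
    then have y: "y \<in> points M" "\<nexists>l. joined x y l" by auto
    obtain N where N: "openin T N" "y \<in> N" "\<forall>z\<in>N. \<exists>l. joined y z l" using nb[OF y(1)] by blast
    have "N \<subseteq> points M - ?U" using N openin_subset[OF N(1)] joined_trans joined_sym y(2) by blast
    then show "\<exists>N. openin T N \<and> y \<in> N \<and> N \<subseteq> points M - ?U" using N by blast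
  qed
  then have "closedin T ?U" by (simp add: closedin_def)
  ultimately have "?U = {} \<or> ?U = points M" using connected unfolding connected_space_clopen_in by blast
  then show ?thesis using joined_refl[OF x] x y by blast
qed

lemma rdist_eq: "x \<in> points M \<Longrightarrow> y \<in> points M \<Longrightarrow> rdist M x y = Inf {l. joined x y l}"
  unfolding rdist_def joined_def piecewise_iff_pw curve_length_def len_def
  by (auto intro!: arg_cong[of _ _ Inf])

lemma rdist_le: "joined x y l \<Longrightarrow> rdist M x y \<le> l"
  using joined_points[of x y l] rdist_eq[of x y] joined_nonneg
  by (auto intro!: cInf_lower bdd_belowI[of _ 0])

lemma rdist_ge:
  assumes "x \<in> points M" "y \<in> points M" "\<And>l. joined x y l \<Longrightarrow> B \<le> l"
  shows "B \<le> rdist M x y"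
  unfolding rdist_eq[OF assms(1,2)] using assms(3) ex_joined[OF assms(1,2)] by (intro cInf_greatest) auto

lemma rdist_approx:
  assumes "x \<in> points M" "y \<in> points M" "rdist M x y < B"
  shows "\<exists>l<B. joined x y l"
proof (rule ccontr)
  assume "\<not> ?thesis"
  then have "B \<le> rdist M x y" by (intro rdist_ge assms) force
  then show False using assms(3) by simp
qed

text \<open>Until it first leaves the coordinate ball the curve stays inside the chart, and there its
  coordinate displacement, which is at least \<open>r\<close> at that time, is bounded by the integral of the
  Euclidean speed, hence by its length divided by \<open>k\<close>.\<close>

lemma exit_length:
  assumes g: "good c x \<rho> k K" and r: "0 < r" "r < \<rho>"
    and \<gamma>: "pw \<gamma> 0 1" "\<gamma> 0 = x" "\<gamma> 1 \<notin> cinv c ` ball (snd c x) r"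
  shows "k * r \<le> len \<gamma> 0 1"
proof -
  note c = goodD(1)[OF g] and k = goodD(4)[OF g]
  let ?y0 = "snd c x"
  let ?O = "cinv c ` ball ?y0 r" and ?C = "cinv c ` cball ?y0 r"
  have cb: "cball ?y0 r \<subseteq> ball ?y0 \<rho>" using r by auto
  have oO: "openin T ?O" using good_open[OF g] r by simp
  have cC: "closedin T ?C" using compactin_imp_closedin[OF Hausdorff good_compact[OF g r(2)]] .
  have ct: "continuous_map (top_of_set {0..1}) T \<gamma>" by (rule pw_continuous[OF \<gamma>(1)])
  have "closedin T (points M - ?O)" using oO by blast
  from closedin_closed_trans[OF closedin_continuous_map_preimage[OF ct this]]
  have "closed {t \<in> {0..1}. \<gamma> t \<in> points M - ?O}" by simp
  moreover have "bounded {t \<in> {0..1::real}. \<gamma> t \<in> points M - ?O}" by (rule bounded_subset[of "{0..1}"]) auto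
  ultimately have "compact {t \<in> {0..1}. \<gamma> t \<in> points M - ?O}" by (simp add: compact_eq_bounded_closed)
  moreover have "1 \<in> {t \<in> {0..1}. \<gamma> t \<in> points M - ?O}" using \<gamma>(3) pw_points[OF \<gamma>(1), of 1] by simp
  ultimately obtain s where s: "s \<in> {t \<in> {0..1}. \<gamma> t \<in> points M - ?O}"
    "\<And>t. t \<in> {t \<in> {0..1}. \<gamma> t \<in> points M - ?O} \<Longrightarrow> s \<le> t"
    using compact_attains_inf[of "{t \<in> {0..1}. \<gamma> t \<in> points M - ?O}"] by blast
  have s0: "0 < s" using s(1) good_mem[OF g r(1)] \<gamma>(2) by (cases "s = 0") auto
  have inO: "\<gamma> t \<in> ?O" if "0 \<le> t" "t < s" for t
    using s(2)[of t] that s(1) pw_points[OF \<gamma>(1), of t] by force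
  from closedin_closed_trans[OF closedin_continuous_map_preimage[OF ct cC]]
  have "closed {t \<in> {0..1}. \<gamma> t \<in> ?C}" by simp
  moreover have "{0..<s} \<subseteq> {t \<in> {0..1}. \<gamma> t \<in> ?C}"
    using inO s(1) ball_subset_cball[of ?y0 r] by fastforce
  ultimately have "closure {0..<s} \<subseteq> {t \<in> {0..1}. \<gamma> t \<in> ?C}" by (rule closure_minimal[rotated])
  then have inC: "\<gamma> t \<in> ?C" if "t \<in> {0..s}" for t using that s0 by auto
  have inc: "\<gamma> t \<in> fst c" "snd c (\<gamma> t) \<in> cball ?y0 r" if "t \<in> {0..s}" for t
    using in_cinv_image_iff[OF c, of "cball ?y0 r" "\<gamma> t"] inC[OF that] cb goodD(6)[OF g] by auto
  have "\<not> snd c (\<gamma> s) \<in> ball ?y0 r"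
  proof
    assume "snd c (\<gamma> s) \<in> ball ?y0 r"
    then have "\<gamma> s \<in> ?O" using inc(1)[of s] s0 cinv_snd[OF c] by (metis atLeastAtMost_iff image_eqI less_imp_le order_refl)
    then show False using s(1) by simp
  qed
  then have dist: "r \<le> norm (snd c (\<gamma> s) - snd c (\<gamma> 0))" using \<gamma>(2) by (simp add: dist_norm norm_minus_commute)
  have pws: "pw \<gamma> 0 s" "len \<gamma> 0 s \<le> len \<gamma> 0 1"
  proof -
    show "pw \<gamma> 0 s" using pw_split[OF \<gamma>(1) s0] \<gamma>(1) s(1) by (cases "s = 1") auto
    show "len \<gamma> 0 s \<le> len \<gamma> 0 1"
    proof (cases "s = 1")
      case False
      then have "s < 1" using s(1) by auto
      then show ?thesis using len_split[OF \<gamma>(1) s0] len_nonneg[of \<gamma> s 1] pw_split[OF \<gamma>(1) s0] by simp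
    qed simp
  qed
  obtain F where F: "finite F" "\<And>t. t \<in> {0..s} - F \<Longrightarrow> \<exists>a' b'. a' < t \<and> t < b' \<and> C1_curve_on M a' b' \<gamma>"
    using pw_regular[OF pws(1)] by blast
  define f where "f = (\<lambda>t. if t \<in> F then 0 else vector_derivative (snd c \<circ> \<gamma>) (at t))"
  have reg: "((snd c \<circ> \<gamma>) has_vector_derivative f t) (at t) \<and> k * norm (f t) \<le> speed M \<gamma> t"
    if t: "t \<in> {0..s} - F" for t
  proof -
    have t': "t \<in> {0..s}" using t by simp
    obtain a' b' where C: "a' < t" "t < b'" "C1_curve_on M a' b' \<gamma>" using F(2)[OF t] by blast
    obtain D where D: "((snd c \<circ> \<gamma>) has_vector_derivative D) (at t)" "speed M \<gamma> t = gnorm M c (\<gamma> t) D"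
      using C1_curve_interior[OF C(3,1,2) c inc(1)[OF t']] by blast
    have "f t = D" using vector_derivative_at[OF D(1)] t by (simp add: f_def)
    moreover have "k * norm D \<le> gnorm M c (cinv c (snd c (\<gamma> t))) D"
      using good_gnorm(1)[OF g] inc(2)[OF t'] cb by blast
    ultimately show ?thesis using D cinv_snd[OF c inc(1)[OF t']] by simp
  qed
  have "continuous_on {0..s} (snd c \<circ> \<gamma>)"
  proof -
    have "continuous_map (top_of_set {0..s}) T \<gamma>" by (rule pw_continuous[OF pws(1)])
    then have "continuous_map (top_of_set {0..s}) (subtopology T (fst c)) \<gamma>"
      using inc(1) by (auto simp: continuous_map_in_subtopology)
    from continuous_map_compose[OF this snd_continuous[OF c]] show ?thesis by simp
  qed
  note cont = this
  have int: "(f has_integral (snd c \<circ> \<gamma>) s - (snd c \<circ> \<gamma>) 0) {0..s}"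
  proof (rule fundamental_theorem_of_calculus_interior_strong[OF F(1) _ _ cont])
    show "((snd c \<circ> \<gamma>) has_vector_derivative f t) (at t)" if "t \<in> {0<..<s} - F" for t
      using reg[of t] that by simp
  qed (use s0 in simp)
  have "norm (integral {0..s} f) \<le> integral {0..s} (\<lambda>t. if t \<in> F then 0 else speed M \<gamma> t / k)"
  proof (rule integral_norm_bound_integral)
    show "f integrable_on {0..s}" using int by blast
    have "(\<lambda>t. speed M \<gamma> t / k) integrable_on {0..s}"
      using integrable_on_cmult_right[OF speed_integrable[OF pws(1)], of "1 / k"] by simp
    then show "(\<lambda>t. if t \<in> F then 0 else speed M \<gamma> t / k) integrable_on {0..s}"
      by (rule integrable_spike_finite[OF F(1), rotated]) auto
    show "norm (f t) \<le> (if t \<in> F then 0 else speed M \<gamma> t / k)" if "t \<in> {0..s}" for t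
      using reg[of t] that k by (auto simp: f_def pos_le_divide_eq mult.commute)
  qed
  also have "integral {0..s} (\<lambda>t. if t \<in> F then 0 else speed M \<gamma> t / k) = integral {0..s} (\<lambda>t. speed M \<gamma> t / k)"
    by (rule integral_spike[OF negligible_finite[OF F(1)]]) auto
  also have "\<dots> = len \<gamma> 0 s / k" by (simp add: len_def)
  finally have "r \<le> len \<gamma> 0 s / k" using dist integral_unique[OF int] by simp
  then show ?thesis using pws(2) k by (simp add: field_simps)
qed

lemma exit_rdist:
  assumes g: "good c x \<rho> k K" and r: "0 < r" "r < \<rho>" and z: "z \<in> points M" "z \<notin> cinv c ` ball (snd c x) r"
  shows "k * r \<le> rdist M x z"
proof (rule rdist_ge[OF goodD(8)[OF g] z(1)])
  fix l assume "joined x z l"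
  then show "k * r \<le> l" using exit_length[OF g r] z(2) by (auto simp: joined_def)
qed

text \<open>Distinct points have positive distance because a curve between them leaves a small coordinate ball
  around the first one.\<close>

lemma rdist_Metric_space: "Metric_space (points M) (rdist M)"
proof
  fix x y
  show "0 \<le> rdist M x y"
    using rdist_ge[of x y 0] joined_nonneg by (cases "x \<in> points M \<and> y \<in> points M") (auto simp: rdist_def)
  have "joined x y = joined y x" using joined_sym by blast
  then show "rdist M x y = rdist M y x"
    using rdist_eq[of x y] rdist_eq[of y x] by (cases "x \<in> points M \<and> y \<in> points M") (auto simp: rdist_def)
next
  fix x y assume xy: "x \<in> points M" "y \<in> points M"
  show "rdist M x y = 0 \<longleftrightarrow> x = y"
  proof
    assume "x = y"
    then have "rdist M x y \<le> 0" using rdist_le[OF joined_refl[OF xy(1)]] by simp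
    moreover have "0 \<le> rdist M x y" using rdist_ge[OF xy, of 0] joined_nonneg by blast
    ultimately show "rdist M x y = 0" by simp
  next
    assume 0: "rdist M x y = 0"
    show "x = y"
    proof (rule ccontr)
      assume ne: "x \<noteq> y"
      obtain c \<rho> k K where g: "good c x \<rho> k K" using ex_good[OF xy(1)] by blast
      have "\<exists>r. 0 < r \<and> r < \<rho> \<and> y \<notin> cinv c ` ball (snd c x) r"
      proof (cases "y \<in> fst c")
        case True
        let ?r = "min (\<rho> / 2) (dist (snd c x) (snd c y))"
        have "snd c x \<noteq> snd c y" using ne chart_inj[OF goodD(1)[OF g]] True goodD(2)[OF g] by (auto simp: inj_on_def)
        moreover have "y \<notin> cinv c ` ball (snd c x) ?r"
        proof
          assume "y \<in> cinv c ` ball (snd c x) ?r"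
          moreover have "ball (snd c x) ?r \<subseteq> snd c ` fst c"
            using goodD(3,6)[OF g] by (auto simp: subset_iff)
          ultimately have "snd c y \<in> ball (snd c x) ?r" using in_cinv_image_iff[OF goodD(1)[OF g]] by blast
          then show False by simp
        qed
        ultimately show ?thesis using goodD(3)[OF g] by (intro exI[of _ ?r]) (auto simp: min_def)
      next
        case False
        have "y \<notin> cinv c ` ball (snd c x) (\<rho> / 2)"
        proof
          assume "y \<in> cinv c ` ball (snd c x) (\<rho> / 2)"
          then obtain w where "y = cinv c w" "w \<in> ball (snd c x) \<rho>" using goodD(3)[OF g] by auto
          then show False using False cinv_in[of w c] goodD(6)[OF g] by auto
        qed
        then show ?thesis using goodD(3)[OF g] by (intro exI[of _ "\<rho> / 2"]) auto
      qed
      then obtain r where r: "0 < r" "r < \<rho>" "y \<notin> cinv c ` ball (snd c x) r" by blast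
      then have "k * r \<le> 0" using exit_rdist[OF g r(1,2) xy(2) r(3)] 0 by simp
      moreover have "k * r > 0" using goodD(4)[OF g] r(1) by simp
      ultimately show False by simp
    qed
  qed
next
  fix x y z assume p: "x \<in> points M" "y \<in> points M" "z \<in> points M"
  show "rdist M x z \<le> rdist M x y + rdist M y z"
  proof (rule field_le_epsilon)
    fix e :: real assume "e > 0"
    then obtain l l' where l: "l < rdist M x y + e / 2" "joined x y l" "l' < rdist M y z + e / 2" "joined y z l'"
      using rdist_approx[OF p(1,2), of "rdist M x y + e / 2"] rdist_approx[OF p(2,3), of "rdist M y z + e / 2"] by auto
    then show "rdist M x z \<le> rdist M x y + rdist M y z + e"
      using rdist_le[OF joined_trans[OF l(2,4)]] by (simp add: field_simps)
  qed
qed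

text \<open>Stopping a nearly shortest curve after length \<open>s\<close>.\<close>

lemma rdist_intermediate:
  assumes p: "x \<in> points M" "y \<in> points M" and s: "0 \<le> s" and e: "0 \<le> e'" "0 < e" and d: "rdist M x y \<le> s + e'"
  shows "\<exists>z\<in>points M. rdist M x z \<le> s \<and> rdist M z y < e' + e"
proof -
  obtain \<gamma> where \<gamma>: "pw \<gamma> 0 1" "\<gamma> 0 = x" "\<gamma> 1 = y" and L: "len \<gamma> 0 1 < s + e' + e"
    using rdist_approx[OF p, of "s + e' + e"] d e by (auto simp: joined_def)
  interpret Metric_space "points M" "rdist M" by (rule rdist_Metric_space)
  consider "s = 0" | "len \<gamma> 0 1 \<le> s" | "0 < s" "s < len \<gamma> 0 1" using s by linarith
  then show ?thesis
  proof cases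
    case 1
    then show ?thesis using p d e by (intro bexI[of _ x]) auto
  next
    case 2
    have "rdist M x y \<le> len \<gamma> 0 1" using rdist_le[OF joined_pw[OF \<gamma>(1)]] \<gamma> by simp
    then show ?thesis using 2 p e by (intro bexI[of _ y]) auto
  next
    case 3
    have "continuous_on {0..1} (\<lambda>t. len \<gamma> 0 t)"
      unfolding len_def by (rule indefinite_integral_continuous_1[OF speed_integrable[OF \<gamma>(1)]])
    moreover have l0: "len \<gamma> 0 0 = 0" by (simp add: len_def)
    ultimately obtain t where t: "0 \<le> t" "t \<le> 1" "len \<gamma> 0 t = s"
      using IVT'[of "\<lambda>t. len \<gamma> 0 t" 0 s 1] 3 by auto
    then have t': "0 < t" "t < 1" using 3 l0 by (auto simp: less_le)
    note sp = pw_split[OF \<gamma>(1) t']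
    have "rdist M x (\<gamma> t) \<le> s" using rdist_le[OF joined_pw[OF conjunct1[OF sp]]] t(3) \<gamma> by simp
    moreover have "rdist M (\<gamma> t) y \<le> len \<gamma> t 1" using rdist_le[OF joined_pw[OF conjunct2[OF sp]]] \<gamma> by simp
    moreover have "len \<gamma> t 1 = len \<gamma> 0 1 - s" using len_split[OF \<gamma>(1) t'] t(3) by simp
    ultimately show ?thesis using L pw_points[OF \<gamma>(1), of t] t by (intro bexI[of _ "\<gamma> t"]) auto
  qed
qed

end

sublocale riemannian \<subseteq> D: Metric_space "points M" "rdist M"
  by (rule rdist_Metric_space)

context riemannian
begin

lemma good_rdist_le:
  assumes "good c x \<rho> k K" "y \<in> ball (snd c x) \<rho>" "y' \<in> ball (snd c x) \<rho>"
  shows "rdist M (cinv c y) (cinv c y') \<le> 2 * gnorm M c x (y' - y)"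
    "rdist M (cinv c y) (cinv c y') \<le> K * norm (y' - y)"
  using good_joined[OF assms] rdist_le by (meson order_trans)+

text \<open>Metric balls and coordinate balls are nested in each other: segments bound the distance from
  above, and the length of curves that leave a coordinate ball bounds it from below.\<close>

lemma mtopology_eq: "D.mtopology = T"
  unfolding topology_eq D.openin_mtopology
proof (intro allI iffI conjI impI)
  fix U x assume U: "openin T U" "x \<in> U"
  then have "x \<in> points M" using openin_subset by blast
  then obtain c \<rho> k K where g: "good c x \<rho> k K" using ex_good by blast
  have "openin T (U \<inter> fst c)" using U(1) chart_open[OF goodD(1)[OF g]] by (rule openin_Int)
  from open_snd_image[OF goodD(1)[OF g] this] have "open (snd c ` (U \<inter> fst c))" by simp
  moreover have "snd c x \<in> snd c ` (U \<inter> fst c)" using U(2) goodD(2)[OF g] by blast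
  ultimately obtain r0 where r0: "r0 > 0" "ball (snd c x) r0 \<subseteq> snd c ` (U \<inter> fst c)"
    using open_contains_ball by blast
  define r where "r = min r0 (\<rho> / 2)"
  have r: "0 < r" "r < \<rho>" "r \<le> r0" using r0(1) goodD(3)[OF g] by (auto simp: r_def)
  have "D.mball x (k * r) \<subseteq> U"
  proof
    fix z assume "z \<in> D.mball x (k * r)"
    then have "z \<in> points M" "rdist M x z < k * r" by auto
    then have "z \<in> cinv c ` ball (snd c x) r" using exit_rdist[OF g r(1,2)] by force
    then obtain w where w: "z = cinv c w" "w \<in> ball (snd c x) r0" using r(3) by auto
    then obtain u where "w = snd c u" "u \<in> U" "u \<in> fst c" using r0(2) by blast
    then show "z \<in> U" using w(1) cinv_snd[OF goodD(1)[OF g]] by simp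
  qed
  moreover have "k * r > 0" using goodD(4)[OF g] r(1) by simp
  ultimately show "\<exists>r>0. D.mball x r \<subseteq> U" by blast
next
  fix U assume "openin T U"
  then show "U \<subseteq> points M" by (rule openin_subset)
next
  fix U assume U: "U \<subseteq> points M \<and> (\<forall>x. x \<in> U \<longrightarrow> (\<exists>r>0. D.mball x r \<subseteq> U))"
  show "openin T U"
  proof (subst openin_subopen, intro ballI)
    fix x assume x: "x \<in> U"
    then obtain e where e: "e > 0" "D.mball x e \<subseteq> U" using U by blast
    have "x \<in> points M" using x U by blast
    from ex_good[OF this] obtain c \<rho> k K where g: "good c x \<rho> k K" by blast
    define r where "r = min \<rho> (e / K)"
    have r: "0 < r" "r \<le> \<rho>" "r \<le> e / K" using e(1) goodD(3,5)[OF g] by (auto simp: r_def)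
    have "cinv c ` ball (snd c x) r \<subseteq> U"
    proof safe
      fix w assume w: "w \<in> ball (snd c x) r"
      then have w': "w \<in> ball (snd c x) \<rho>" using r(2) by auto
      have "rdist M x (cinv c w) \<le> K * norm (w - snd c x)"
        using good_rdist_le(2)[OF g _ w', of "snd c x"] goodD(3,7)[OF g] by simp
      also have "\<dots> < K * r" using w goodD(5)[OF g] by (simp add: dist_norm norm_minus_commute)
      also have "\<dots> \<le> e" using r(3) goodD(5)[OF g] by (simp add: field_simps)
      finally have "cinv c w \<in> D.mball x e"
        using goodD(8)[OF g] chart_points[OF goodD(1)[OF g] cinv_in] goodD(6)[OF g] w' by auto
      then show "cinv c w \<in> U" using e(2) by blast
    qed
    then show "\<exists>N. openin T N \<and> x \<in> N \<and> N \<subseteq> U" using good_open[OF g r(2)] good_mem[OF g r(1)] by blast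
  qed
qed

lemma geodesic_ball_eq: "geodesic_ball M = D.mball"
  by (simp add: geodesic_ball_def)

end


section \<open>Closed balls are compact\<close>

context riemannian
begin

lemma ex_compact_mcball:
  assumes "x \<in> points M"
  shows "\<exists>e>0. compactin T (D.mcball x e)"
proof -
  obtain c \<rho> k K where g: "good c x \<rho> k K" using ex_good[OF assms] by blast
  let ?r = "\<rho> / 2"
  have r: "0 < ?r" "?r < \<rho>" using goodD(3)[OF g] by auto
  have "D.mcball x (k * ?r / 2) \<subseteq> cinv c ` cball (snd c x) ?r"
  proof
    fix z assume "z \<in> D.mcball x (k * ?r / 2)"
    then have z: "z \<in> points M" "rdist M x z \<le> k * ?r / 2" by auto
    have "k * ?r > 0" using goodD(4)[OF g] r(1) by simp
    then have "z \<in> cinv c ` ball (snd c x) ?r" using exit_rdist[OF g r z(1)] z(2) by fastforce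
    then show "z \<in> cinv c ` cball (snd c x) ?r" using ball_subset_cball by blast
  qed
  then have "compactin T (D.mcball x (k * ?r / 2))"
    using closed_compactin[OF good_compact[OF g r(2)]] D.closedin_mcball[of x] mtopology_eq by metis
  then show ?thesis using goodD(4)[OF g] r(1) by (intro exI[of _ "k * ?r / 2"]) simp
qed

text \<open>Let \<open>\<rho>\<close> be the supremum of the radii whose closed ball is compact. Points at distance at most
  \<open>\<rho>\<close> are close to points at a slightly smaller distance, so the closed ball of radius \<open>\<rho>\<close> is totally
  bounded, hence compact by completeness; a finite cover by small compact balls then reaches beyond
  \<open>\<rho>\<close>. Both steps use that distances are almost attained by curves.\<close>

theorem compact_mcball:
  assumes complete: "D.mcomplete" and x0: "x0 \<in> points M"
  shows "compactin T (D.mcball x0 r)"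
proof (rule ccontr)
  assume nc: "\<not> compactin T (D.mcball x0 r)"
  have sub: "compactin T (D.mcball x0 s)" if "compactin T (D.mcball x0 t)" "s \<le> t" for s t
    by (rule closed_compactin[OF that(1) D.mcball_subset_concentric[OF that(2)]])
       (use D.closedin_mcball[of x0 s] mtopology_eq in simp)
  define S where "S = {s. 0 \<le> s \<and> compactin T (D.mcball x0 s)}"
  have "x = x0" if "x \<in> points M" "rdist M x0 x \<le> 0" for x
    using D.zero[OF x0 that(1)] D.nonneg[of x0 x] that(2) by auto
  then have "D.mcball x0 0 = {x0}" using x0 by auto
  then have S0: "0 \<in> S" using x0 by (simp add: S_def)
  have lt: "s < r" if "s \<in> S" for s using sub[of s r] nc that by (force simp: S_def)
  then have bdd: "bdd_above S" by (meson bdd_aboveI less_imp_le)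
  define \<rho> where "\<rho> = Sup S"
  have \<rho>0: "0 \<le> \<rho>" unfolding \<rho>_def by (rule cSup_upper[OF S0 bdd])
  have below: "compactin T (D.mcball x0 t)" if t: "t < \<rho> \<or> t = 0" for t
  proof (cases "t = 0")
    case True then show ?thesis using S0 by (simp add: S_def)
  next
    case False
    then obtain s where "s \<in> S" "t < s" using t less_cSup_iff[of S t] S0 bdd unfolding \<rho>_def by blast
    then show ?thesis using sub[of s t] by (simp add: S_def)
  qed
  have "D.mtotally_bounded (D.mcball x0 \<rho>)"
    unfolding D.mtotally_bounded_def
  proof (intro allI impI)
    fix \<epsilon> :: real assume \<epsilon>: "\<epsilon> > 0"
    define t where "t = max 0 (\<rho> - \<epsilon> / 4)"
    have t: "0 \<le> t" "t < \<rho> \<or> t = 0" "t \<le> \<rho>" "\<rho> \<le> t + \<epsilon> / 4" using \<epsilon> \<rho>0 by (auto simp: t_def)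
    have "D.mtotally_bounded (D.mcball x0 t)"
      using D.compactin_imp_mtotally_bounded below[OF t(2)] mtopology_eq by simp
    from this[unfolded D.mtotally_bounded_def, rule_format, OF half_gt_zero[OF \<epsilon>]]
    obtain K where K: "finite K" "K \<subseteq> D.mcball x0 t" "D.mcball x0 t \<subseteq> (\<Union>x\<in>K. D.mball x (\<epsilon> / 2))"
      by blast
    have "D.mcball x0 \<rho> \<subseteq> (\<Union>x\<in>K. D.mball x \<epsilon>)"
    proof
      fix y assume "y \<in> D.mcball x0 \<rho>"
      then have y: "y \<in> points M" "rdist M x0 y \<le> t + \<epsilon> / 4" using t(4) by auto
      obtain z where z: "z \<in> points M" "rdist M x0 z \<le> t" "rdist M z y < \<epsilon> / 4 + \<epsilon> / 4"
        using rdist_intermediate[OF x0 y(1) t(1) _ _ y(2), of "\<epsilon> / 4"] \<epsilon> by auto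
      then have "z \<in> D.mcball x0 t" using x0 by simp
      then obtain k where k: "k \<in> K" "z \<in> D.mball k (\<epsilon> / 2)" using K(3) by blast
      then have "rdist M k y < \<epsilon>" using D.triangle[of k z y] z y(1) by auto
      then show "y \<in> (\<Union>x\<in>K. D.mball x \<epsilon>)" using k y(1) by auto
    qed
    moreover have "K \<subseteq> D.mcball x0 \<rho>" using K(2) D.mcball_subset_concentric[OF t(3)] by blast
    ultimately show "\<exists>K. finite K \<and> K \<subseteq> D.mcball x0 \<rho> \<and> D.mcball x0 \<rho> \<subseteq> (\<Union>x\<in>K. D.mball x \<epsilon>)"
      using K(1) by blast
  qed
  then have c\<rho>: "compactin T (D.mcball x0 \<rho>)"
    using D.mtotally_bounded_eq_compact_closure_of[OF complete, of "D.mcball x0 \<rho>"]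
      closure_of_closedin[OF D.closedin_mcball[of x0 \<rho>]] mtopology_eq by simp
  have "\<forall>x\<in>points M. \<exists>e>0. compactin T (D.mcball x e)" using ex_compact_mcball by blast
  from bchoice[OF this]
  obtain e where e: "\<And>x. x \<in> points M \<Longrightarrow> e x > 0" "\<And>x. x \<in> points M \<Longrightarrow> compactin T (D.mcball x (e x))" by blast
  let ?\<U> = "(\<lambda>x. D.mball x (e x / 2)) ` D.mcball x0 \<rho>"
  have op: "\<And>U. U \<in> ?\<U> \<Longrightarrow> openin T U" using D.openin_mball mtopology_eq by auto
  have cov: "D.mcball x0 \<rho> \<subseteq> \<Union>?\<U>"
  proof
    fix x assume x: "x \<in> D.mcball x0 \<rho>"
    then have "x \<in> D.mball x (e x / 2)" using e(1)[of x] by auto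
    then show "x \<in> \<Union>?\<U>" using x by blast
  qed
  obtain \<F> where "finite \<F>" "\<F> \<subseteq> ?\<U>" "D.mcball x0 \<rho> \<subseteq> \<Union>\<F>"
    using compactinD[OF c\<rho> op cov] by blast
  then obtain F where F: "finite F" "F \<subseteq> D.mcball x0 \<rho>" "D.mcball x0 \<rho> \<subseteq> (\<Union>x\<in>F. D.mball x (e x / 2))"
    using finite_subset_image[of \<F> "\<lambda>x. D.mball x (e x / 2)" "D.mcball x0 \<rho>"] by blast
  have Fp: "x \<in> points M" if "x \<in> F" for x using F(2) that by auto
  have "F \<noteq> {}" using F(3) x0 \<rho>0 by auto
  define \<eta> where "\<eta> = Min (e ` F) / 4"
  have \<eta>: "\<eta> > 0" "\<And>x. x \<in> F \<Longrightarrow> \<eta> \<le> e x / 4"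
    using F(1) \<open>F \<noteq> {}\<close> e(1) Fp by (auto simp: \<eta>_def)
  have "compactin T (\<Union>x\<in>F. D.mcball x (e x))"
    by (rule compactin_Union) (use F(1) e(2) Fp in auto)
  moreover have "D.mcball x0 (\<rho> + \<eta>) \<subseteq> (\<Union>x\<in>F. D.mcball x (e x))"
  proof
    fix y assume "y \<in> D.mcball x0 (\<rho> + \<eta>)"
    then have y: "y \<in> points M" "rdist M x0 y \<le> \<rho> + \<eta>" by auto
    obtain z where z: "z \<in> points M" "rdist M x0 z \<le> \<rho>" "rdist M z y < \<eta> + \<eta>"
      using rdist_intermediate[OF x0 y(1) \<rho>0 _ \<eta>(1) y(2)] \<eta>(1) by auto
    then have "z \<in> D.mcball x0 \<rho>" using x0 by simp
    then obtain x where x: "x \<in> F" "z \<in> D.mball x (e x / 2)" using F(3) by blast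
    have "rdist M x y \<le> e x"
      using D.triangle[of x z y] z y(1) x \<eta>(2)[OF x(1)] Fp[OF x(1)] by auto
    then show "y \<in> (\<Union>x\<in>F. D.mcball x (e x))" using x(1) y(1) Fp[OF x(1)] by auto
  qed
  ultimately have "compactin T (D.mcball x0 (\<rho> + \<eta>))"
    by (rule closed_compactin) (use D.closedin_mcball[of x0 "\<rho> + \<eta>"] mtopology_eq in simp)
  then have "\<rho> + \<eta> \<in> S" using \<rho>0 \<eta>(1) by (simp add: S_def)
  then show False using cSup_upper[OF _ bdd] \<eta>(1) by (fastforce simp: \<rho>_def)
qed

end


section \<open>Change of variables for nonnegative functions\<close>

text \<open>The Jacobian formula \<open>has_absolute_integral_change_of_variables\<close> concerns Cartesian spaces with a
  well-ordered index type. The type \<open>'n ordered\<close> is a copy of an arbitrary finite index type, ordered by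
  an enumeration; relabelling the coordinates preserves Lebesgue measure and determinants.\<close>

datatype 'n ordered = Ord (unOrd: 'n)

instance ordered :: (finite) finite
proof
  have "(UNIV :: 'a ordered set) = range Ord" by (metis ordered.collapse surjI)
  then show "finite (UNIV :: 'a ordered set)" by (metis finite finite_imageI)
qed

instantiation ordered :: (finite) wellorder
begin

definition "x \<le> y \<longleftrightarrow> to_nat (unOrd x) \<le> to_nat (unOrd y)"
definition "x < y \<longleftrightarrow> to_nat (unOrd x) < to_nat (unOrd y)"

instance
proof
  fix x y z :: "'a ordered"
  show "x < y \<longleftrightarrow> x \<le> y \<and> \<not> y \<le> x" "x \<le> x" "x \<le> y \<or> y \<le> x"
    by (auto simp: less_eq_ordered_def less_ordered_def)
  show "x \<le> y \<Longrightarrow> y \<le> z \<Longrightarrow> x \<le> z" by (simp add: less_eq_ordered_def)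
  show "x \<le> y \<Longrightarrow> y \<le> x \<Longrightarrow> x = y"
    by (simp add: less_eq_ordered_def ordered.expand)
next
  fix P :: "'a ordered \<Rightarrow> bool" and a :: "'a ordered"
  assume step: "\<And>x. (\<And>y. y < x \<Longrightarrow> P y) \<Longrightarrow> P x"
  show "P a"
    by (induction "to_nat (unOrd a)" arbitrary: a rule: less_induct) (use step less_ordered_def in blast)
qed

end

lemma all_ordered: "(\<forall>i. Q i) \<longleftrightarrow> (\<forall>j. Q (Ord j))"
  by (metis ordered.collapse)

lemma bij_Ord: "bij Ord" by (metis bijI' ordered.collapse ordered.inject)

lemma sign_conj_bij:
  fixes f :: "'a::finite \<Rightarrow> 'b::finite"
  assumes f: "bij f" and p: "p permutes UNIV"
  shows "f \<circ> p \<circ> inv f permutes UNIV \<and> sign (f \<circ> p \<circ> inv f) = sign p"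
  using p finite
proof (induction p rule: permutes_induct)
  case id
  have "f \<circ> id \<circ> inv f = id" using f by (simp add: fun_eq_iff bij_is_surj surj_f_inv_f)
  then show ?case by (simp only: permutes_id sign_id simp_thms)
next
  case (swap a b p)
  let ?q = "f \<circ> p \<circ> inv f"
  have eq: "f \<circ> (Transposition.transpose a b \<circ> p) \<circ> inv f = Transposition.transpose (f a) (f b) \<circ> ?q"
    using bij_is_inj[OF f] by (auto simp: fun_eq_iff Transposition.transpose_def inj_eq)
  have perm: "permutation (Transposition.transpose (f a) (f b))" "permutation ?q"
    "permutation (Transposition.transpose a b)" "permutation p"
    by (intro permutation_swap_id permutation_permutes[THEN iffD2] exI[of _ UNIV] conjI finite
        conjunct1[OF swap(5)] swap(4))+
  have "f a \<noteq> f b" using f swap(3) by (simp add: bij_is_inj inj_eq)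
  then have "sign (Transposition.transpose (f a) (f b) \<circ> ?q) = sign (Transposition.transpose a b \<circ> p)"
    using swap(3) perm conjunct2[OF swap(5)] by (simp only: sign_compose sign_swap_id if_False)
  moreover have "Transposition.transpose (f a) (f b) \<circ> ?q permutes UNIV"
    by (intro permutes_compose[OF conjunct1[OF swap(5)]] permutes_swap_id) auto
  ultimately show ?case by (simp only: eq simp_thms)
qed

lemma det_reindex:
  fixes f :: "'b::finite \<Rightarrow> 'a::finite" and A :: "real ^ 'a ^ 'a"
  assumes f: "bij f"
  shows "det (\<chi> i j. A $ f i $ f j) = det A"
proof -
  have fi: "f (inv f x) = x" "inv f (f y) = y" for x y
    using f by (simp_all add: bij_is_surj surj_f_inv_f bij_is_inj)
  have bi: "bij (inv f)" using f by (rule bij_imp_bij_inv)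
  have "bij_betw (\<lambda>p. f \<circ> p \<circ> inv f) {p. p permutes UNIV} {p. p permutes UNIV}"
  proof (rule bij_betw_byWitness[where f' = "\<lambda>p. inv f \<circ> p \<circ> f"])
    show "(\<lambda>p. f \<circ> p \<circ> inv f) ` {p. p permutes UNIV} \<subseteq> {p. p permutes UNIV}"
      using sign_conj_bij[OF f] by blast
    show "(\<lambda>p. inv f \<circ> p \<circ> f) ` {p. p permutes UNIV} \<subseteq> {p. p permutes UNIV}"
      using sign_conj_bij[OF bi] inv_inv_eq[OF f] by auto
  qed (auto simp: fun_eq_iff fi)
  from sum.reindex_bij_betw[OF this, of "\<lambda>p. of_int (sign p) * (\<Prod>i\<in>UNIV. A $ i $ p i)"]
  have "det A = (\<Sum>p | p permutes UNIV. of_int (sign (f \<circ> p \<circ> inv f)) * (\<Prod>i\<in>UNIV. A $ i $ (f \<circ> p \<circ> inv f) i))"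
    by (simp add: det_def)
  also have "\<dots> = (\<Sum>p | p permutes UNIV. of_int (sign p) * (\<Prod>i\<in>UNIV. A $ f i $ f (p i)))"
  proof (rule sum.cong[OF refl])
    fix p :: "'b \<Rightarrow> 'b" assume "p \<in> {p. p permutes UNIV}"
    then have "sign (f \<circ> p \<circ> inv f) = sign p" using sign_conj_bij[OF f] by blast
    moreover have "(\<Prod>i\<in>UNIV. A $ f i $ f (p i)) = (\<Prod>i\<in>UNIV. A $ i $ (f \<circ> p \<circ> inv f) i)"
      using prod.reindex_bij_betw[OF f, of "\<lambda>i. A $ i $ (f \<circ> p \<circ> inv f) i"] by (simp add: fi)
    ultimately show "of_int (sign (f \<circ> p \<circ> inv f)) * (\<Prod>i\<in>UNIV. A $ i $ (f \<circ> p \<circ> inv f) i)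
      = of_int (sign p) * (\<Prod>i\<in>UNIV. A $ f i $ f (p i))" by simp
  qed
  also have "\<dots> = det (\<chi> i j. A $ f i $ f j)" by (simp add: det_def)
  finally show ?thesis by simp
qed

definition relabel :: "real ^ 'n \<Rightarrow> real ^ ('n::finite) ordered" where
  "relabel x = (\<chi> i. x $ unOrd i)"

definition unlabel :: "real ^ ('n::finite) ordered \<Rightarrow> real ^ 'n" where
  "unlabel y = (\<chi> i. y $ Ord i)"

lemma relabel_inverse [simp]: "unlabel (relabel x) = x" "relabel (unlabel y) = y"
  by (simp_all add: relabel_def unlabel_def vec_eq_iff)

lemma relabel_linear: "linear relabel" "linear unlabel"
  by (simp_all add: linear_iff relabel_def unlabel_def vec_eq_iff)

lemma relabel_bounded_linear: "bounded_linear relabel" "bounded_linear unlabel"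
  using relabel_linear linear_conv_bounded_linear by blast+

lemma relabel_measurable [measurable]: "relabel \<in> borel_measurable borel" "unlabel \<in> borel_measurable borel"
  by (intro borel_measurable_continuous_onI linear_continuous_on relabel_bounded_linear)+

lemma lborel_relabel: "distr lborel borel relabel = (lborel :: (real ^ 'n::finite ordered) measure)"
proof (rule lborel_eqI[symmetric])
  fix l u :: "real ^ 'n ordered" assume le: "\<And>b. b \<in> Basis \<Longrightarrow> l \<bullet> b \<le> u \<bullet> b"
  have le': "l $ i \<le> u $ i" for i using le[of "axis i 1"] by (simp add: inner_axis)
  have "relabel -` box l u = box (unlabel l) (unlabel u)"
    by (rule set_eqI) (simp add: mem_box_cart relabel_def unlabel_def all_ordered)
  then have "emeasure (distr lborel borel relabel) (box l u) = emeasure lborel (box (unlabel l) (unlabel u))"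
    by (simp add: emeasure_distr)
  also have "\<dots> = ennreal (\<Prod>b\<in>Basis. (unlabel u - unlabel l) \<bullet> b)"
    by (rule emeasure_lborel_box) (use le' in \<open>auto simp: Basis_vec_def inner_axis unlabel_def\<close>)
  also have "(\<Prod>b\<in>Basis. (unlabel u - unlabel l) \<bullet> b) = (\<Prod>i\<in>UNIV. (u - l) $ Ord i)"
    by (simp add: Basis_vec_def UNION_singleton_eq_range prod.reindex inj_on_def axis_eq_axis inner_axis unlabel_def)
  also have "\<dots> = (\<Prod>i\<in>UNIV. (u - l) $ i)"
    by (rule prod.reindex_bij_betw[OF bij_Ord])
  also have "\<dots> = (\<Prod>b\<in>Basis. (u - l) \<bullet> b)"
    by (simp add: Basis_vec_def UNION_singleton_eq_range prod.reindex inj_on_def axis_eq_axis inner_axis)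
  finally show "emeasure (distr lborel borel relabel) (box l u) = ennreal (\<Prod>b\<in>Basis. (u - l) \<bullet> b)" .
qed simp

lemma nn_integral_unlabel:
  assumes "h \<in> borel_measurable borel"
  shows "(\<integral>\<^sup>+ y. h (unlabel y) \<partial>lborel) = (\<integral>\<^sup>+ x. h x \<partial>lborel)"
proof -
  have m: "(\<lambda>y. h (unlabel y)) \<in> borel_measurable borel"
    using measurable_compose[OF relabel_measurable(2) assms] .
  show ?thesis
    unfolding lborel_relabel[symmetric] using m by (subst nn_integral_distr) simp_all
qed

lemma det_matrix_relabel:
  fixes D :: "real ^ 'n::finite \<Rightarrow> real ^ 'n"
  shows "det (matrix (\<lambda>y. relabel (D (unlabel y)))) = det (matrix D)"
proof -
  have un: "unlabel (axis i 1) = axis (unOrd i) 1" for i :: "'n ordered"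
    by (auto simp: unlabel_def vec_eq_iff axis_def)
  have "bij (unOrd :: 'n ordered \<Rightarrow> 'n)" by (metis bijI' ordered.expand ordered.sel)
  then have "det (\<chi> i j. matrix D $ unOrd i $ unOrd j) = det (matrix D)" by (rule det_reindex)
  then show ?thesis by (simp add: matrix_def un relabel_def)
qed

text \<open>Where the integrand is bounded on a bounded set both sides are finite and the formula for
  integrable functions applies; monotone convergence does the rest.\<close>

lemma change_of_variables_wellorder:
  fixes \<tau> :: "real ^ 'm::{finite,wellorder} \<Rightarrow> real ^ 'm::_"
  assumes S: "S \<in> sets borel" and der: "\<And>x. x \<in> S \<Longrightarrow> (\<tau> has_derivative D x) (at x within S)"
    and inj: "inj_on \<tau> S" and im: "\<And>B. B \<in> sets borel \<Longrightarrow> B \<subseteq> S \<Longrightarrow> \<tau> ` B \<in> sets borel"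
    and f: "f \<in> borel_measurable borel" "\<And>y. 0 \<le> f y" and g: "g \<in> borel_measurable borel"
    and gf: "\<And>x. x \<in> S \<Longrightarrow> g x = \<bar>det (matrix (D x))\<bar> * f (\<tau> x)"
  shows "(\<integral>\<^sup>+ y. ennreal (f y) * indicator (\<tau> ` S) y \<partial>lborel) = (\<integral>\<^sup>+ x. ennreal (g x) * indicator S x \<partial>lborel)"
proof -
  define A where "A = (\<lambda>k::nat. S \<inter> {x. norm x \<le> k} \<inter> {x. g x \<le> k})"
  have gm: "{x. g x \<le> k} \<in> sets borel" for k using g by measurable
  have Ab: "A k \<in> sets borel" for k
    unfolding A_def using S gm[of k] by (intro sets.Int) auto
  have AS: "A k \<subseteq> S" for k by (auto simp: A_def)
  have Ainc: "incseq A" by (auto simp: A_def incseq_def) 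
  have AU: "(\<Union>k. A k) = S"
  proof
    show "S \<subseteq> (\<Union>k. A k)"
    proof
      fix x assume "x \<in> S"
      obtain k :: nat where "max (norm x) (g x) \<le> k" using real_arch_simple by blast
      then show "x \<in> (\<Union>k. A k)" using \<open>x \<in> S\<close> by (auto simp: A_def)
    qed
  qed (use AS in blast)
  have piece: "(\<integral>\<^sup>+ y. ennreal (f y) * indicator (\<tau> ` A k) y \<partial>lborel) = (\<integral>\<^sup>+ x. ennreal (g x) * indicator (A k) x \<partial>lborel)" for k
  proof -
    have g0: "0 \<le> g x" if "x \<in> A k" for x using gf AS[of k] that f(2) by auto
    have "A k \<subseteq> cball 0 k" by (auto simp: A_def)
    then have fin: "emeasure lborel (A k) < \<infinity>"
      using emeasure_mono[of "A k" "cball 0 k" lborel] emeasure_lborel_cball_finite[of "0 :: real ^ 'm::_" "real k"]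
      by (simp add: order_le_less_trans)
    have "integrable lborel (\<lambda>x. indicator (A k) x *\<^sub>R g x)"
      by (rule integrableI_bounded_set_indicator[of _ _ _ "real k"]) (use Ab g fin g0 in \<open>auto simp: A_def\<close>)
    then have "set_integrable lebesgue (A k) g"
      unfolding set_integrable_def using Ab g by (subst integrable_completion) auto
    moreover have "bounded_linear (vec :: real \<Rightarrow> real ^ 1)"
      unfolding linear_conv_bounded_linear[symmetric] by (simp add: linear_iff vec_eq_iff)
    ultimately have "(vec \<circ> g :: _ \<Rightarrow> real ^ 1) absolutely_integrable_on A k" by (rule absolutely_integrable_linear)
    then have gi: "(\<lambda>x. vec (g x) :: real ^ 1) absolutely_integrable_on A k" by (simp add: o_def)
    have eq: "\<bar>det (matrix (D x))\<bar> *\<^sub>R vec (f (\<tau> x)) = (vec (g x) :: real ^ 1)" if "x \<in> A k" for x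
      using gf AS[of k] that by (auto simp: vec_eq_iff)
    (* The Jacobian formula is for vector-valued functions, so g is read as a vector of length 1. *)
    let ?I = "integral (A k) (\<lambda>x. vec (g x) :: real ^ 1)"
    have "(\<lambda>x. \<bar>det (matrix (D x))\<bar> *\<^sub>R (vec (f (\<tau> x)) :: real ^ 1)) absolutely_integrable_on A k
        \<longleftrightarrow> (\<lambda>x. vec (g x) :: real ^ 1) absolutely_integrable_on A k"
      by (rule set_integrable_cong[OF refl refl eq])
    then have l1: "(\<lambda>x. \<bar>det (matrix (D x))\<bar> *\<^sub>R (vec (f (\<tau> x)) :: real ^ 1)) absolutely_integrable_on A k"
      using gi by (rule iffD2)
    have l2: "integral (A k) (\<lambda>x. \<bar>det (matrix (D x))\<bar> *\<^sub>R (vec (f (\<tau> x)) :: real ^ 1)) = ?I"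
      by (rule integral_cong[OF eq])
    have Al: "A k \<in> sets lebesgue" using Ab by simp
    have dA: "(\<tau> has_derivative D x) (at x within A k)" if "x \<in> A k" for x
      by (rule has_derivative_subset[OF der AS]) (use AS that in blast)
    have iA: "inj_on \<tau> (A k)" using inj AS inj_on_subset by blast
    have "(\<lambda>y. vec (f y) :: real ^ 1) absolutely_integrable_on \<tau> ` A k \<and>
        integral (\<tau> ` A k) (\<lambda>y. vec (f y) :: real ^ 1) = ?I"
      by (rule iffD1[OF has_absolute_integral_change_of_variables[OF Al dA iA] conjI[OF l1 l2]])
    then have fi: "(\<lambda>y. vec (f y) :: real ^ 1) absolutely_integrable_on \<tau> ` A k"
        "integral (\<tau> ` A k) (\<lambda>y. vec (f y) :: real ^ 1) = ?I"
      by (rule conjunct1, rule conjunct2)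
    have "((\<lambda>y. vec (f y) :: real ^ 1) has_integral ?I) (\<tau> ` A k)"
      using set_lebesgue_integral_eq_integral(1)[OF fi(1)] fi(2) by (simp add: has_integral_integrable_integral)
    moreover have "((\<lambda>x. vec (g x) :: real ^ 1) has_integral ?I) (A k)"
      using set_lebesgue_integral_eq_integral(1)[OF gi] by (rule integrable_integral)
    ultimately have "(f has_integral ?I $ 1) (\<tau> ` A k)" "(g has_integral ?I $ 1) (A k)"
      using has_integral_linear[OF _ bounded_linear_vec_nth[of 1], of "\<lambda>y. vec (f y)" ?I "\<tau> ` A k"]
        has_integral_linear[OF _ bounded_linear_vec_nth[of 1], of "\<lambda>x. vec (g x)" ?I "A k"] by (simp_all add: o_def)
    then show ?thesis
      using nn_integral_has_integral_lebesgue'[of "\<tau> ` A k" f] nn_integral_has_integral_lebesgue'[of "A k" g] f(2) g0 by simp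
  qed
  let ?F = "density lborel (\<lambda>y. ennreal (f y))" and ?G = "density lborel (\<lambda>x. ennreal (g x))"
  have tA: "\<tau> ` A k \<in> sets borel" for k by (rule im[OF Ab AS])
  have "(SUP k. emeasure ?F (\<tau> ` A k)) = emeasure ?F (\<Union>k. \<tau> ` A k)"
  proof (rule SUP_emeasure_incseq)
    show "incseq (\<lambda>k. \<tau> ` A k)" using Ainc by (simp add: incseq_def image_mono)
  qed (use tA in auto)
  moreover have "(SUP k. emeasure ?G (A k)) = emeasure ?G (\<Union>k. A k)"
    by (rule SUP_emeasure_incseq) (use Ab Ainc in auto)
  moreover have "emeasure ?F (\<tau> ` A k) = emeasure ?G (A k)" for k
    using piece[of k] tA Ab f(1) g by (simp add: emeasure_density)
  moreover have "(\<Union>k. \<tau> ` A k) = \<tau> ` S" using AU by blast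
  ultimately have "emeasure ?F (\<tau> ` S) = emeasure ?G S" using AU by simp
  then show ?thesis using im[OF S order_refl] S f(1) g by (simp add: emeasure_density)
qed

theorem change_of_variables_nonneg:
  fixes \<tau> :: "real ^ 'n::finite \<Rightarrow> real ^ 'n"
  assumes S: "S \<in> sets borel" and der: "\<And>x. x \<in> S \<Longrightarrow> (\<tau> has_derivative D x) (at x within S)"
    and inj: "inj_on \<tau> S" and im: "\<And>B. B \<in> sets borel \<Longrightarrow> B \<subseteq> S \<Longrightarrow> \<tau> ` B \<in> sets borel"
    and f: "f \<in> borel_measurable borel" "\<And>y. 0 \<le> f y" and g: "g \<in> borel_measurable borel"
    and gf: "\<And>x. x \<in> S \<Longrightarrow> g x = \<bar>det (matrix (D x))\<bar> * f (\<tau> x)"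
  shows "(\<integral>\<^sup>+ y. ennreal (f y) * indicator (\<tau> ` S) y \<partial>lborel) = (\<integral>\<^sup>+ x. ennreal (g x) * indicator S x \<partial>lborel)"
proof -
  let ?\<tau> = "\<lambda>y. relabel (\<tau> (unlabel y))" and ?S = "relabel ` S"
  have rim: "relabel ` B = unlabel -` B" for B :: "(real ^ 'n) set"
    by (auto intro: image_eqI[of _ _ "unlabel _"])
  have uim: "unlabel ` B = relabel -` B" for B :: "(real ^ 'n ordered) set"
    by (auto intro: image_eqI[of _ _ "relabel _"])
  have rb: "relabel ` B \<in> sets borel" if "B \<in> sets borel" for B :: "(real ^ 'n) set"
    unfolding rim using measurable_sets[OF relabel_measurable(2) that] by simp
  have ub: "unlabel ` B \<in> sets borel" if "B \<in> sets borel" for B :: "(real ^ 'n ordered) set"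
    unfolding uim using measurable_sets[OF relabel_measurable(1) that] by simp
  have ind: "indicator (relabel ` B) y = (indicator B (unlabel y) :: ennreal)" for B :: "(real ^ 'n) set" and y
    unfolding rim by (simp add: indicator_def)
  have tS: "?\<tau> ` ?S = relabel ` (\<tau> ` S)" by (simp add: image_image)
  have "(\<integral>\<^sup>+ y. ennreal (f (unlabel y)) * indicator (?\<tau> ` ?S) y \<partial>lborel) =
      (\<integral>\<^sup>+ x. ennreal (g (unlabel x)) * indicator ?S x \<partial>lborel)"
  proof (rule change_of_variables_wellorder[where D = "\<lambda>y v. relabel (D (unlabel y) (unlabel v))"])
    show "?S \<in> sets borel" by (rule rb[OF S])
    show "(?\<tau> has_derivative (\<lambda>v. relabel (D (unlabel y) (unlabel v)))) (at y within ?S)" if "y \<in> ?S" for y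
    proof -
      have y: "unlabel y \<in> S" "unlabel ` ?S = S" using that by (auto simp: image_image)
      have 1: "(unlabel has_derivative unlabel) (at y within ?S)"
        by (rule bounded_linear_imp_has_derivative[OF relabel_bounded_linear(2)])
      have 2: "(\<tau> has_derivative D (unlabel y)) (at (unlabel y) within unlabel ` ?S)"
        using der[OF y(1)] y(2) by simp
      from bounded_linear.has_derivative[OF relabel_bounded_linear(1) diff_chain_within[OF 1 2]]
      show ?thesis by (simp add: o_def)
    qed
    show "inj_on ?\<tau> ?S"
    proof (rule inj_onI)
      fix x y assume xy: "x \<in> ?S" "y \<in> ?S" "?\<tau> x = ?\<tau> y"
      then have "\<tau> (unlabel x) = \<tau> (unlabel y)" by (metis relabel_inverse(1))
      moreover have "unlabel x \<in> S" "unlabel y \<in> S" using xy(1,2) by auto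
      ultimately have "unlabel x = unlabel y" by (rule inj_onD[OF inj])
      then have "relabel (unlabel x) = relabel (unlabel y)" by (rule arg_cong)
      then show "x = y" by simp
    qed
    show "?\<tau> ` B \<in> sets borel" if "B \<in> sets borel" "B \<subseteq> ?S" for B
    proof -
      have "unlabel ` B \<subseteq> S" using that(2) by auto
      from rb[OF im[OF ub[OF that(1)] this]] show ?thesis by (simp add: image_image)
    qed
    show "(\<lambda>y. f (unlabel y)) \<in> borel_measurable borel" "(\<lambda>y. g (unlabel y)) \<in> borel_measurable borel"
      by (rule measurable_compose[OF relabel_measurable(2) f(1)] measurable_compose[OF relabel_measurable(2) g])+
    show "g (unlabel x) = \<bar>det (matrix (\<lambda>v. relabel (D (unlabel x) (unlabel v))))\<bar> * f (unlabel (?\<tau> x))" if "x \<in> ?S" for x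
      using gf[of "unlabel x"] that by (auto simp: det_matrix_relabel)
  qed (rule f(2))
  moreover have "(\<integral>\<^sup>+ y. ennreal (f (unlabel y)) * indicator (?\<tau> ` ?S) y \<partial>lborel) = (\<integral>\<^sup>+ y. ennreal (f y) * indicator (\<tau> ` S) y \<partial>lborel)"
    unfolding tS ind using f(1) im[OF S order_refl]
    by (subst nn_integral_unlabel[where h = "\<lambda>y. ennreal (f y) * indicator (\<tau> ` S) y", symmetric]) auto
  moreover have "(\<integral>\<^sup>+ x. ennreal (g (unlabel x)) * indicator ?S x \<partial>lborel) = (\<integral>\<^sup>+ x. ennreal (g x) * indicator S x \<partial>lborel)"
    unfolding ind using g S
    by (subst nn_integral_unlabel[where h = "\<lambda>y. ennreal (g y) * indicator S y", symmetric]) auto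
  ultimately show ?thesis by simp
qed


section \<open>The Riemannian volume\<close>

context riemannian
begin

abbreviation B where "B \<equiv> sets (borel_sigma T)"

lemma space_borel_sigma: "space (borel_sigma T) = points M"
  unfolding borel_sigma_def by (rule space_measure_of) (use openin_subset in blast)

lemma B_open: "openin T U \<Longrightarrow> U \<in> B"
  unfolding borel_sigma_def by (subst sets_measure_of) (use openin_subset in auto)

lemma B_closed: "closedin T C \<Longrightarrow> C \<in> B"
  using sets.compl_sets[OF B_open[of "points M - C"]] closedin_subset[of T C]
  by (auto simp: space_borel_sigma closedin_def double_diff)

lemma cinv_measurable:
  assumes c: "c \<in> atlas M"
  shows "cinv c \<in> measurable (restrict_space borel (snd c ` fst c)) (borel_sigma T)"
  unfolding borel_sigma_def
proof (rule measurable_measure_of)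
  show "{U. openin T U} \<subseteq> Pow (points M)" using openin_subset by blast
  show "cinv c \<in> space (restrict_space borel (snd c ` fst c)) \<rightarrow> points M"
    using cinv_snd[OF c] chart_points[OF c] by (auto simp: space_restrict_space)
  fix U assume "U \<in> {U. openin T U}"
  then have "openin T (U \<inter> fst c)" using openin_Int[OF _ chart_open[OF c]] by blast
  from open_snd_image[OF c this] have o: "open (snd c ` (U \<inter> fst c))" by simp
  have "cinv c -` U \<inter> space (restrict_space borel (snd c ` fst c)) = (snd c ` fst c) \<inter> (snd c ` (U \<inter> fst c))"
    using cinv_snd[OF c] by (auto simp: space_restrict_space intro: image_eqI)
  then show "cinv c -` U \<inter> space (restrict_space borel (snd c ` fst c)) \<in> sets (restrict_space borel (snd c ` fst c))"
    using o by (simp add: sets_restrict_space)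
qed

lemma snd_image_borel:
  assumes c: "c \<in> atlas M" and A: "A \<in> B" "A \<subseteq> fst c"
  shows "snd c ` A \<in> sets borel"
proof -
  have "cinv c -` A \<inter> space (restrict_space borel (snd c ` fst c)) = snd c ` A"
    using cinv_snd[OF c] A(2) by (force simp: space_restrict_space)
  then have "snd c ` A \<in> sets (restrict_space borel (snd c ` fst c))"
    using measurable_sets[OF cinv_measurable[OF c] A(1)] by simp
  moreover have "sets (restrict_space borel (snd c ` fst c)) \<subseteq> sets borel"
    using image_open[OF c] by (auto simp: sets_restrict_space)
  ultimately show ?thesis by blast
qed

lemma cinv_image_B:
  assumes c: "c \<in> atlas M" and V: "V \<in> sets borel" "V \<subseteq> snd c ` fst c"
  shows "cinv c ` V \<in> B"
proof -
  have m: "snd c \<in> measurable (restrict_space (borel_sigma T) (fst c)) borel"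
  proof (rule borel_measurableI)
    fix U :: "(real ^ 'n) set" assume U: "open U"
    have "openin (subtopology T (fst c)) {x \<in> topspace (subtopology T (fst c)). snd c x \<in> U}"
      by (rule openin_continuous_map_preimage[OF snd_continuous[OF c]]) (simp add: U)
    then have "openin T {x \<in> fst c. snd c x \<in> U}"
      unfolding topspace_chart[OF c] openin_open_subtopology[OF chart_open[OF c]] by (rule conjunct1)
    then have "{x \<in> fst c. snd c x \<in> U} \<in> B" by (rule B_open)
    moreover have "snd c -` U \<inter> space (restrict_space (borel_sigma T) (fst c)) = fst c \<inter> {x \<in> fst c. snd c x \<in> U}"
      using chart_points[OF c] by (auto simp: space_restrict_space space_borel_sigma)
    ultimately show "snd c -` U \<inter> space (restrict_space (borel_sigma T) (fst c)) \<in> sets (restrict_space (borel_sigma T) (fst c))"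
      by (simp add: sets_restrict_space)
  qed
  have "snd c -` V \<inter> space (restrict_space (borel_sigma T) (fst c)) = cinv c ` V"
    using in_cinv_image_iff[OF c V(2)] chart_points[OF c] by (auto simp: space_restrict_space space_borel_sigma)
  then have "cinv c ` V \<in> sets (restrict_space (borel_sigma T) (fst c))" using measurable_sets[OF m V(1)] by simp
  moreover have "sets (restrict_space (borel_sigma T) (fst c)) \<subseteq> B"
    using B_open[OF chart_open[OF c]] by (auto simp: sets_restrict_space)
  ultimately show ?thesis by blast
qed

text \<open>Cutting the density off outside the chart makes it Borel measurable on the whole space.\<close>

definition dens :: "('m, 'n) chart \<Rightarrow> real ^ 'n \<Rightarrow> real" where
  "dens c y = indicator (snd c ` fst c) y *\<^sub>R sqrt (det (gmat M c (cinv c y)))"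

lemma det_gmat_pos: "c \<in> atlas M \<Longrightarrow> x \<in> fst c \<Longrightarrow> det (gmat M c x) > 0"
  by (rule det_positive_definite) (rule gmat_pos)

lemma continuous_dens: "c \<in> atlas M \<Longrightarrow> continuous_on (snd c ` fst c) (\<lambda>y. sqrt (det (gmat M c (cinv c y))))"
  unfolding det_def
  by (intro continuous_intros continuous_on_component gmat_continuous)

lemma dens_measurable: "c \<in> atlas M \<Longrightarrow> dens c \<in> borel_measurable borel"
  unfolding dens_def[abs_def]
  by (rule borel_measurable_continuous_on_indicator[OF _ continuous_dens]) (use image_open in auto)

lemma dens_nonneg: "c \<in> atlas M \<Longrightarrow> 0 \<le> dens c y"
  using det_gmat_pos[of c "cinv c y"] cinv_in[of y c] by (simp add: dens_def indicator_def less_imp_le)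

definition cvol :: "('m, 'n) chart \<Rightarrow> (real ^ 'n) measure" where
  "cvol c = density lborel (\<lambda>y. ennreal (dens c y))"

lemma sets_cvol [simp]: "sets (cvol c) = sets borel"
  by (simp add: cvol_def)

lemma emeasure_cvol:
  "c \<in> atlas M \<Longrightarrow> V \<in> sets borel \<Longrightarrow> emeasure (cvol c) V = (\<integral>\<^sup>+ y. ennreal (dens c y) * indicator V y \<partial>lborel)"
  using dens_measurable by (simp add: cvol_def emeasure_density)

lemma emeasure_cvol_eq:
  assumes c: "c \<in> atlas M" and A: "A \<in> B" "A \<subseteq> fst c"
  shows "emeasure (cvol c) (snd c ` A) = (\<integral>\<^sup>+ y\<in>snd c ` A. ennreal (sqrt (det (gmat M c (cinv c y)))) \<partial>lborel)"
  unfolding emeasure_cvol[OF c snd_image_borel[OF assms]]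
proof (rule nn_integral_cong)
  fix y
  show "ennreal (dens c y) * indicator (snd c ` A) y = ennreal (sqrt (det (gmat M c (cinv c y)))) * indicator (snd c ` A) y"
    using A(2) by (auto simp: dens_def indicator_def)
qed

text \<open>The density transforms by the absolute value of the Jacobian determinant of the transition map,
  since \<open>det g\<close> transforms by its square.\<close>

lemma cvol_chart_indep:
  assumes c: "c \<in> atlas M" and c': "c' \<in> atlas M" and A: "A \<in> B" "A \<subseteq> fst c" "A \<subseteq> fst c'"
  shows "emeasure (cvol c) (snd c ` A) = emeasure (cvol c') (snd c' ` A)"
proof -
  let ?S = "snd c ` A" and ?\<tau> = "trans c c'"
  have S: "?S \<in> sets borel" by (rule snd_image_borel[OF c A(1,2)])
  have tS: "?\<tau> ` ?S = snd c' ` A" using cinv_snd[OF c] A(2) by (force simp: image_image)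
  let ?D = "\<lambda>y. dtrans c c' (cinv c y)"
  have mem: "cinv c y \<in> fst c" "cinv c y \<in> fst c'" "snd c (cinv c y) = y" "y \<in> snd c ` fst c" "cinv c y \<in> A" if "y \<in> ?S" for y
  proof -
    obtain a where a: "a \<in> A" "y = snd c a" using \<open>y \<in> ?S\<close> by blast
    then have "cinv c y = a" "a \<in> fst c" "a \<in> fst c'" using cinv_snd[OF c] A(2,3) by auto
    then show "cinv c y \<in> fst c" "cinv c y \<in> fst c'" "snd c (cinv c y) = y" "y \<in> snd c ` fst c" "cinv c y \<in> A"
      using a by auto
  qed
  have "(\<integral>\<^sup>+ y. ennreal (dens c' y) * indicator (?\<tau> ` ?S) y \<partial>lborel) = (\<integral>\<^sup>+ y. ennreal (dens c y) * indicator ?S y \<partial>lborel)"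
  proof (rule change_of_variables_nonneg[OF S, where D = ?D])
    show "(?\<tau> has_derivative ?D y) (at y within ?S)" if "y \<in> ?S" for y
      using trans_derivative[OF c c' mem(1,2)[OF that]] mem(3)[OF that] by (auto intro: has_derivative_at_withinI)
    show "inj_on ?\<tau> ?S"
    proof (rule inj_onI)
      fix y z assume yz: "y \<in> ?S" "z \<in> ?S" "?\<tau> y = ?\<tau> z"
      then have "cinv c y = cinv c z" using mem(2) inj_onD[OF chart_inj[OF c']] by simp
      then show "y = z" using mem(3) yz by metis
    qed
    show "?\<tau> ` V \<in> sets borel" if V: "V \<in> sets borel" "V \<subseteq> ?S" for V
    proof -
      have V': "V \<subseteq> snd c ` fst c" using V(2) A(2) by blast
      have "cinv c ` V \<subseteq> fst c'" using V(2) mem(2) by blast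
      from snd_image_borel[OF c' cinv_image_B[OF c V(1) V'] this] show ?thesis by (simp add: image_image o_def)
    qed
    show "dens c y = \<bar>det (matrix (?D y))\<bar> * dens c' (?\<tau> y)" if "y \<in> ?S" for y
    proof -
      let ?x = "cinv c y" and ?J = "jacobian c c' (cinv c y)"
      note m = mem[OF that]
      have J: "?J = matrix (?D y)" by (simp add: jacobian_def dtrans_def)
      have "det (gmat M c ?x) = (det ?J)\<^sup>2 * det (gmat M c' ?x)"
        by (simp add: gmat_trans[OF c c' m(1,2)] det_mul det_transpose power2_eq_square)
      moreover have "?\<tau> y \<in> snd c' ` fst c'" "cinv c' (?\<tau> y) = ?x" using m(2) cinv_snd[OF c'] by auto
      ultimately show ?thesis using m(4) by (simp add: dens_def J real_sqrt_mult)
    qed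
  qed (use dens_measurable[OF c] dens_measurable[OF c'] dens_nonneg[OF c'] in auto)
  then show ?thesis
    using emeasure_cvol[OF c S] emeasure_cvol[OF c' snd_image_borel[OF c' A(1,3)]] tS by simp
qed

text \<open>The description that singles out \<^const>\<open>rvol\<close>.\<close>

definition is_vol :: "'m measure \<Rightarrow> bool" where
  "is_vol \<mu> \<longleftrightarrow> space \<mu> = points M \<and> sets \<mu> = B \<and>
     (\<forall>c\<in>atlas M. \<forall>A\<in>sets \<mu>. A \<subseteq> fst c \<longrightarrow>
        emeasure \<mu> A = (\<integral>\<^sup>+ y\<in>snd c ` A. ennreal (sqrt (det (gmat M c (cinv c y)))) \<partial>lborel))"

lemma is_vol_iff:
  "is_vol \<mu> \<longleftrightarrow> space \<mu> = points M \<and> sets \<mu> = B \<and>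
     (\<forall>c\<in>atlas M. \<forall>A\<in>B. A \<subseteq> fst c \<longrightarrow> emeasure \<mu> A = emeasure (cvol c) (snd c ` A))"
  unfolding is_vol_def using emeasure_cvol_eq by auto

text \<open>A second countable space is Lindelof, so countably many charts cover it. On a partition into pieces
  that lie in one chart each, the volume must be the sum of the chart volumes of the pieces: this
  proves uniqueness and is the construction for existence.\<close>

lemma chart_partition:
  assumes "points M \<noteq> {}"
  shows "\<exists>(C :: nat \<Rightarrow> ('m, 'n) chart) D. (\<forall>i. C i \<in> atlas M \<and> D i \<subseteq> fst (C i) \<and> D i \<in> B) \<and>
    disjoint_family D \<and> (\<Union>i. D i) = points M"
proof -
  have "Lindelof_space T" using second_countable by (rule second_countable_imp_Lindelof_space)
  moreover have "openin T U" if "U \<in> fst ` atlas M" for U using that chart_open by blast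
  ultimately have "\<exists>\<V>. countable \<V> \<and> \<V> \<subseteq> fst ` atlas M \<and> \<Union>\<V> = points M"
    by (rule Lindelof_spaceD) (assumption, rule atlas_cover)
  then obtain \<V> where "countable \<V> \<and> \<V> \<subseteq> fst ` atlas M \<and> \<Union>\<V> = points M" ..
  then have V: "countable \<V>" "\<V> \<subseteq> fst ` atlas M" "\<Union>\<V> = points M" by blast+
  have ne: "\<V> \<noteq> {}" using assms V(3) by (metis Union_empty)
  define U where "U = from_nat_into \<V>"
  have U: "range U = \<V>" unfolding U_def by (rule range_from_nat_into[OF ne V(1)])
  have "\<exists>c. c \<in> atlas M \<and> fst c = U i" for i
  proof -
    have "U i \<in> fst ` atlas M" using V(2) U by (metis rangeI subsetD)
    then show ?thesis by auto
  qed
  then obtain C where C: "\<And>i. C i \<in> atlas M" "\<And>i. fst (C i) = U i" by metis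
  have "U i \<in> B" for i using B_open[OF chart_open[OF C(1)]] C(2) by simp
  then have "disjointed U i \<in> B" for i using sets.range_disjointed_sets[of U "borel_sigma T"] by blast
  moreover have "disjointed U i \<subseteq> fst (C i)" for i using disjointed_subset[of U i] C(2) by simp
  moreover have "(\<Union>i. disjointed U i) = points M" unfolding UN_disjointed_eq using U V(3) by auto
  ultimately show ?thesis
    by (intro exI[of _ C] exI[of _ "disjointed U"] conjI allI C(1) disjoint_family_disjointed)
qed

lemma is_vol_unique:
  assumes ne: "points M \<noteq> {}" and "is_vol \<mu>" "is_vol \<nu>"
  shows "\<mu> = \<nu>"
proof -
  obtain C :: "nat \<Rightarrow> ('m, 'n) chart" and D where "\<forall>i. C i \<in> atlas M \<and> D i \<subseteq> fst (C i) \<and> D i \<in> B"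
    "disjoint_family D \<and> (\<Union>i. D i) = points M" using chart_partition[OF ne] by (elim exE conjE) simp
  then have CD: "\<And>i. C i \<in> atlas M" "\<And>i. D i \<subseteq> fst (C i)" "\<And>i. D i \<in> B"
    "disjoint_family D" "(\<Union>i. D i) = points M" by simp_all
  have eq: "emeasure \<mu> A = (\<Sum>i. emeasure (cvol (C i)) (snd (C i) ` (A \<inter> D i)))" if \<mu>: "is_vol \<mu>" and A: "A \<in> B" for \<mu> A
  proof -
    have s: "sets \<mu> = B" using \<mu> by (simp add: is_vol_iff)
    have AD: "A \<inter> D i \<in> B" for i using A CD(3) by blast
    have "(\<Sum>i. emeasure \<mu> (A \<inter> D i)) = emeasure \<mu> (\<Union>i. A \<inter> D i)"
    proof (rule suminf_emeasure)
      show "disjoint_family (\<lambda>i. A \<inter> D i)" using CD(4) unfolding disjoint_family_on_def by blast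
    qed (use AD s in auto)
    also have "(\<Union>i. A \<inter> D i) = A" using CD(5) sets.sets_into_space[OF A] space_borel_sigma by auto
    finally have "emeasure \<mu> A = (\<Sum>i. emeasure \<mu> (A \<inter> D i))" by simp
    moreover have "emeasure \<mu> (A \<inter> D i) = emeasure (cvol (C i)) (snd (C i) ` (A \<inter> D i))" for i
      using \<mu> AD[of i] CD(1)[of i] CD(2)[of i] unfolding is_vol_iff by blast
    ultimately show ?thesis by simp
  qed
  show ?thesis
  proof (rule measure_eqI)
    show "sets \<mu> = sets \<nu>" using assms by (simp add: is_vol_iff)
    show "emeasure \<mu> A = emeasure \<nu> A" if "A \<in> sets \<mu>" for A
      using eq[OF assms(2)] eq[OF assms(3)] that assms(2) by (simp add: is_vol_iff)
  qed
qed

lemma ex_is_vol: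
  assumes ne: "points M \<noteq> {}"
  shows "\<exists>\<mu>. is_vol \<mu>"
proof -
  obtain C :: "nat \<Rightarrow> ('m, 'n) chart" and D where "\<forall>i. C i \<in> atlas M \<and> D i \<subseteq> fst (C i) \<and> D i \<in> B"
    "disjoint_family D \<and> (\<Union>i. D i) = points M" using chart_partition[OF ne] by (elim exE conjE) simp
  then have CD: "\<And>i. C i \<in> atlas M" "\<And>i. D i \<subseteq> fst (C i)" "\<And>i. D i \<in> B"
    "disjoint_family D" "(\<Union>i. D i) = points M" by simp_all
  let ?m = "\<lambda>i A. emeasure (cvol (C i)) (snd (C i) ` (A \<inter> D i))"
  define \<mu> where "\<mu> = measure_of (points M) B (\<lambda>A. \<integral>\<^sup>+ i. ?m i A \<partial>count_space UNIV)"
  have B_sub: "B \<subseteq> Pow (points M)" using sets.sets_into_space space_borel_sigma by blast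
  have "sigma_algebra (points M) B" using sets.sigma_algebra_axioms[of "borel_sigma T"] by (simp add: space_borel_sigma)
  then have sets_\<mu>: "sets \<mu> = B" unfolding \<mu>_def by (simp add: B_sub sigma_algebra.sigma_sets_eq)
  have space_\<mu>: "space \<mu> = points M" unfolding \<mu>_def by (rule space_measure_of[OF B_sub])
  have img: "snd (C i) ` (A \<inter> D i) \<in> sets borel" if "A \<in> B" for A i
    by (rule snd_image_borel[OF CD(1)]) (use that CD(2,3) in blast)+
  have em: "emeasure \<mu> A = (\<integral>\<^sup>+ i. ?m i A \<partial>count_space UNIV)" if "A \<in> B" for A
  proof (rule emeasure_measure_of[OF \<mu>_def B_sub])
    show "positive (sets \<mu>) (\<lambda>A. \<integral>\<^sup>+ i. ?m i A \<partial>count_space UNIV)" by (simp add: positive_def)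
    show "countably_additive (sets \<mu>) (\<lambda>A. \<integral>\<^sup>+ i. ?m i A \<partial>count_space UNIV)"
    proof (rule countably_additiveI)
      fix A :: "nat \<Rightarrow> 'm set" assume A: "range A \<subseteq> sets \<mu>" "disjoint_family A"
      have sA: "A k \<in> B" for k using A(1) sets_\<mu> by auto
      have one: "(\<Sum>k. ?m i (A k)) = ?m i (\<Union>k. A k)" for i
      proof -
        have "disjoint_family (\<lambda>k. snd (C i) ` (A k \<inter> D i))"
          unfolding disjoint_family_on_def
        proof (intro ballI impI)
          fix j k :: nat assume "j \<noteq> k"
          then have "A j \<inter> A k = {}" using A(2) by (auto simp: disjoint_family_on_def)
          moreover have "inj_on (snd (C i)) (D i)" using chart_inj[OF CD(1)] CD(2) inj_on_subset by blast
          ultimately show "snd (C i) ` (A j \<inter> D i) \<inter> snd (C i) ` (A k \<inter> D i) = {}"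
            using inj_on_image_Int[of "snd (C i)" "D i" "A j \<inter> D i" "A k \<inter> D i"] by blast
        qed
        then have "(\<Sum>k. ?m i (A k)) = emeasure (cvol (C i)) (\<Union>k. snd (C i) ` (A k \<inter> D i))"
          by (intro suminf_emeasure) (use img sA in auto)
        also have "(\<Union>k. snd (C i) ` (A k \<inter> D i)) = snd (C i) ` ((\<Union>k. A k) \<inter> D i)" by blast
        finally show ?thesis .
      qed
      have "(\<Sum>k. \<integral>\<^sup>+ i. ?m i (A k) \<partial>count_space UNIV) = (\<integral>\<^sup>+ i. (\<Sum>k. ?m i (A k)) \<partial>count_space UNIV)"
        by (rule nn_integral_suminf[symmetric]) simp
      then show "(\<Sum>k. \<integral>\<^sup>+ i. ?m i (A k) \<partial>count_space UNIV) = (\<integral>\<^sup>+ i. ?m i (\<Union>k. A k) \<partial>count_space UNIV)"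
        by (simp only: one)
    qed
    show "A \<in> sets \<mu>" using that sets_\<mu> by simp
  qed
  have "emeasure \<mu> A = emeasure (cvol c) (snd c ` A)" if c: "c \<in> atlas M" and A: "A \<in> B" "A \<subseteq> fst c" for c A
  proof -
    have AD: "A \<inter> D i \<in> B" for i using A CD(3) by blast
    have sub: "A \<inter> D i \<subseteq> fst c" "A \<inter> D i \<subseteq> fst (C i)" for i using A(2) CD(2) by blast+
    have "emeasure \<mu> A = (\<Sum>i. ?m i A)" by (simp add: em[OF A(1)] nn_integral_count_space_nat)
    also have "\<dots> = (\<Sum>i. emeasure (cvol c) (snd c ` (A \<inter> D i)))"
      using cvol_chart_indep[OF CD(1) c AD sub(2,1)] by simp
    also have "\<dots> = emeasure (cvol c) (\<Union>i. snd c ` (A \<inter> D i))"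
    proof (rule suminf_emeasure)
      show "range (\<lambda>i. snd c ` (A \<inter> D i)) \<subseteq> sets (cvol c)" using snd_image_borel[OF c AD sub(1)] by auto
      show "disjoint_family (\<lambda>i. snd c ` (A \<inter> D i))"
        unfolding disjoint_family_on_def
      proof (intro ballI impI)
        fix j k :: nat assume "j \<noteq> k"
        then have "D j \<inter> D k = {}" using CD(4) by (auto simp: disjoint_family_on_def)
        then have "(A \<inter> D j) \<inter> (A \<inter> D k) = {}" by blast
        then show "snd c ` (A \<inter> D j) \<inter> snd c ` (A \<inter> D k) = {}"
          using inj_on_image_Int[OF chart_inj[OF c] sub(1)[of j] sub(1)[of k]] by simp
      qed
    qed
    also have "(\<Union>i. snd c ` (A \<inter> D i)) = snd c ` (A \<inter> (\<Union>i. D i))" by blast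
    also have "A \<inter> (\<Union>i. D i) = A" using CD(5) A(2) chart_points[OF c] by auto
    finally show ?thesis .
  qed
  then have "is_vol \<mu>"
    unfolding is_vol_iff by (intro conjI ballI impI sets_\<mu> space_\<mu>)
  then show ?thesis ..
qed

lemma rvol_is_vol: "points M \<noteq> {} \<Longrightarrow> is_vol (rvol M)"
proof -
  assume ne: "points M \<noteq> {}"
  have "rvol M = (THE \<mu>. is_vol \<mu>)" by (simp add: rvol_def is_vol_def)
  then show ?thesis using theI'[of is_vol] ex_is_vol[OF ne] is_vol_unique[OF ne] by metis
qed

lemma rvol_space:
  assumes "points M \<noteq> {}"
  shows "space (rvol M) = points M" "sets (rvol M) = B"
    "\<And>c A. c \<in> atlas M \<Longrightarrow> A \<in> B \<Longrightarrow> A \<subseteq> fst c \<Longrightarrow> emeasure (rvol M) A = emeasure (cvol c) (snd c ` A)"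
  using rvol_is_vol[OF assms] by (auto simp: is_vol_iff)

lemma good_volume_bounds:
  assumes g: "good c x \<rho> k K"
  shows "emeasure (rvol M) (cinv c ` ball (snd c x) (\<rho> / 2)) < \<infinity>"
    "\<exists>b>0. \<forall>s\<le>\<rho> / 2. ennreal b * emeasure lborel (ball (snd c x) s) \<le> emeasure (rvol M) (cinv c ` ball (snd c x) s)"
proof -
  note c = goodD(1)[OF g]
  have ne: "points M \<noteq> {}" using goodD(8)[OF g] by blast
  let ?K = "cball (snd c x) (\<rho> / 2)" and ?f = "\<lambda>y. sqrt (det (gmat M c (cinv c y)))"
  have Ki: "?K \<subseteq> snd c ` fst c" using goodD(3,6)[OF g] by (force simp: subset_iff)
  have cf: "continuous_on ?K ?f" by (rule continuous_on_subset[OF continuous_dens[OF c] Ki])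
  have Kne: "?K \<noteq> {}" using goodD(3)[OF g] by simp
  have d: "dens c y = ?f y" if "y \<in> ?K" for y using that Ki by (auto simp: dens_def)
  obtain y1 where y1: "y1 \<in> ?K" "\<And>y. y \<in> ?K \<Longrightarrow> ?f y1 \<le> ?f y"
    using continuous_attains_inf[OF compact_cball Kne cf] by blast
  obtain y2 where y2: "y2 \<in> ?K" "\<And>y. y \<in> ?K \<Longrightarrow> ?f y \<le> ?f y2"
    using continuous_attains_sup[OF compact_cball Kne cf] by blast
  have pos: "?f y1 > 0" using det_gmat_pos[OF c cinv_in[of y1 c]] y1(1) Ki by auto
  have im: "cinv c ` ball (snd c x) s \<in> B" "cinv c ` ball (snd c x) s \<subseteq> fst c" "snd c ` (cinv c ` ball (snd c x) s) = ball (snd c x) s"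
    "ball (snd c x) s \<subseteq> ?K" if "s \<le> \<rho> / 2" for s
  proof -
    show bK: "ball (snd c x) s \<subseteq> ?K" using that by auto
    show "cinv c ` ball (snd c x) s \<in> B" using B_open[OF good_open[OF g]] that goodD(3)[OF g] by simp
    have bi: "ball (snd c x) s \<subseteq> snd c ` fst c" using bK Ki by (rule order_trans)
    show "cinv c ` ball (snd c x) s \<subseteq> fst c"
      by (rule image_subsetI, rule cinv_in, rule subsetD[OF bi])
    show "snd c ` (cinv c ` ball (snd c x) s) = ball (snd c x) s" by (rule snd_image_cinv[OF bi])
  qed
  have vol: "emeasure (rvol M) (cinv c ` ball (snd c x) s) = (\<integral>\<^sup>+ y. ennreal (dens c y) * indicator (ball (snd c x) s) y \<partial>lborel)" if "s \<le> \<rho> / 2" for s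
    using rvol_space(3)[OF ne c im(1,2)[OF that]] emeasure_cvol[OF c, of "ball (snd c x) s"] im(3)[OF that] by simp
  show "emeasure (rvol M) (cinv c ` ball (snd c x) (\<rho> / 2)) < \<infinity>"
  proof -
    have "(\<integral>\<^sup>+ y. ennreal (dens c y) * indicator (ball (snd c x) (\<rho> / 2)) y \<partial>lborel)
        \<le> (\<integral>\<^sup>+ y. ennreal (?f y2) * indicator (ball (snd c x) (\<rho> / 2)) y \<partial>lborel)"
    proof (rule nn_integral_mono)
      fix y
      show "ennreal (dens c y) * indicator (ball (snd c x) (\<rho> / 2)) y \<le> ennreal (?f y2) * indicator (ball (snd c x) (\<rho> / 2)) y"
      proof (cases "y \<in> ball (snd c x) (\<rho> / 2)")
        case True
        then have "y \<in> ?K" by simp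
        then have "dens c y \<le> ?f y2" using d y2(2) by metis
        then show ?thesis using True by (simp add: ennreal_leI del: mem_ball)
      qed simp
    qed
    also have "\<dots> = ennreal (?f y2) * emeasure lborel (ball (snd c x) (\<rho> / 2))" by (simp add: nn_integral_cmult_indicator)
    also have "\<dots> < \<infinity>" using emeasure_lborel_ball_finite[of "snd c x" "\<rho> / 2"] by (simp add: ennreal_mult_less_top)
    finally show ?thesis using vol[OF order_refl] by simp
  qed
  have "ennreal (?f y1) * emeasure lborel (ball (snd c x) s) \<le> emeasure (rvol M) (cinv c ` ball (snd c x) s)" if "s \<le> \<rho> / 2" for s
  proof -
    have "ennreal (?f y1) * emeasure lborel (ball (snd c x) s) = (\<integral>\<^sup>+ y. ennreal (?f y1) * indicator (ball (snd c x) s) y \<partial>lborel)"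
      by (simp add: nn_integral_cmult_indicator)
    also have "\<dots> \<le> (\<integral>\<^sup>+ y. ennreal (dens c y) * indicator (ball (snd c x) s) y \<partial>lborel)"
    proof (rule nn_integral_mono)
      fix y
      show "ennreal (?f y1) * indicator (ball (snd c x) s) y \<le> ennreal (dens c y) * indicator (ball (snd c x) s) y"
      proof (cases "y \<in> ball (snd c x) s")
        case True
        then have "y \<in> ?K" using im(4)[OF that] by blast
        then have "?f y1 \<le> dens c y" using d y1(2) by metis
        then show ?thesis using True by (simp add: ennreal_leI del: mem_ball)
      qed simp
    qed
    finally show ?thesis using vol[OF that] by simp
  qed
  then show "\<exists>b>0. \<forall>s\<le>\<rho> / 2. ennreal b * emeasure lborel (ball (snd c x) s) \<le> emeasure (rvol M) (cinv c ` ball (snd c x) s)"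
    using pos by (intro exI[of _ "?f y1"]) simp
qed

lemma compact_finite_volume:
  assumes K: "compactin T K" and ne: "points M \<noteq> {}"
  shows "emeasure (rvol M) K < \<infinity>"
proof -
  let ?\<U> = "{U. openin T U \<and> emeasure (rvol M) U < \<infinity>}"
  have "K \<subseteq> \<Union>?\<U>"
  proof
    fix x assume "x \<in> K"
    then have "x \<in> points M" using compactin_subset_topspace[OF K] by blast
    from ex_good[OF this] obtain c \<rho> k L where g: "good c x \<rho> k L" by blast
    have "cinv c ` ball (snd c x) (\<rho> / 2) \<in> ?\<U>"
      using good_volume_bounds(1)[OF g] good_open[OF g, of "\<rho> / 2"] goodD(3)[OF g] by simp
    then show "x \<in> \<Union>?\<U>" using good_mem[OF g, of "\<rho> / 2"] goodD(3)[OF g] by auto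
  qed
  then obtain \<F> where F: "finite \<F>" "\<F> \<subseteq> ?\<U>" "K \<subseteq> \<Union>\<F>" using compactinD[OF K, of ?\<U>] by blast
  have sF: "\<F> \<subseteq> sets (rvol M)" using F(2) B_open rvol_space(2)[OF ne] by auto
  have "emeasure (rvol M) K \<le> emeasure (rvol M) (\<Union>\<F>)"
    by (rule emeasure_mono[OF F(3)]) (use sF F(1) in auto)
  also have "\<dots> \<le> (\<Sum>U\<in>\<F>. emeasure (rvol M) U)"
    using emeasure_subadditive_finite[OF F(1), of "\<lambda>U. U" "rvol M"] sF by simp
  also have "\<dots> < \<infinity>" using F(1,2) by (auto simp: sum_Pinfty less_top intro!: ennreal_sum_less_top)
  finally show ?thesis .
qed

text \<open>Small balls contain coordinate balls of proportional radius.\<close>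

lemma small_ball_volume:
  assumes x: "x \<in> points M"
  obtains b r0 where "b > 0" "r0 > 0"
    "\<And>r. 0 < r \<Longrightarrow> r \<le> r0 \<Longrightarrow> ennreal (b * r ^ CARD('n)) \<le> emeasure (rvol M) (D.mball x r)"
proof -
  have ne: "points M \<noteq> {}" using x by blast
  obtain c \<rho> k K where g: "good c x \<rho> k K" using ex_good[OF x] by blast
  obtain b where b: "b > 0"
    "\<forall>s\<le>\<rho> / 2. ennreal b * emeasure lborel (ball (snd c x) s) \<le> emeasure (rvol M) (cinv c ` ball (snd c x) s)"
    using good_volume_bounds(2)[OF g] by blast
  define \<omega> where "\<omega> = unit_ball_vol (real CARD('n))"
  have \<omega>: "\<omega> > 0" by (simp add: \<omega>_def)
  have K: "K > 0" "\<rho> > 0" using goodD[OF g] by auto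
  show ?thesis
  proof (rule that[of "b * \<omega> / K ^ CARD('n)" "K * \<rho> / 2"])
    show "b * \<omega> / K ^ CARD('n) > 0" "K * \<rho> / 2 > 0" using b(1) \<omega> K by auto
    fix r :: real assume r: "0 < r" "r \<le> K * \<rho> / 2"
    define s where "s = r / K"
    have s: "0 < s" "s \<le> \<rho> / 2" using r K by (auto simp: s_def field_simps)
    have "cinv c ` ball (snd c x) s \<subseteq> D.mball x r"
    proof safe
      fix w assume w: "w \<in> ball (snd c x) s"
      then have w': "w \<in> ball (snd c x) \<rho>" using s(2) K by auto
      have "rdist M x (cinv c w) \<le> K * norm (w - snd c x)"
        using good_rdist_le(2)[OF g _ w', of "snd c x"] K goodD(7)[OF g] by simp
      also have "\<dots> < K * s" using w K by (simp add: dist_norm norm_minus_commute)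
      also have "\<dots> = r" using K by (simp add: s_def)
      finally show "cinv c w \<in> D.mball x r"
        using x chart_points[OF goodD(1)[OF g] cinv_in] goodD(6)[OF g] w' by auto
    qed
    then have "emeasure (rvol M) (cinv c ` ball (snd c x) s) \<le> emeasure (rvol M) (D.mball x r)"
      by (rule emeasure_mono) (use D.openin_mball[of x r] B_open mtopology_eq rvol_space(2)[OF ne] in simp)
    moreover have "ennreal (b * \<omega> / K ^ CARD('n) * r ^ CARD('n)) = ennreal b * emeasure lborel (ball (snd c x) s)"
      using s(1) b(1) \<omega> K by (simp add: emeasure_ball \<omega>_def s_def power_divide ennreal_mult'[symmetric] mult.assoc)
    ultimately show "ennreal (b * \<omega> / K ^ CARD('n) * r ^ CARD('n)) \<le> emeasure (rvol M) (D.mball x r)"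
      using order_trans[OF b(2)[rule_format, OF s(2)]] by simp
  qed
qed

end


section \<open>Smooth functions that approximate a Lipschitz function\<close>

lemma smooth_derivative_bound:
  fixes \<phi> :: "'a::euclidean_space \<Rightarrow> real"
  assumes "smooth_on UNIV \<phi>" "compact C"
  obtains b where "b \<ge> 0" "\<And>y v. y \<in> C \<Longrightarrow> \<bar>frechet_derivative \<phi> (at y) v\<bar> \<le> b * norm v"
proof -
  let ?D = "\<lambda>y. frechet_derivative \<phi> (at y)"
  have "\<exists>b\<ge>0. \<forall>y\<in>C. \<bar>?D y i\<bar> \<le> b" for i
  proof -
    have "continuous_on C (\<lambda>y. ?D y i)"
      by (rule continuous_on_subset[OF smooth_on_imp_continuous_on[OF smooth_on_derivative[OF assms(1)]]]) simp
    then have "bounded ((\<lambda>y. ?D y i) ` C)" using assms(2) by (intro compact_imp_bounded compact_continuous_image)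
    then obtain b where "\<forall>x\<in>(\<lambda>y. ?D y i) ` C. norm x \<le> b" unfolding bounded_iff by blast
    then show ?thesis by (intro exI[of _ "max b 0"]) (auto simp: le_max_iff_disj)
  qed
  then obtain b where b: "\<And>i. b i \<ge> 0" "\<And>i y. y \<in> C \<Longrightarrow> \<bar>?D y i\<bar> \<le> b i" by metis
  show ?thesis
  proof (rule that[of "\<Sum>i\<in>Basis. b i"])
    show "(\<Sum>i\<in>Basis. b i) \<ge> 0" by (intro sum_nonneg b(1))
    fix y v assume y: "y \<in> C"
    have lin: "linear (?D y)" using smooth_on_has_derivative[OF assms(1)] has_derivative_linear by blast
    have "?D y v = ?D y (\<Sum>i\<in>Basis. (v \<bullet> i) *\<^sub>R i)" by (simp add: euclidean_representation)
    also have "\<dots> = (\<Sum>i\<in>Basis. (v \<bullet> i) * ?D y i)" by (simp add: linear_sum[OF lin] linear_scale[OF lin])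
    finally have "\<bar>?D y v\<bar> \<le> (\<Sum>i\<in>Basis. \<bar>v \<bullet> i\<bar> * \<bar>?D y i\<bar>)"
      using sum_abs[of "\<lambda>i. (v \<bullet> i) * ?D y i" Basis] by (simp add: abs_mult)
    also have "\<dots> \<le> (\<Sum>i\<in>Basis. norm v * b i)"
      by (intro sum_mono mult_mono Basis_le_norm b(2)[OF y]) auto
    finally show "\<bar>?D y v\<bar> \<le> (\<Sum>i\<in>Basis. b i) * norm v" by (simp add: sum_distrib_left mult.commute)
  qed
qed

context riemannian
begin

definition msmooth :: "('m \<Rightarrow> real) \<Rightarrow> bool" where
  "msmooth f \<longleftrightarrow> (\<forall>c\<in>atlas M. smooth_on (snd c ` fst c) (f \<circ> cinv c))"

definition dd :: "('m, 'n) chart \<Rightarrow> ('m \<Rightarrow> real) \<Rightarrow> 'm \<Rightarrow> real ^ 'n \<Rightarrow> real" where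
  "dd c f z = frechet_derivative (f \<circ> cinv c) (at (snd c z))"

lemma dd_derivative:
  "msmooth f \<Longrightarrow> c \<in> atlas M \<Longrightarrow> z \<in> fst c \<Longrightarrow> ((f \<circ> cinv c) has_derivative dd c f z) (at (snd c z))"
  unfolding dd_def msmooth_def using smooth_on_has_derivative[of "snd c ` fst c" "f \<circ> cinv c" "snd c z"] by simp

lemma dd_zero:
  assumes c: "c \<in> atlas M" "z \<in> fst c" and U: "openin T U" "z \<in> U" "\<And>x. x \<in> U \<Longrightarrow> f x = 0"
  shows "dd c f z = (\<lambda>v. 0)"
proof -
  have "openin T (fst c \<inter> U)" using chart_open[OF c(1)] U(1) by (rule openin_Int)
  from open_snd_image[OF c(1) this] have o: "open (snd c ` (fst c \<inter> U))" by simp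
  have "frechet_derivative (f \<circ> cinv c) (at (snd c z)) = frechet_derivative (\<lambda>_. 0) (at (snd c z))"
    by (rule frechet_derivative_cong_open[OF o]) (use c U cinv_snd[OF c(1)] in auto)
  then show ?thesis by (simp add: dd_def frechet_derivative_const)
qed

text \<open>A function that is given in one chart and vanishes there outside a closed set \<open>C\<close> continues by \<open>0\<close>
  to the whole manifold, and its differential in any other chart comes from the transition map.
  Closedness of \<open>C\<close> in the manifold, not just in the chart, is essential.\<close>

lemma glue:
  assumes c: "c \<in> atlas M" and U: "openin T U" "U \<subseteq> fst c" and C: "closedin T C" "C \<subseteq> U"
    and \<phi>: "smooth_on UNIV \<phi>" "\<forall>z\<in>U - C. \<phi> (snd c z) = 0"
    and f: "f = (\<lambda>z. if z \<in> U then \<phi> (snd c z) else 0)"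
  shows "msmooth f"
    "\<And>c' z v. c' \<in> atlas M \<Longrightarrow> z \<in> fst c' \<Longrightarrow> z \<notin> C \<Longrightarrow> dd c' f z v = 0"
    "\<And>c' z v. c' \<in> atlas M \<Longrightarrow> z \<in> fst c' \<Longrightarrow> z \<in> U \<Longrightarrow>
       dd c' f z v = frechet_derivative \<phi> (at (snd c z)) (dtrans c' c z v)"
proof -
  have oC: "openin T (points M - C)" using C(1) by (simp add: closedin_def)
  have f0: "f z = 0" if "z \<in> points M - C" for z using \<phi>(2) that by (auto simp: f)
  have on_U: "open (snd c' ` (fst c' \<inter> U))" "smooth_on (snd c' ` (fst c' \<inter> U)) (\<lambda>y. \<phi> (trans c' c y))"
    "\<And>y. y \<in> snd c' ` (fst c' \<inter> U) \<Longrightarrow> \<phi> (trans c' c y) = (f \<circ> cinv c') y" if c': "c' \<in> atlas M" for c'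
  proof -
    show o: "open (snd c' ` (fst c' \<inter> U))"
      using open_snd_image[OF c' openin_Int[OF chart_open[OF c'] U(1)]] by simp
    have "smooth_on (snd c' ` (fst c' \<inter> U)) (trans c' c)"
      by (rule smooth_on_subset[OF trans_smooth[OF c' c]]) (use U(2) in blast)
    from smooth_on_compose[OF o open_UNIV _ \<phi>(1) this]
    show "smooth_on (snd c' ` (fst c' \<inter> U)) (\<lambda>y. \<phi> (trans c' c y))" by simp
    show "\<phi> (trans c' c y) = (f \<circ> cinv c') y" if "y \<in> snd c' ` (fst c' \<inter> U)" for y
      using that cinv_snd[OF c'] by (auto simp: f)
  qed
  show "msmooth f"
    unfolding msmooth_def
  proof (intro ballI smooth_on_locally)
    fix c' y assume c': "c' \<in> atlas M" and y: "y \<in> snd c' ` fst c'"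
    then obtain z where z: "z \<in> fst c'" "y = snd c' z" by blast
    show "\<exists>V. y \<in> V \<and> open V \<and> smooth_on V (f \<circ> cinv c')"
    proof (cases "z \<in> U")
      case True
      have sm: "smooth_on (snd c' ` (fst c' \<inter> U)) (f \<circ> cinv c')"
        by (rule smooth_on_cong[OF on_U(1)[OF c'] on_U(2)[OF c'] on_U(3)[OF c']])
      have yU: "y \<in> snd c' ` (fst c' \<inter> U)" unfolding z(2) by (intro imageI IntI z(1) True)
      show ?thesis by (rule exI[of _ "snd c' ` (fst c' \<inter> U)"], intro conjI yU on_U(1)[OF c'] sm)
    next
      case False
      let ?V = "snd c' ` (fst c' \<inter> (points M - C))"
      have o: "open ?V" using open_snd_image[OF c' openin_Int[OF chart_open[OF c'] oC]] by simp
      have sm: "smooth_on ?V (f \<circ> cinv c')"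
        by (rule smooth_on_cong[OF o smooth_on_const[of _ 0]]) (use f0 cinv_snd[OF c'] in auto)
      have "z \<in> points M - C" using False C(2) chart_points[OF c' z(1)] by blast
      then have yV: "y \<in> ?V" unfolding z(2) by (intro imageI IntI z(1))
      show ?thesis by (rule exI[of _ ?V], intro conjI yV o sm)
    qed
  qed
  fix c' z v assume c': "c' \<in> atlas M" "z \<in> fst c'"
  show "dd c' f z v = 0" if "z \<notin> C"
    using dd_zero[OF c' oC _ f0] that chart_points[OF c'] by simp
  show "dd c' f z v = frechet_derivative \<phi> (at (snd c z)) (dtrans c' c z v)" if z: "z \<in> U"
  proof -
    have zc: "z \<in> fst c" using z U(2) by blast
    have "dd c' f z = frechet_derivative (\<lambda>y. \<phi> (trans c' c y)) (at (snd c' z))"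
      unfolding dd_def
      by (rule frechet_derivative_cong_open[OF on_U(1)[OF c'(1)] _ on_U(3)[OF c'(1), symmetric]]) (use c' z in auto)
    moreover have "(\<phi> has_derivative frechet_derivative \<phi> (at (snd c z))) (at (trans c' c (snd c' z)))"
      using smooth_on_has_derivative[OF \<phi>(1) UNIV_I, of "snd c z"] by (simp add: cinv_snd[OF c'])
    from has_derivative_compose[OF trans_derivative[OF c'(1) c c'(2) zc] this]
    have "frechet_derivative (\<lambda>y. \<phi> (trans c' c y)) (at (snd c' z)) = (\<lambda>v. frechet_derivative \<phi> (at (snd c z)) (dtrans c' c z v))"
      by (rule frechet_derivative_at[symmetric])
    ultimately show ?thesis by simp
  qed
qed

text \<open>The data near one point: a bump \<open>\<beta>\<close> that does not depend on the accuracy \<open>e\<close>, and a product \<open>w\<close> of \<open>\<beta>\<close>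
  with a mollification of \<open>D\<close>. The number \<open>t\<close> is the value of that mollification at \<open>z\<close>; stated through
  \<open>t\<close>, the estimates make sense also where only \<open>w\<close> is defined.\<close>

definition patch :: "('m \<Rightarrow> real) \<Rightarrow> 'm set \<Rightarrow> ('m \<Rightarrow> real) \<Rightarrow> real \<Rightarrow> real \<Rightarrow> bool" where
  "patch D P \<beta> b m \<longleftrightarrow> openin T P \<and> 0 < m \<and> 0 \<le> b \<and> msmooth \<beta> \<and> (\<forall>z\<in>points M. 0 \<le> \<beta> z) \<and> (\<forall>z\<in>P. m \<le> \<beta> z) \<and>
    (\<forall>c\<in>atlas M. \<forall>z\<in>fst c. \<forall>v. \<bar>dd c \<beta> z v\<bar> \<le> b * gnorm M c z v) \<and>
    (\<forall>e>0. \<exists>w. msmooth w \<and> (\<forall>z\<in>points M. \<exists>t. \<bar>t - D z\<bar> \<le> e \<and> w z = \<beta> z * t \<and>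
       (\<forall>c\<in>atlas M. z \<in> fst c \<longrightarrow> (\<forall>v. \<bar>dd c w z v - t * dd c \<beta> z v\<bar> \<le> \<beta> z * (4 * gnorm M c z v)))))"

text \<open>In good coordinates \<open>D\<close> is Lipschitz with constant \<open>2\<close> for the metric at the centre, and so is its
  mollification. Returning to the metric at the point in question costs another factor \<open>2\<close>, whence the
  \<open>4\<close> in the definition of \<open>patch\<close>.\<close>

lemma ex_patch:
  assumes x: "x \<in> points M" and D: "\<And>y z. y \<in> points M \<Longrightarrow> z \<in> points M \<Longrightarrow> \<bar>D y - D z\<bar> \<le> rdist M y z"
  shows "\<exists>P \<beta> b m. x \<in> P \<and> patch D P \<beta> b m"
proof -
  obtain c \<rho> k K where g: "good c x \<rho> k K" using ex_good[OF x] by blast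
  note c = goodD(1)[OF g]
  let ?y0 = "snd c x"
  obtain a1 a2 where box: "cbox a1 a2 \<subseteq> ball ?y0 \<rho>" "?y0 \<in> box a1 a2"
  proof (rule open_contains_cbox[OF open_ball])
    show "?y0 \<in> ball ?y0 \<rho>" using goodD(3)[OF g] by simp
    fix a b assume "cbox a b \<subseteq> ball ?y0 \<rho>" "?y0 \<in> box a b"
    then show thesis by (rule that)
  qed
  obtain \<rho>2 where \<rho>2: "\<rho>2 > 0" "cball ?y0 \<rho>2 \<subseteq> box a1 a2"
    using open_contains_cball[of "box a1 a2"] open_box box(2) by blast
  define \<rho>' where "\<rho>' = \<rho>2 / 2"
  have \<rho>': "\<rho>' > 0" "cball ?y0 (2 * \<rho>') \<subseteq> cbox a1 a2"
    using \<rho>2 box_subset_cbox by (auto simp: \<rho>'_def)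
  have bb: "ball ?y0 \<rho>' \<subseteq> ball ?y0 \<rho>" "\<rho>' \<le> \<rho>"
  proof -
    show "ball ?y0 \<rho>' \<subseteq> ball ?y0 \<rho>" using \<rho>' box(1) by (auto simp: subset_iff)
    then show "\<rho>' \<le> \<rho>" using \<rho>'(1) goodD(3)[OF g] by (simp add: ball_subset_ball_iff)
  qed
  (* The bump lives on C, inside the open set U where the mollification is controlled, and it is
     bounded below by m on the smaller neighbourhood P. *)
  define U where "U = cinv c ` ball ?y0 \<rho>'"
  define C where "C = cinv c ` cball ?y0 (\<rho>' / 2)"
  define P where "P = cinv c ` ball ?y0 (\<rho>' / 4)"
  have bi: "ball ?y0 \<rho>' \<subseteq> snd c ` fst c" using bb(1) goodD(6)[OF g] by (rule order_trans)
  have inU: "z \<in> U \<longleftrightarrow> z \<in> fst c \<and> snd c z \<in> ball ?y0 \<rho>'" for z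
    unfolding U_def by (rule in_cinv_image_iff[OF c bi])
  have inC: "z \<in> C \<longleftrightarrow> z \<in> fst c \<and> snd c z \<in> cball ?y0 (\<rho>' / 2)" for z
    unfolding C_def by (rule in_cinv_image_iff[OF c]) (use bi \<rho>'(1) in \<open>auto simp: subset_iff\<close>)
  have inP: "z \<in> P \<longleftrightarrow> z \<in> fst c \<and> snd c z \<in> ball ?y0 (\<rho>' / 4)" for z
    unfolding P_def by (rule in_cinv_image_iff[OF c]) (use bi \<rho>'(1) in \<open>auto simp: subset_iff\<close>)
  have U: "openin T U" "U \<subseteq> fst c" using good_open[OF g bb(2)] inU by (auto simp: U_def)
  have "\<rho>' / 2 < \<rho>" using \<rho>'(1) bb(2) by simp
  then have C1: "closedin T C"
    unfolding C_def by (intro compactin_imp_closedin[OF Hausdorff good_compact[OF g]])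
  have C2: "C \<subseteq> U"
  proof
    fix z assume "z \<in> C"
    then show "z \<in> U" using inC inU \<rho>'(1) by auto
  qed
  note C = C1 C2
  have oP: "openin T P" using good_open[OF g, of "\<rho>' / 4"] bb(2) \<rho>'(1) by (simp add: P_def)
  define \<phi> where "\<phi> = bump ?y0 (\<rho>' / 2)"
  have \<phi>: "smooth_on UNIV \<phi>" "\<And>y. 0 \<le> \<phi> y" unfolding \<phi>_def by (rule smooth_bump, rule bump_nonneg)
  have \<phi>0: "\<forall>z\<in>U - C. \<phi> (snd c z) = 0"
    unfolding \<phi>_def using inU inC \<rho>'(1) by (intro ballI bump_eq_0) auto
  define \<beta> where "\<beta> = (\<lambda>z. if z \<in> U then \<phi> (snd c z) else 0)"
  note gl\<beta> = glue[OF c U C \<phi>(1) \<phi>0 \<beta>_def]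
  obtain b0 where b0: "b0 \<ge> 0" "\<And>y v. y \<in> cball ?y0 \<rho>' \<Longrightarrow> \<bar>frechet_derivative \<phi> (at y) v\<bar> \<le> b0 * norm v"
  proof (rule smooth_derivative_bound[OF \<phi>(1) compact_cball])
    fix b assume "b \<ge> 0" "\<And>y v. y \<in> cball ?y0 \<rho>' \<Longrightarrow> \<bar>frechet_derivative \<phi> (at y) v\<bar> \<le> b * norm v"
    then show thesis by (rule that)
  qed
  have k: "k > 0" by (rule goodD(4)[OF g])
  have gz: "k * norm v \<le> gnorm M c z v" "gnorm M c x v \<le> 2 * gnorm M c z v" if "z \<in> U" for z v
    using good_gnorm(1,4)[OF g, of "snd c z" v] inU[of z] that bb(1) cinv_snd[OF c, of z] by auto
  have "continuous_on (cball ?y0 (\<rho>' / 4)) \<phi>"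
    by (rule continuous_on_subset[OF smooth_on_imp_continuous_on[OF \<phi>(1)]]) simp
  moreover have "cball ?y0 (\<rho>' / 4) \<noteq> {}" using \<rho>'(1) by simp
  ultimately obtain y1 where y1: "y1 \<in> cball ?y0 (\<rho>' / 4)" "\<And>y. y \<in> cball ?y0 (\<rho>' / 4) \<Longrightarrow> \<phi> y1 \<le> \<phi> y"
    using continuous_attains_inf[OF compact_cball] by blast
  have m: "\<phi> y1 > 0" unfolding \<phi>_def using y1(1) \<rho>'(1) by (subst bump_pos_iff) auto
  have "patch D P \<beta> (b0 / k) (\<phi> y1)"
    unfolding patch_def
  proof (intro conjI ballI allI impI)
    show "openin T P" "0 < \<phi> y1" "0 \<le> b0 / k" "msmooth \<beta>" using oP m b0(1) k gl\<beta>(1) by auto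
    show "0 \<le> \<beta> z" for z using \<phi>(2) by (simp add: \<beta>_def)
    show "\<phi> y1 \<le> \<beta> z" if "z \<in> P" for z
    proof -
      have "z \<in> U" using that inP inU \<rho>'(1) by auto
      then show ?thesis using y1(2)[of "snd c z"] that inP by (simp add: \<beta>_def)
    qed
    show "\<bar>dd c' \<beta> z v\<bar> \<le> b0 / k * gnorm M c' z v" if c': "c' \<in> atlas M" "z \<in> fst c'" for c' z v
    proof (cases "z \<in> U")
      case True
      let ?v = "dtrans c' c z v"
      have zc: "z \<in> fst c" using True U(2) by blast
      have "\<bar>dd c' \<beta> z v\<bar> \<le> b0 * norm ?v"
        unfolding gl\<beta>(3)[OF c' True] by (rule b0(2)) (use True inU in auto)
      also have "\<dots> \<le> b0 * (gnorm M c z ?v / k)"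
        using gz(1)[OF True, of ?v] k b0(1) by (intro mult_left_mono) (simp_all add: field_simps)
      also have "gnorm M c z ?v = gnorm M c' z v" using gnorm_trans[OF c'(1) c c'(2) zc] by simp
      finally show ?thesis by simp
    next
      case False
      then have "dd c' \<beta> z v = 0" using gl\<beta>(2)[OF c'] C(2) by blast
      then show ?thesis using b0(1) k gnorm_nonneg[OF c'] by simp
    qed
    fix e :: real assume e: "e > 0"
    define u where "u = (\<lambda>y. D (cinv c y))"
    define N where "N = (\<lambda>v. 2 * gnorm M c x v)"
    have pt: "cinv c y \<in> points M" if "y \<in> ball ?y0 \<rho>" for y
      using chart_points[OF c cinv_in] goodD(6)[OF g] that by blast
    have lip: "\<bar>u y - u z\<bar> \<le> N (y - z)" if "y \<in> cbox a1 a2" "z \<in> cbox a1 a2" for y z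
    proof -
      have yz: "y \<in> ball ?y0 \<rho>" "z \<in> ball ?y0 \<rho>" using that box(1) by blast+
      have "\<bar>u y - u z\<bar> \<le> rdist M (cinv c z) (cinv c y)"
        using D[OF pt[OF yz(2)] pt[OF yz(1)]] by (simp add: u_def abs_minus_commute)
      also have "\<dots> \<le> N (y - z)" unfolding N_def by (rule good_rdist_le(1)[OF g yz(2,1)])
      finally show ?thesis .
    qed
    have Ns: "N (t *\<^sub>R v) = \<bar>t\<bar> * N v" for t v by (simp add: N_def gnorm_scale)
    have NK: "N v \<le> (2 * K) * norm v" for v
      using good_gnorm(2)[OF g, of ?y0 v] goodD(3,7)[OF g] by (simp add: N_def)
    obtain h where h: "smooth_on UNIV h" "\<And>y. y \<in> ball ?y0 \<rho>' \<Longrightarrow> \<bar>h y - u y\<bar> \<le> e"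
        "\<And>y v. y \<in> ball ?y0 \<rho>' \<Longrightarrow> \<bar>frechet_derivative h (at y) v\<bar> \<le> N v"
    proof (rule mollify[OF \<rho>' lip Ns NK e])
      fix h assume "smooth_on UNIV h" "\<And>y. y \<in> ball ?y0 \<rho>' \<Longrightarrow> \<bar>h y - u y\<bar> \<le> e"
        "\<And>y v. y \<in> ball ?y0 \<rho>' \<Longrightarrow> \<bar>frechet_derivative h (at y) v\<bar> \<le> N v"
      then show thesis by (rule that)
    qed
    define w where "w = (\<lambda>z. if z \<in> U then \<phi> (snd c z) * h (snd c z) else 0)"
    have \<phi>h: "smooth_on UNIV (\<lambda>y. \<phi> y * h y)" by (rule smooth_on_mult[OF open_UNIV \<phi>(1) h(1)])
    have \<phi>h0: "\<forall>z\<in>U - C. \<phi> (snd c z) * h (snd c z) = 0" using \<phi>0 by simp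
    note glw = glue[OF c U C \<phi>h \<phi>h0 w_def]
    have "\<exists>t. \<bar>t - D z\<bar> \<le> e \<and> w z = \<beta> z * t \<and>
       (\<forall>c'\<in>atlas M. z \<in> fst c' \<longrightarrow> (\<forall>v. \<bar>dd c' w z v - t * dd c' \<beta> z v\<bar> \<le> \<beta> z * (4 * gnorm M c' z v)))"
      if z: "z \<in> points M" for z
    proof (cases "z \<in> U")
      case True
      let ?w = "snd c z"
      have zc: "z \<in> fst c" and y: "?w \<in> ball ?y0 \<rho>'" using iffD1[OF inU True] by blast+
      have "\<bar>dd c' w z v - h ?w * dd c' \<beta> z v\<bar> \<le> \<beta> z * (4 * gnorm M c' z v)"
        if c': "c' \<in> atlas M" "z \<in> fst c'" for c' v
      proof -
        let ?v = "dtrans c' c z v"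
        have "((\<lambda>y. \<phi> y * h y) has_derivative (\<lambda>v. \<phi> ?w * frechet_derivative h (at ?w) v + frechet_derivative \<phi> (at ?w) v * h ?w)) (at ?w)"
          by (intro has_derivative_mult smooth_on_has_derivative[OF \<phi>(1)] smooth_on_has_derivative[OF h(1)] UNIV_I)
        then have "frechet_derivative (\<lambda>y. \<phi> y * h y) (at ?w) ?v = \<phi> ?w * frechet_derivative h (at ?w) ?v + frechet_derivative \<phi> (at ?w) ?v * h ?w"
          by (rule fun_cong[OF frechet_derivative_at[symmetric]])
        then have "dd c' w z v - h ?w * dd c' \<beta> z v = \<phi> ?w * frechet_derivative h (at ?w) ?v"
          unfolding glw(3)[OF c' True] gl\<beta>(3)[OF c' True] by simp
        moreover have "\<bar>frechet_derivative h (at ?w) ?v\<bar> \<le> 4 * gnorm M c' z v"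
          using h(3)[OF y, of ?v] gz(2)[OF True, of ?v] gnorm_trans[OF c'(1) c c'(2) zc, of v] by (simp add: N_def)
        ultimately show ?thesis using \<phi>(2)[of ?w] True by (simp add: \<beta>_def abs_mult mult_left_mono)
      qed
      moreover have "\<bar>h ?w - D z\<bar> \<le> e" using h(2)[OF y] cinv_snd[OF c zc] by (simp add: u_def)
      ultimately show ?thesis using True by (intro exI[of _ "h ?w"]) (simp add: w_def \<beta>_def)
    next
      case False
      then have zC: "z \<notin> C" using C(2) by blast
      show ?thesis using False e glw(2)[OF _ _ zC] gl\<beta>(2)[OF _ _ zC] by (intro exI[of _ "D z"]) (simp add: w_def \<beta>_def)
    qed
    then show "\<exists>w. msmooth w \<and> (\<forall>z\<in>points M. \<exists>t. \<bar>t - D z\<bar> \<le> e \<and> w z = \<beta> z * t \<and>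
       (\<forall>c'\<in>atlas M. z \<in> fst c' \<longrightarrow> (\<forall>v. \<bar>dd c' w z v - t * dd c' \<beta> z v\<bar> \<le> \<beta> z * (4 * gnorm M c' z v))))"
      using glw(1) by blast
  qed
  moreover have "x \<in> P" using inP goodD(2)[OF g] \<rho>'(1) by simp
  ultimately show ?thesis by blast
qed

end


section \<open>Cut-off functions\<close>

context riemannian
begin

lemma msmooth_continuous:
  assumes "msmooth f"
  shows "continuous_map T euclideanreal f"
  unfolding continuous_map
proof (intro conjI allI impI)
  fix V :: "real set" assume V: "openin euclideanreal V"
  have "{x \<in> points M. f x \<in> V} = (\<Union>c\<in>atlas M. cinv c ` {y \<in> snd c ` fst c. (f \<circ> cinv c) y \<in> V})" (is "?L = ?R")
  proof (intro set_eqI iffI)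
    fix x assume x: "x \<in> ?L"
    then obtain c where c: "c \<in> atlas M" "x \<in> fst c" using ex_chart by blast
    have "x = cinv c (snd c x)" "snd c x \<in> {y \<in> snd c ` fst c. (f \<circ> cinv c) y \<in> V}"
      using x c cinv_snd[OF c] by auto
    then show "x \<in> ?R" using c(1) by blast
  next
    fix x assume "x \<in> ?R"
    then obtain c y where c: "c \<in> atlas M" "x = cinv c y" "y \<in> snd c ` fst c" "f (cinv c y) \<in> V" by auto
    then show "x \<in> ?L" using chart_points[OF c(1) cinv_in[OF c(3)]] by simp
  qed
  moreover have "openin T (cinv c ` {y \<in> snd c ` fst c. (f \<circ> cinv c) y \<in> V})" if c: "c \<in> atlas M" for c
  proof (rule open_cinv_image[OF c])
    have "continuous_on (snd c ` fst c) (f \<circ> cinv c)"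
      using assms c unfolding msmooth_def by (intro smooth_on_imp_continuous_on) blast
    from continuous_open_preimage[OF this image_open[OF c], of V]
    have "open (snd c ` fst c \<inter> (f \<circ> cinv c) -` V)" using V by simp
    also have "snd c ` fst c \<inter> (f \<circ> cinv c) -` V = {y \<in> snd c ` fst c. (f \<circ> cinv c) y \<in> V}" by auto
    finally show "open {y \<in> snd c ` fst c. (f \<circ> cinv c) y \<in> V}" .
  qed auto
  ultimately show "openin T {x \<in> points M. f x \<in> V}" by (auto intro!: openin_Union)
qed auto

text \<open>Applying the differential to the gradient itself yields the square of the norm of the gradient.\<close>

lemma gnorm_gradient_le:
  assumes c: "c \<in> atlas M" "z \<in> fst c" and lin: "linear (dd c f z)"
    and bd: "\<And>v. \<bar>dd c f z v\<bar> \<le> L * gnorm M c z v" and L: "L \<ge> 0"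
  shows "gnorm M c z (gradient M c f z) \<le> L"
proof -
  let ?G = "gmat M c z" and ?g = "gradient M c f z"
  have "invertible ?G" using det_gmat_pos[OF c] by (simp add: invertible_det_nz)
  then have "\<exists>A. ?G ** A = mat 1 \<and> A ** ?G = mat 1" by (simp add: invertible_def)
  from someI_ex[OF this] have "?G ** matrix_inv ?G = mat 1" by (simp add: matrix_inv_def)
  then have Gg: "?G *v ?g = differential c f z"
    by (simp add: gradient_def matrix_vector_mul_assoc)
  have "?g \<bullet> (?G *v ?g) = (\<Sum>i\<in>UNIV. ?g $ i * dd c f z (axis i 1))"
    by (simp add: Gg differential_def dd_def inner_vec_def)
  also have "\<dots> = dd c f z (\<Sum>i\<in>UNIV. ?g $ i *\<^sub>R axis i 1)"
    by (simp add: linear_sum[OF lin] linear_scale[OF lin])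
  also have "(\<Sum>i\<in>UNIV. ?g $ i *\<^sub>R axis i 1) = ?g"
    using basis_expansion[of ?g] by (simp add: scalar_mult_eq_scaleR)
  finally have "(gnorm M c z ?g)\<^sup>2 = dd c f z ?g"
    using gmat_nonneg[OF c, of ?g] by (simp add: gnorm_def)
  then have "gnorm M c z ?g * gnorm M c z ?g \<le> L * gnorm M c z ?g"
    using bd[of ?g] by (simp add: power2_eq_square)
  then show ?thesis using gnorm_nonneg[OF c, of ?g] L by (cases "gnorm M c z ?g = 0") auto
qed

lemma grad_norm_le:
  assumes f: "msmooth f" and z: "z \<in> points M" and L: "L \<ge> 0"
    and bd: "\<And>c v. c \<in> atlas M \<Longrightarrow> z \<in> fst c \<Longrightarrow> \<bar>dd c f z v\<bar> \<le> L * gnorm M c z v"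
  shows "grad_norm M f z \<le> L"
proof -
  note c = chart_at[OF z, THEN conjunct1] chart_at[OF z, THEN conjunct2]
  have "linear (dd (chart_at M z) f z)" using dd_derivative[OF f c] has_derivative_linear by blast
  from gnorm_gradient_le[OF c this bd[OF c] L] show ?thesis by (simp add: grad_norm_def Let_def)
qed

lemma grad_norm_nonneg: "z \<in> points M \<Longrightarrow> 0 \<le> grad_norm M f z"
  using gnorm_nonneg chart_at by (simp add: grad_norm_def Let_def)

text \<open>The weights \<open>\<beta> j / S\<close> form a partition of unity over the compact set \<open>K\<close>. The differential of
  \<open>H / S\<close> is the weighted mean of the differentials of the local approximations plus the sum of
  \<open>(t j - H / S) * d (\<beta> j) / S\<close>. The second part is small, because all \<open>t j\<close> are close to \<open>D\<close> and the
  bumps do not depend on how close.\<close>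

lemma smooth_approximation:
  assumes K: "compactin T K" and D: "\<And>y z. y \<in> points M \<Longrightarrow> z \<in> points M \<Longrightarrow> \<bar>D y - D z\<bar> \<le> rdist M y z" and e: "e > 0"
  shows "\<exists>W H S. openin T W \<and> K \<subseteq> W \<and> msmooth H \<and> msmooth S \<and> (\<forall>z\<in>W. 0 < S z \<and> \<bar>H z / S z - D z\<bar> \<le> e) \<and>
     (\<forall>z\<in>K. \<forall>c\<in>atlas M. z \<in> fst c \<longrightarrow> (\<forall>v. \<bar>(dd c H z v - H z / S z * dd c S z v) / S z\<bar> \<le> 5 * gnorm M c z v))"
proof (cases "K = {}")
  case True
  have "msmooth (\<lambda>_. 0)" by (simp add: msmooth_def o_def smooth_on_const)
  then show ?thesis using True by (intro exI[of _ "{}"] exI[of _ "\<lambda>_. 0"]) simp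
next
  case False
  have Kp: "K \<subseteq> points M" by (rule compactin_subset_topspace[OF K])
  have "\<forall>x\<in>points M. \<exists>P \<beta> b m. x \<in> P \<and> patch D P \<beta> b m" using ex_patch[OF _ D] by blast
  then obtain P \<beta> b m where pa: "\<And>x. x \<in> points M \<Longrightarrow> x \<in> P x \<and> patch D (P x) (\<beta> x) (b x) (m x)" by metis
  have pK: "x \<in> P x" "patch D (P x) (\<beta> x) (b x) (m x)" if "x \<in> K" for x using pa Kp that by blast+
  have op: "openin T U" if "U \<in> P ` K" for U using that pK(2) unfolding patch_def by blast
  have cov: "K \<subseteq> \<Union>(P ` K)" using pK(1) by blast
  obtain \<F> where "finite \<F>" "\<F> \<subseteq> P ` K" "K \<subseteq> \<Union>\<F>" using compactinD[OF K op cov] by blast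
  then obtain F where F: "finite F" "F \<subseteq> K" "K \<subseteq> (\<Union>x\<in>F. P x)"
    using finite_subset_image[of \<F> P K] by blast
  have Fne: "F \<noteq> {}" using F(3) False by auto
  have pF: "openin T (P j)" "0 < m j" "0 \<le> b j" "msmooth (\<beta> j)" if "j \<in> F" for j
    using pK(2)[of j] F(2) that unfolding patch_def by blast+
  have pF0: "0 \<le> \<beta> j z" if "j \<in> F" "z \<in> points M" for j z
    using pK(2)[of j] F(2) that unfolding patch_def by blast
  have pFm: "m j \<le> \<beta> j z" if "j \<in> F" "z \<in> P j" for j z
    using pK(2)[of j] F(2) that unfolding patch_def by blast
  have pFb: "\<bar>dd c (\<beta> j) z v\<bar> \<le> b j * gnorm M c z v" if "j \<in> F" "c \<in> atlas M" "z \<in> fst c" for j c z v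
    using pK(2)[of j] F(2) that unfolding patch_def by blast
  define m0 where "m0 = Min (m ` F)"
  have m0: "m0 > 0" "\<And>j. j \<in> F \<Longrightarrow> m0 \<le> m j" using F(1) Fne pF(2) by (auto simp: m0_def)
  define b0 where "b0 = (\<Sum>j\<in>F. b j)"
  have b0: "b0 \<ge> 0" using pF(3) by (auto simp: b0_def intro: sum_nonneg)
  (* m0 bounds the sum of the bumps below and b0 bounds their differentials; with this error the
     differentials of the weights contribute at most 1 to the gradient, on top of the local 4. *)
  define \<epsilon> where "\<epsilon> = min e (m0 / (2 * (b0 + 1)))"
  have \<epsilon>: "\<epsilon> > 0" "\<epsilon> \<le> e" using e m0(1) b0 by (auto simp: \<epsilon>_def)
  have "\<epsilon> \<le> m0 / (2 * (b0 + 1))" by (simp add: \<epsilon>_def)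
  then have "\<epsilon> * (2 * (b0 + 1)) \<le> m0" using pos_le_divide_eq[of "2 * (b0 + 1)" \<epsilon> m0] b0 by simp
  then have \<epsilon>b: "2 * \<epsilon> * b0 \<le> m0" using \<epsilon>(1) by (simp add: algebra_simps)
  have "\<forall>j\<in>F. \<exists>w. msmooth w \<and> (\<forall>z\<in>points M. \<exists>t. \<bar>t - D z\<bar> \<le> \<epsilon> \<and> w z = \<beta> j z * t \<and>
       (\<forall>c\<in>atlas M. z \<in> fst c \<longrightarrow> (\<forall>v. \<bar>dd c w z v - t * dd c (\<beta> j) z v\<bar> \<le> \<beta> j z * (4 * gnorm M c z v))))"
    using pK(2) F(2) \<epsilon>(1) unfolding patch_def by blast
  then obtain w where w: "\<And>j. j \<in> F \<Longrightarrow> msmooth (w j)"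
    "\<And>j z. j \<in> F \<Longrightarrow> z \<in> points M \<Longrightarrow> \<exists>t. \<bar>t - D z\<bar> \<le> \<epsilon> \<and> w j z = \<beta> j z * t \<and>
       (\<forall>c\<in>atlas M. z \<in> fst c \<longrightarrow> (\<forall>v. \<bar>dd c (w j) z v - t * dd c (\<beta> j) z v\<bar> \<le> \<beta> j z * (4 * gnorm M c z v)))"
    by (metis (no_types, lifting))
  define W where "W = (\<Union>j\<in>F. P j)"
  define S where "S = (\<lambda>z. \<Sum>j\<in>F. \<beta> j z)"
  define H where "H = (\<lambda>z. \<Sum>j\<in>F. w j z)"
  have ms: "msmooth (\<lambda>z. \<Sum>j\<in>F. g j z)" if "\<And>j. j \<in> F \<Longrightarrow> msmooth (g j)" for g
    using that smooth_on_sum[OF image_open, of _ F "\<lambda>j. g j \<circ> cinv _"] unfolding msmooth_def by (simp add: o_def)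
  have mH: "msmooth H" and mS: "msmooth S" unfolding H_def S_def using ms w(1) pF(4) by blast+
  have oW: "openin T W" unfolding W_def using pF(1) by (auto intro!: openin_Union)
  have Wp: "W \<subseteq> points M" by (rule openin_subset[OF oW])
  have S: "m0 \<le> S z" if z: "z \<in> W" for z
  proof -
    obtain j where j: "j \<in> F" "z \<in> P j" using z by (auto simp: W_def)
    have "m0 \<le> \<beta> j z" using m0(2)[OF j(1)] pFm[OF j] by simp
    also have "\<dots> \<le> S z" unfolding S_def by (rule member_le_sum[OF j(1) _ F(1)]) (use pF0 z Wp in auto)
    finally show ?thesis .
  qed
  have main: "\<bar>H z / S z - D z\<bar> \<le> \<epsilon> \<and> (\<forall>c\<in>atlas M. z \<in> fst c \<longrightarrow> (\<forall>v. \<bar>(dd c H z v - H z / S z * dd c S z v) / S z\<bar> \<le> 5 * gnorm M c z v))"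
    if z: "z \<in> W" for z
  proof -
    have zp: "z \<in> points M" using z Wp by blast
    have Sz: "S z > 0" using S[OF z] m0(1) by simp
    have "\<forall>j\<in>F. \<exists>t. \<bar>t - D z\<bar> \<le> \<epsilon> \<and> w j z = \<beta> j z * t \<and>
       (\<forall>c\<in>atlas M. z \<in> fst c \<longrightarrow> (\<forall>v. \<bar>dd c (w j) z v - t * dd c (\<beta> j) z v\<bar> \<le> \<beta> j z * (4 * gnorm M c z v)))"
      using w(2)[OF _ zp] by blast
    from bchoice[OF this] obtain t where t: "\<forall>j\<in>F. \<bar>t j - D z\<bar> \<le> \<epsilon> \<and> w j z = \<beta> j z * t j \<and>
       (\<forall>c\<in>atlas M. z \<in> fst c \<longrightarrow> (\<forall>v. \<bar>dd c (w j) z v - t j * dd c (\<beta> j) z v\<bar> \<le> \<beta> j z * (4 * gnorm M c z v)))" ..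
    have "\<bar>H z - D z * S z\<bar> = \<bar>\<Sum>j\<in>F. \<beta> j z * (t j - D z)\<bar>"
      unfolding H_def S_def sum_distrib_left sum_subtractf[symmetric]
      by (intro arg_cong[of _ _ abs] sum.cong) (use t in \<open>auto simp: algebra_simps\<close>)
    also have "\<dots> \<le> (\<Sum>j\<in>F. \<bar>\<beta> j z * (t j - D z)\<bar>)" by (rule sum_abs)
    also have "\<dots> \<le> (\<Sum>j\<in>F. \<beta> j z * \<epsilon>)"
      by (intro sum_mono) (use t pF0[OF _ zp] in \<open>auto simp: abs_mult intro!: mult_left_mono\<close>)
    also have "\<dots> = \<epsilon> * S z" by (simp add: S_def sum_distrib_left mult.commute)
    finally have "\<bar>H z - D z * S z\<bar> / S z \<le> \<epsilon>" using Sz by (simp add: divide_le_eq)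
    moreover have "H z / S z - D z = (H z - D z * S z) / S z" using Sz by (simp add: field_simps)
    ultimately have HD: "\<bar>H z / S z - D z\<bar> \<le> \<epsilon>" using Sz by (simp add: abs_divide)
    have "\<bar>(dd c H z v - H z / S z * dd c S z v) / S z\<bar> \<le> 5 * gnorm M c z v" if c: "c \<in> atlas M" "z \<in> fst c" for c v
    proof -
      let ?h = "H z / S z" and ?N = "gnorm M c z v"
      have N0: "?N \<ge> 0" by (rule gnorm_nonneg[OF c])
      have dsum: "dd c (\<lambda>z. \<Sum>j\<in>F. g j z) z = (\<lambda>v. \<Sum>j\<in>F. dd c (g j) z v)" if g: "\<And>j. j \<in> F \<Longrightarrow> msmooth (g j)" for g
      proof -
        have "((\<lambda>y. \<Sum>j\<in>F. (g j \<circ> cinv c) y) has_derivative (\<lambda>v. \<Sum>j\<in>F. dd c (g j) z v)) (at (snd c z))"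
          by (rule has_derivative_sum) (rule dd_derivative[OF g c])
        then show ?thesis unfolding dd_def[of c "\<lambda>z. \<Sum>j\<in>F. g j z"] o_def by (rule frechet_derivative_at[symmetric])
      qed
      have "dd c H z v - ?h * dd c S z v = (\<Sum>j\<in>F. dd c (w j) z v) - ?h * (\<Sum>j\<in>F. dd c (\<beta> j) z v)"
        unfolding H_def[abs_def] S_def[abs_def] using dsum[of w, OF w(1)] dsum[of \<beta>, OF pF(4)] by simp
      also have "\<dots> = (\<Sum>j\<in>F. (dd c (w j) z v - t j * dd c (\<beta> j) z v) + (t j - ?h) * dd c (\<beta> j) z v)"
        unfolding sum_distrib_left sum_subtractf[symmetric] by (rule sum.cong) (auto simp: algebra_simps)
      also have "\<bar>\<dots>\<bar> \<le> (\<Sum>j\<in>F. \<beta> j z * (4 * ?N) + 2 * \<epsilon> * (b j * ?N))"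
      proof (rule order_trans[OF sum_abs], rule sum_mono)
        fix j assume j: "j \<in> F"
        have "\<bar>t j - ?h\<bar> \<le> 2 * \<epsilon>" using t j HD by (auto simp: abs_le_iff)
        then have "\<bar>(t j - ?h) * dd c (\<beta> j) z v\<bar> \<le> 2 * \<epsilon> * (b j * ?N)"
          unfolding abs_mult using pFb[OF j c, of v] by (intro mult_mono) auto
        moreover have "\<bar>dd c (w j) z v - t j * dd c (\<beta> j) z v\<bar> \<le> \<beta> j z * (4 * ?N)" using t j c by blast
        ultimately show "\<bar>(dd c (w j) z v - t j * dd c (\<beta> j) z v) + (t j - ?h) * dd c (\<beta> j) z v\<bar> \<le> \<beta> j z * (4 * ?N) + 2 * \<epsilon> * (b j * ?N)"
          by linarith
      qed
      also have "\<dots> = S z * (4 * ?N) + 2 * \<epsilon> * b0 * ?N"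
        by (simp add: sum.distrib S_def b0_def sum_distrib_left sum_distrib_right mult_ac)
      also have "\<dots> \<le> S z * (4 * ?N) + S z * ?N"
        using mult_right_mono[OF order_trans[OF \<epsilon>b S[OF z]] N0] by simp
      finally have "\<bar>dd c H z v - ?h * dd c S z v\<bar> \<le> (5 * ?N) * S z" by (simp add: algebra_simps)
      then show ?thesis using Sz by (simp add: abs_divide divide_le_eq)
    qed
    then show ?thesis using HD by blast
  qed
  have 1: "\<forall>z\<in>W. 0 < S z \<and> \<bar>H z / S z - D z\<bar> \<le> e"
  proof
    fix z assume z: "z \<in> W"
    show "0 < S z \<and> \<bar>H z / S z - D z\<bar> \<le> e" using main[OF z] \<epsilon>(2) S[OF z] m0(1) by linarith
  qed
  have KW: "K \<subseteq> W" using F(3) by (simp add: W_def)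
  have 2: "\<forall>z\<in>K. \<forall>c\<in>atlas M. z \<in> fst c \<longrightarrow> (\<forall>v. \<bar>(dd c H z v - H z / S z * dd c S z v) / S z\<bar> \<le> 5 * gnorm M c z v)"
  proof
    fix z assume "z \<in> K"
    then have "z \<in> W" using KW by blast
    from main[OF this] show "\<forall>c\<in>atlas M. z \<in> fst c \<longrightarrow> (\<forall>v. \<bar>(dd c H z v - H z / S z * dd c S z v) / S z\<bar> \<le> 5 * gnorm M c z v)" ..
  qed
  show ?thesis by (rule exI[of _ W], rule exI[of _ H], rule exI[of _ S], intro conjI oW KW mH mS 1 2)
qed

text \<open>The step function is applied to an approximation of \<open>D = r - rdist M x0\<close> with error \<open>r / 16\<close>. It is
  \<open>0\<close> up to \<open>r / 8\<close>, hence where \<open>D \<le> r / 16\<close>, which leaves a margin between the support and the sphere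
  of radius \<open>r\<close>; and it is \<open>1\<close> from \<open>3 * r / 8\<close> on, hence where \<open>D \<ge> r / 2\<close>. Its slope is \<open>4 * L / r\<close>,
  and the approximation has gradient at most \<open>5\<close>.\<close>

lemma cutoff:
  assumes complete: "D.mcomplete" and x0: "x0 \<in> points M" and r: "r > 0"
    and \<sigma>: "smooth_on UNIV \<sigma>" "\<And>s. s \<le> 0 \<Longrightarrow> \<sigma> s = 0" "\<And>s. s \<ge> 1 \<Longrightarrow> \<sigma> s = 1" "\<And>s. 0 \<le> \<sigma> s \<and> \<sigma> s \<le> 1"
      "\<And>s v. \<bar>frechet_derivative \<sigma> (at s) v\<bar> \<le> L * \<bar>v\<bar>" and L: "L > 0"
  shows "\<exists>f\<in>test_functions M. msmooth f \<and> (\<forall>z. 0 \<le> f z \<and> f z \<le> 1) \<and> (\<forall>z\<in>D.mball x0 (r / 2). f z = 1) \<and>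
    (\<forall>z\<in>points M. grad_norm M f z \<le> 20 * L / r) \<and>
    (\<forall>z\<in>points M - D.mball x0 r. f z = 0 \<and> grad_norm M f z \<le> 0)"
proof -
  define R where "R = 15 / 16 * r"
  define K where "K = D.mcball x0 R"
  define D where "D = (\<lambda>z. r - rdist M x0 z)"
  have cK: "compactin T K" unfolding K_def by (rule compact_mcball[OF complete x0])
  have clK: "closedin T K" using D.closedin_mcball[of x0 R] mtopology_eq by (simp add: K_def)
  have Kball: "K \<subseteq> D.mball x0 r" unfolding K_def R_def by (rule D.mcball_subset_mball_concentric) (use r in simp)
  have Dlip: "\<bar>D y - D z\<bar> \<le> rdist M y z" if "y \<in> points M" "z \<in> points M" for y z
    using D.triangle[OF x0 that] D.triangle[OF x0 that(2,1)] D.commute[of y z] by (simp add: D_def abs_le_iff)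
  obtain W H S where W: "openin T W" "K \<subseteq> W" "msmooth H" "msmooth S"
    "\<forall>z\<in>W. 0 < S z \<and> \<bar>H z / S z - D z\<bar> \<le> r / 16"
    "\<forall>z\<in>K. \<forall>c\<in>atlas M. z \<in> fst c \<longrightarrow> (\<forall>v. \<bar>(dd c H z v - H z / S z * dd c S z v) / S z\<bar> \<le> 5 * gnorm M c z v)"
    using smooth_approximation[OF cK Dlip, of "r / 16"] r by auto
  define \<tau> where "\<tau> = (\<lambda>s. \<sigma> (4 / r * s - 1 / 2))"
  have "smooth_on UNIV (\<lambda>s::real. 4 / r * s - 1 / 2)"
    by (intro smooth_on_diff[OF open_UNIV smooth_on_mult[OF open_UNIV smooth_on_const smooth_on_linear[OF bounded_linear_ident]] smooth_on_const])
  from smooth_on_compose[OF open_UNIV open_UNIV _ \<sigma>(1) this]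
  have \<tau>s: "smooth_on UNIV \<tau>" by (simp add: \<tau>_def)
  have \<tau>0: "\<tau> s = 0" if "s \<le> r / 8" for s
    unfolding \<tau>_def by (rule \<sigma>(2)) (use that r in \<open>simp add: field_simps\<close>)
  have \<tau>1: "\<tau> s = 1" if "3 / 8 * r \<le> s" for s
    unfolding \<tau>_def by (rule \<sigma>(3)) (use that r in \<open>simp add: field_simps\<close>)
  have \<tau>d: "\<bar>frechet_derivative \<tau> (at s) v\<bar> \<le> 4 * L / r * \<bar>v\<bar>" for s v
  proof -
    have 1: "((\<lambda>s. 4 / r * s - 1 / 2) has_derivative (\<lambda>v. 4 / r * v)) (at s)"
      using r by (auto intro!: derivative_eq_intros)
    from has_derivative_compose[OF 1 smooth_on_has_derivative[OF \<sigma>(1) UNIV_I]]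
    have "frechet_derivative \<tau> (at s) = (\<lambda>v. frechet_derivative \<sigma> (at (4 / r * s - 1 / 2)) (4 / r * v))"
      unfolding \<tau>_def by (rule frechet_derivative_at[symmetric])
    then show ?thesis using \<sigma>(5)[of "4 / r * s - 1 / 2" "4 / r * v"] r by (simp add: abs_mult mult_ac)
  qed
  define f where "f = (\<lambda>z. if z \<in> K then \<tau> (H z / S z) else 0)"
  have fW: "f z = \<tau> (H z / S z)" if z: "z \<in> W" for z
  proof (cases "z \<in> K")
    case False
    have "z \<in> points M" using z openin_subset[OF W(1)] by blast
    then have "D z \<le> r / 16" using False x0 by (auto simp: K_def D_def R_def)
    moreover have "\<bar>H z / S z - D z\<bar> \<le> r / 16" using W(5) z by blast
    ultimately have "H z / S z \<le> r / 8" by linarith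
    then show ?thesis using False \<tau>0 by (simp add: f_def)
  qed (simp add: f_def)
  have oK: "openin T (points M - K)" using clK by (simp add: closedin_def)
  have f0: "f z = 0" if "z \<in> points M - K" for z using that by (simp add: f_def)
  have smW: "open (snd c ` (fst c \<inter> W))" "smooth_on (snd c ` (fst c \<inter> W)) (\<lambda>y. \<tau> ((H \<circ> cinv c) y / (S \<circ> cinv c) y))"
    "\<And>y. y \<in> snd c ` (fst c \<inter> W) \<Longrightarrow> \<tau> ((H \<circ> cinv c) y / (S \<circ> cinv c) y) = (f \<circ> cinv c) y" if c: "c \<in> atlas M" for c
  proof -
    let ?V = "snd c ` (fst c \<inter> W)"
    show o: "open ?V" using open_snd_image[OF c openin_Int[OF chart_open[OF c] W(1)]] by simp
    have sH: "smooth_on ?V (H \<circ> cinv c)" "smooth_on ?V (S \<circ> cinv c)"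
      using W(3,4) c unfolding msmooth_def by (auto intro: smooth_on_subset)
    have pos: "(S \<circ> cinv c) y \<noteq> 0" if "y \<in> ?V" for y
      using that W(5) cinv_snd[OF c] by force
    from smooth_on_compose[OF o open_UNIV _ \<tau>s smooth_on_divide[OF o sH pos]]
    show "smooth_on ?V (\<lambda>y. \<tau> ((H \<circ> cinv c) y / (S \<circ> cinv c) y))" by simp
    show "\<tau> ((H \<circ> cinv c) y / (S \<circ> cinv c) y) = (f \<circ> cinv c) y" if y: "y \<in> ?V" for y
    proof -
      obtain z where "z \<in> fst c" "z \<in> W" "y = snd c z" using y by blast
      then show ?thesis using fW[of z] cinv_snd[OF c] by simp
    qed
  qed
  have mf: "msmooth f"
    unfolding msmooth_def
  proof (intro ballI smooth_on_locally)
    fix c y assume c: "c \<in> atlas M" and y: "y \<in> snd c ` fst c"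
    then obtain z where z: "z \<in> fst c" "y = snd c z" by blast
    show "\<exists>V. y \<in> V \<and> open V \<and> smooth_on V (f \<circ> cinv c)"
    proof (cases "z \<in> W")
      case True
      have sm: "smooth_on (snd c ` (fst c \<inter> W)) (f \<circ> cinv c)"
        by (rule smooth_on_cong[OF smW(1)[OF c] smW(2)[OF c] smW(3)[OF c]])
      have yV: "y \<in> snd c ` (fst c \<inter> W)" unfolding z(2) by (intro imageI IntI z(1) True)
      show ?thesis by (rule exI[of _ "snd c ` (fst c \<inter> W)"], intro conjI yV smW(1)[OF c] sm)
    next
      case False
      let ?V = "snd c ` (fst c \<inter> (points M - K))"
      have o: "open ?V" using open_snd_image[OF c openin_Int[OF chart_open[OF c] oK]] by simp
      have sm: "smooth_on ?V (f \<circ> cinv c)"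
        by (rule smooth_on_cong[OF o smooth_on_const[of _ 0]]) (use f0 cinv_snd[OF c] in auto)
      have "z \<in> points M - K" using False W(2) chart_points[OF c z(1)] by blast
      then have yV: "y \<in> ?V" unfolding z(2) by (intro imageI IntI z(1))
      show ?thesis by (rule exI[of _ ?V], intro conjI yV o sm)
    qed
  qed
  have "compactin T (T closure_of {x \<in> points M. f x \<noteq> 0})"
  proof (rule closed_compactin[OF cK _ closedin_closure_of])
    show "T closure_of {x \<in> points M. f x \<noteq> 0} \<subseteq> K"
      by (rule closure_of_minimal[OF _ clK]) (auto simp: f_def)
  qed
  then have test: "f \<in> test_functions M" using mf by (simp add: test_functions_def msmooth_def)
  have dK: "\<bar>dd c f z v\<bar> \<le> 20 * L / r * gnorm M c z v" if c: "c \<in> atlas M" "z \<in> fst c" and z: "z \<in> K" for c z v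
  proof -
    have zW: "z \<in> W" using z W(2) by blast
    let ?H = "H \<circ> cinv c" and ?S = "S \<circ> cinv c" and ?y = "snd c z"
    have vals: "?H ?y = H z" "?S ?y = S z" using cinv_snd[OF c] by auto
    have Sz: "S z > 0" using W(5) zW by blast
    have dq: "((\<lambda>y. ?H y / ?S y) has_derivative (\<lambda>v. (dd c H z v - H z / S z * dd c S z v) / S z)) (at ?y)"
    proof -
      have "((\<lambda>y. ?H y / ?S y) has_derivative (\<lambda>v. (dd c H z v * ?S ?y - ?H ?y * dd c S z v) / (?S ?y * ?S ?y))) (at ?y)"
        by (rule has_derivative_divide'[OF dd_derivative[OF W(3) c] dd_derivative[OF W(4) c]]) (use vals Sz in simp)
      moreover have "(dd c H z v * ?S ?y - ?H ?y * dd c S z v) / (?S ?y * ?S ?y) = (dd c H z v - H z / S z * dd c S z v) / S z" for v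
        using Sz unfolding vals by (simp add: field_simps)
      ultimately show ?thesis by simp
    qed
    from has_derivative_compose[OF dq smooth_on_has_derivative[OF \<tau>s UNIV_I]]
    have "frechet_derivative (\<lambda>y. \<tau> (?H y / ?S y)) (at ?y) = (\<lambda>v. frechet_derivative \<tau> (at (?H ?y / ?S ?y)) ((dd c H z v - H z / S z * dd c S z v) / S z))"
      by (rule frechet_derivative_at[symmetric])
    moreover have "dd c f z = frechet_derivative (\<lambda>y. \<tau> (?H y / ?S y)) (at ?y)"
      unfolding dd_def
      by (rule frechet_derivative_cong_open[OF smW(1)[OF c(1)] _ smW(3)[OF c(1), symmetric]]) (use c zW in auto)
    ultimately have eq: "dd c f z v = frechet_derivative \<tau> (at (?H ?y / ?S ?y)) ((dd c H z v - H z / S z * dd c S z v) / S z)"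
      by (simp only:)
    have "\<bar>dd c f z v\<bar> \<le> 4 * L / r * \<bar>(dd c H z v - H z / S z * dd c S z v) / S z\<bar>"
      unfolding eq by (rule \<tau>d)
    also have "\<dots> \<le> 4 * L / r * (5 * gnorm M c z v)"
      using W(6) z c L r by (intro mult_left_mono) auto
    finally show ?thesis by simp
  qed
  have d0: "dd c f z = (\<lambda>v. 0)" if c: "c \<in> atlas M" "z \<in> fst c" and z: "z \<in> points M - K" for c z
    by (rule dd_zero[OF c oK z f0])
  show ?thesis
  proof (rule bexI[OF _ test], intro conjI ballI allI mf)
    fix z show "0 \<le> f z" "f z \<le> 1" using \<sigma>(4) by (auto simp: f_def \<tau>_def)
  next
    fix z assume z: "z \<in> D.mball x0 (r / 2)"
    then have zK: "z \<in> K" using r by (auto simp: K_def R_def)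
    have "D z \<ge> r / 2" using z by (auto simp: D_def)
    moreover have "\<bar>H z / S z - D z\<bar> \<le> r / 16" using W(2,5) zK by blast
    ultimately have "3 / 8 * r \<le> H z / S z" using r by linarith
    then show "f z = 1" using zK \<tau>1 by (simp add: f_def)
  next
    fix z assume z: "z \<in> points M"
    show "grad_norm M f z \<le> 20 * L / r"
    proof (rule grad_norm_le[OF mf z])
      show "0 \<le> 20 * L / r" using L r by simp
      show "\<bar>dd c f z v\<bar> \<le> 20 * L / r * gnorm M c z v" if c: "c \<in> atlas M" "z \<in> fst c" for c v
      proof (cases "z \<in> K")
        case False
        then show ?thesis using d0[OF c] z gnorm_nonneg[OF c, of v] L r by simp
      qed (rule dK[OF c])
    qed
  next
    fix z assume z: "z \<in> points M - D.mball x0 r"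
    then have zK: "z \<in> points M - K" using Kball by blast
    show "f z = 0" by (rule f0[OF zK])
    show "grad_norm M f z \<le> 0"
      by (rule grad_norm_le[OF mf]) (use d0[OF _ _ zK] z in auto)
  qed
qed

end


section \<open>Volume growth\<close>

context riemannian
begin

lemma msmooth_measurable:
  assumes "msmooth f" "points M \<noteq> {}"
  shows "f \<in> borel_measurable (rvol M)"
proof (rule borel_measurableI)
  fix U :: "real set" assume U: "open U"
  have "openin T {x \<in> points M. f x \<in> U}"
    using openin_continuous_map_preimage[OF msmooth_continuous[OF assms(1)], of U] U by simp
  moreover have "f -` U \<inter> space (rvol M) = {x \<in> points M. f x \<in> U}" using rvol_space(1)[OF assms(2)] by auto
  ultimately show "f -` U \<inter> space (rvol M) \<in> sets (rvol M)" using B_open rvol_space(2)[OF assms(2)] by simp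
qed

lemma mball_volume:
  assumes complete: "D.mcomplete" and x0: "x0 \<in> points M"
  shows "D.mball x0 r \<in> sets (rvol M)" "emeasure (rvol M) (D.mball x0 r) < \<infinity>"
proof -
  have ne: "points M \<noteq> {}" using x0 by blast
  show "D.mball x0 r \<in> sets (rvol M)"
    using B_open[of "D.mball x0 r"] D.openin_mball[of x0 r] mtopology_eq rvol_space(2)[OF ne] by simp
  have "D.mcball x0 r \<in> sets (rvol M)"
    using B_closed[of "D.mcball x0 r"] D.closedin_mcball[of x0 r] mtopology_eq rvol_space(2)[OF ne] by simp
  then have "emeasure (rvol M) (D.mball x0 r) \<le> emeasure (rvol M) (D.mcball x0 r)"
    by (rule emeasure_mono[OF D.mball_subset_mcball])
  also have "\<dots> < \<infinity>" by (rule compact_finite_volume[OF compact_mcball[OF complete x0] ne])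
  finally show "emeasure (rvol M) (D.mball x0 r) < \<infinity>" .
qed

text \<open>The left side of the Sobolev inequality for the cut-off function is at least the contribution of
  the half ball, and on the right side only the ball itself contributes.\<close>

lemma sobolev_balls:
  assumes complete: "D.mcomplete" and x0: "x0 \<in> points M" and r: "r > 0"
    and sob: "sobolev_inequality M p q C1" and C1: "C1 > 0" and p: "p > 0" and q: "q > 0"
    and \<sigma>: "smooth_on UNIV \<sigma>" "\<And>s. s \<le> 0 \<Longrightarrow> \<sigma> s = 0" "\<And>s. s \<ge> 1 \<Longrightarrow> \<sigma> s = 1" "\<And>s. 0 \<le> \<sigma> s \<and> \<sigma> s \<le> 1"
      "\<And>s v. \<bar>frechet_derivative \<sigma> (at s) v\<bar> \<le> L * \<bar>v\<bar>" and L: "L > 0"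
  shows "measure (rvol M) (D.mball x0 (r / 2)) powr (1 / p) \<le> C1 * (20 * L) / r * measure (rvol M) (D.mball x0 r) powr (1 / q)"
proof -
  let ?\<mu> = "rvol M" and ?A = "D.mball x0 r" and ?A' = "D.mball x0 (r / 2)" and ?g = "20 * L / r"
  have ne: "points M \<noteq> {}" using x0 by blast
  note sp = rvol_space(1)[OF ne]
  note A = mball_volume[OF complete x0]
  obtain f where f: "f \<in> test_functions M" "msmooth f" "\<forall>z. 0 \<le> f z \<and> f z \<le> 1" "\<forall>z\<in>?A'. f z = 1"
    "\<forall>z\<in>points M. grad_norm M f z \<le> ?g" "\<forall>z\<in>points M - ?A. f z = 0 \<and> grad_norm M f z \<le> 0"
    using cutoff[OF complete x0 r \<sigma> L] by blast
  note fm [measurable] = msmooth_measurable[OF f(2) ne]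
  have fp: "0 \<le> \<bar>f z\<bar> powr p" "\<bar>f z\<bar> powr p \<le> 1" for z
    using f(3)[rule_format, of z] p by (auto intro: powr_le1)
  have I1: "integrable ?\<mu> (\<lambda>z. \<bar>f z\<bar> powr p)"
  proof (rule integrableI_bounded_set[OF A(1)])
    show "(\<lambda>z. \<bar>f z\<bar> powr p) \<in> borel_measurable ?\<mu>" by measurable
    show "emeasure ?\<mu> ?A < \<infinity>" by (rule A(2))
    show "AE z in ?\<mu>. z \<in> ?A \<longrightarrow> norm (\<bar>f z\<bar> powr p) \<le> 1" using fp by (intro AE_I2) simp
    show "AE z in ?\<mu>. z \<notin> ?A \<longrightarrow> \<bar>f z\<bar> powr p = 0" using f(6) sp by (intro AE_I2) simp
  qed
  have I2: "integrable ?\<mu> (indicat_real ?A')"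
    using A[of "r / 2"] by (simp add: integrable_indicator_iff)
  have "(\<integral>z. indicat_real ?A' z \<partial>?\<mu>) \<le> (\<integral>z. \<bar>f z\<bar> powr p \<partial>?\<mu>)"
  proof (rule integral_mono[OF I2 I1])
    fix z show "indicat_real ?A' z \<le> \<bar>f z\<bar> powr p" using f(4) fp by (auto simp: indicator_def)
  qed
  moreover have "(\<integral>z. indicat_real ?A' z \<partial>?\<mu>) = measure ?\<mu> ?A'"
    using A(1)[of "r / 2"] sets.sets_into_space[OF A(1)[of "r / 2"]] by (simp add: Int_absorb2)
  ultimately have lower: "measure ?\<mu> ?A' powr (1 / p) \<le> Lp_norm ?\<mu> p f"
    unfolding Lp_norm_def using p by (intro powr_mono2) auto
  have "(\<integral>z. \<bar>grad_norm M f z\<bar> powr q \<partial>?\<mu>) \<le> (\<integral>z. ?g powr q * indicat_real ?A z \<partial>?\<mu>)"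
  proof (rule integral_mono')
    show "integrable ?\<mu> (\<lambda>z. ?g powr q * indicat_real ?A z)"
      using A[of r] by (simp add: integrable_indicator_iff)
    fix z assume "z \<in> space ?\<mu>"
    then have z: "z \<in> points M" using sp by simp
    note g0 = grad_norm_nonneg[OF z, of f]
    show "\<bar>grad_norm M f z\<bar> powr q \<le> ?g powr q * indicat_real ?A z"
    proof (cases "z \<in> ?A")
      case True
      have "\<bar>grad_norm M f z\<bar> powr q \<le> ?g powr q" using f(5) z g0 q by (intro powr_mono2) auto
      then show ?thesis using True by simp
    next
      case False
      then have "grad_norm M f z = 0" using f(6) z g0 by (meson DiffI order_antisym)
      then show ?thesis by simp
    qed
    show "0 \<le> ?g powr q * indicat_real ?A z" by simp
  qed
  also have "\<dots> = ?g powr q * measure ?\<mu> ?A"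
    using sets.sets_into_space[OF A(1)[of r]] by (simp add: Int_absorb2)
  finally have "Lp_norm ?\<mu> q (grad_norm M f) \<le> (?g powr q * measure ?\<mu> ?A) powr (1 / q)"
    unfolding Lp_norm_def using q by (intro powr_mono2) auto
  also have "\<dots> = ?g * measure ?\<mu> ?A powr (1 / q)"
    using q L r by (simp add: powr_mult powr_powr)
  finally have upper: "Lp_norm ?\<mu> q (grad_norm M f) \<le> ?g * measure ?\<mu> ?A powr (1 / q)" .
  have "Lp_norm ?\<mu> p f \<le> C1 * Lp_norm ?\<mu> q (grad_norm M f)" using sob f(1) unfolding sobolev_inequality_def by blast
  also have "\<dots> \<le> C1 * (?g * measure ?\<mu> ?A powr (1 / q))" using upper C1 by (intro mult_left_mono) auto
  finally show ?thesis using lower by (simp add: mult.assoc)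
qed

end

text \<open>Here \<open>\<beta> = (n - q) * ln 2 + q * ln E\<close>. In terms of \<open>w r = ln (V r / r ^ n)\<close> the hypothesis reads \<open>w r \<ge> a * w (r / 2) - \<beta>\<close> with
  \<open>a = q / p = 1 - q / n\<close>. Since \<open>0 < a < 1\<close> and \<open>w\<close> is bounded below near \<open>0\<close>, iterating it pushes
  \<open>w\<close> above the fixed point \<open>- \<beta> / (1 - a)\<close>, whatever the lower bound near \<open>0\<close> was.\<close>

lemma growth_of_doubling:
  fixes V :: "real \<Rightarrow> real" and n :: nat
  assumes pos: "\<And>r. r > 0 \<Longrightarrow> V r > 0" and q: "0 < q" "q < real n" and pq: "1 / p = 1 / q - 1 / real n" and E: "E > 0"
    and step: "\<And>r. r > 0 \<Longrightarrow> V (r / 2) powr (1 / p) \<le> E / r * V r powr (1 / q)"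
    and b: "b > 0" "r0 > 0" "\<And>r. 0 < r \<Longrightarrow> r \<le> r0 \<Longrightarrow> b * r ^ n \<le> V r" and r: "r > 0"
  shows "exp (- ((real n - q) * ln 2 + q * ln E) * real n / q) * r ^ n \<le> V r"
proof -
  have n: "real n > 0" using q by linarith
  define a where "a = 1 - q / real n"
  have a: "0 < a" "a < 1" using q n by (auto simp: a_def)
  have ap: "q / p = a"
  proof -
    have "q / p = q * (1 / p)" by simp
    also have "\<dots> = q * (1 / q - 1 / real n)" by (simp only: pq)
    finally show ?thesis using q(1) by (simp add: a_def right_diff_distrib)
  qed
  have an: "a * real n = real n - q" using n by (simp add: a_def field_simps)
  define w where "w = (\<lambda>r. ln (V r) - real n * ln r)"
  define \<beta> where "\<beta> = (real n - q) * ln 2 + q * ln E"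
  define ws where "ws = - \<beta> * real n / q"
  have ws: "ws = a * ws - \<beta>"
  proof -
    have "(1 - a) * ws = - \<beta>" using q n by (simp add: a_def ws_def)
    then show ?thesis by (simp add: algebra_simps)
  qed
  have rec: "w s \<ge> a * w (s / 2) - \<beta>" if s: "s > 0" for s
  proof -
    have V: "V s > 0" "V (s / 2) > 0" using pos s by auto
    have "ln (V (s / 2) powr (1 / p)) \<le> ln (E / s * V s powr (1 / q))"
      using step[OF s] V E s by (subst ln_le_cancel_iff) auto
    then have "(1 / p) * ln (V (s / 2)) \<le> ln E - ln s + (1 / q) * ln (V s)"
      using V E s by (simp add: ln_mult ln_div ln_powr)
    then have "q * ((1 / p) * ln (V (s / 2))) \<le> q * (ln E - ln s + (1 / q) * ln (V s))"
      using q(1) by (intro mult_left_mono) auto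
    moreover have "q * ((1 / p) * ln (V (s / 2))) = a * ln (V (s / 2))" by (simp flip: ap)
    moreover have "q * (ln E - ln s + (1 / q) * ln (V s)) = q * ln E - q * ln s + ln (V s)"
      using q(1) by (simp add: algebra_simps)
    ultimately have "a * ln (V (s / 2)) \<le> q * ln E - q * ln s + ln (V s)" by linarith
    moreover have "a * w (s / 2) = a * ln (V (s / 2)) - (real n - q) * (ln s - ln 2)"
      using s an by (simp add: w_def ln_div right_diff_distrib mult.assoc[symmetric])
    ultimately show ?thesis by (simp add: w_def \<beta>_def algebra_simps)
  qed
  have iter: "w r - ws \<ge> a ^ k * (w (r / 2 ^ k) - ws)" for k
  proof (induction k)
    case (Suc k)
    have "w (r / 2 ^ k) - ws \<ge> a * (w (r / 2 ^ Suc k) - ws)"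
      using rec[of "r / 2 ^ k"] r ws by (simp add: right_diff_distrib mult.commute)
    then have "a ^ k * (w (r / 2 ^ k) - ws) \<ge> a ^ k * (a * (w (r / 2 ^ Suc k) - ws))"
      using a(1) by (intro mult_left_mono) auto
    then show ?case using Suc by (simp add: mult_ac)
  qed simp
  have small: "w s \<ge> ln b" if s: "0 < s" "s \<le> r0" for s
  proof -
    have "ln (b * s ^ n) \<le> ln (V s)" using b(3)[OF s] b(1) s pos[OF s(1)] by (subst ln_le_cancel_iff) auto
    then show ?thesis using b(1) s(1) by (simp add: w_def ln_mult ln_realpow)
  qed
  have "(\<lambda>k. r / 2 ^ k) \<longlonglongrightarrow> 0" by (rule LIMSEQ_divide_realpow_zero) simp
  then have "\<forall>\<^sub>F k in sequentially. r / 2 ^ k < r0" using b(2) by (rule order_tendstoD(2))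
  then have "\<forall>\<^sub>F k in sequentially. a ^ k * (ln b - ws) \<le> w r - ws"
  proof eventually_elim
    case (elim k)
    have "a ^ k * (ln b - ws) \<le> a ^ k * (w (r / 2 ^ k) - ws)"
      using small[of "r / 2 ^ k"] elim r a(1) by (intro mult_left_mono) auto
    then show ?case using iter[of k] by linarith
  qed
  moreover have "(\<lambda>k. a ^ k * (ln b - ws)) \<longlonglongrightarrow> 0"
    using tendsto_mult_left_zero[OF LIMSEQ_realpow_zero[of a]] a by simp
  ultimately have "0 \<le> w r - ws" using tendsto_upperbound by (metis trivial_limit_sequentially)
  then have "ws + real n * ln r \<le> ln (V r)" by (simp add: w_def)
  then have "exp (ws + real n * ln r) \<le> V r" using pos[OF r] by (metis exp_le_cancel_iff exp_ln)
  moreover have "exp (real n * ln r) = r ^ n" using r by (simp add: exp_of_nat_mult)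
  ultimately show ?thesis by (simp add: exp_add ws_def \<beta>_def)
qed

theorem theorem1p2:
  fixes p q C\<^sub>1 :: real
  assumes "CARD('n::finite) \<ge> 2"
    and "1 \<le> q" and "q < real CARD('n)"
    and "1 / p = 1 / q - 1 / real CARD('n)"
    and "C\<^sub>1 > 0"
    and "C\<^sub>1 > optimal_sobolev_constant (euclidean_manifold :: (real ^ 'n, 'n) rmanifold) p q"
  shows "\<exists>C>0. \<forall>(M :: ('m, 'n) rmanifold) x\<^sub>0.
           complete_riemannian M \<longrightarrow> sobolev_inequality M p q C\<^sub>1 \<longrightarrow> x\<^sub>0 \<in> points M \<longrightarrow>
           Liminf at_top (\<lambda>r. emeasure (rvol M) (geodesic_ball M x\<^sub>0 r)
                              / emeasure lborel (ball (0 :: real ^ 'n) r)) \<ge> ennreal C"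
proof -
  obtain \<sigma> :: "real \<Rightarrow> real" and L where L: "L > 0" and \<sigma>: "smooth_on UNIV \<sigma>"
    "\<And>s. s \<le> 0 \<Longrightarrow> \<sigma> s = 0" "\<And>s. s \<ge> 1 \<Longrightarrow> \<sigma> s = 1" "\<And>s. 0 \<le> \<sigma> s \<and> \<sigma> s \<le> 1"
    "\<And>s v. \<bar>frechet_derivative \<sigma> (at s) v\<bar> \<le> L * \<bar>v\<bar>"
  proof (rule smooth_step)
    fix \<sigma> :: "real \<Rightarrow> real" and L assume "L > 0" "smooth_on UNIV \<sigma>"
      "\<And>s. s \<le> 0 \<Longrightarrow> \<sigma> s = 0" "\<And>s. s \<ge> 1 \<Longrightarrow> \<sigma> s = 1" "\<And>s. 0 \<le> \<sigma> s \<and> \<sigma> s \<le> 1"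
      "\<And>s v. \<bar>frechet_derivative \<sigma> (at s) v\<bar> \<le> L * \<bar>v\<bar>"
    then show thesis by (rule that)
  qed
  let ?n = "CARD('n)"
  have q: "q > 0" "q < real ?n" using assms(2,3) by auto
  have "1 / real ?n < 1 / q" using q by (intro divide_strict_left_mono) auto
  then have p: "p > 0" using assms(4) by (metis diff_gt_0_iff_gt zero_less_divide_1_iff)
  (* E depends on C\<^sub>1 and the absolute constant L only, so \<kappa> depends on n, q and C\<^sub>1. *)
  define E where "E = C\<^sub>1 * (20 * L)"
  have E: "E > 0" using assms(5) L by (simp add: E_def)
  define \<kappa> where "\<kappa> = exp (- ((real ?n - q) * ln 2 + q * ln E) * real ?n / q)"
  define \<omega> where "\<omega> = unit_ball_vol (real ?n)"
  have \<omega>: "\<omega> > 0" by (simp add: \<omega>_def)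
  have main: "Liminf at_top (\<lambda>r. emeasure (rvol M) (geodesic_ball M x0 r) / emeasure lborel (ball (0 :: real ^ 'n) r)) \<ge> ennreal (\<kappa> / \<omega>)"
    if M: "complete_riemannian M" "sobolev_inequality M p q C\<^sub>1" "x0 \<in> points M" for M :: "('m, 'n) rmanifold" and x0
  proof -
    interpret riemannian M by (unfold_locales) (use M(1) in \<open>simp add: complete_riemannian_def\<close>)
    have complete: "D.mcomplete" using M(1) by (simp add: complete_riemannian_def)
    define V where "V = (\<lambda>r. measure (rvol M) (D.mball x0 r))"
    have em: "emeasure (rvol M) (D.mball x0 r) = ennreal (V r)" for r
      using mball_volume(2)[OF complete M(3), of r] by (simp add: V_def emeasure_eq_ennreal_measure)
    obtain b r0 where b: "b > 0" "r0 > 0" "\<And>r. 0 < r \<Longrightarrow> r \<le> r0 \<Longrightarrow> ennreal (b * r ^ ?n) \<le> emeasure (rvol M) (D.mball x0 r)"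
    proof (rule small_ball_volume[OF M(3)])
      fix b r0 :: real assume "b > 0" "r0 > 0" "\<And>r. 0 < r \<Longrightarrow> r \<le> r0 \<Longrightarrow> ennreal (b * r ^ ?n) \<le> emeasure (rvol M) (D.mball x0 r)"
      then show thesis by (rule that)
    qed
    have b': "b * r ^ ?n \<le> V r" if "0 < r" "r \<le> r0" for r
      using b(3)[OF that] unfolding em by (subst (asm) ennreal_le_iff) (simp_all add: V_def)
    have Vpos: "V r > 0" if r: "r > 0" for r
    proof -
      let ?s = "min r r0"
      have "0 < b * ?s ^ ?n" using b(1,2) r by simp
      also have "\<dots> \<le> V ?s" using b' b(2) r by simp
      also have "\<dots> \<le> V r"
        unfolding V_def using mball_volume[OF complete M(3)]
        by (intro measure_mono_fmeasurable fmeasurableI D.mball_subset_concentric) auto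
      finally show ?thesis .
    qed
    have step: "V (r / 2) powr (1 / p) \<le> E / r * V r powr (1 / q)" if "r > 0" for r
      unfolding V_def E_def by (rule sobolev_balls[OF complete M(3) that M(2) assms(5) p q(1) \<sigma> L])
    have growth: "\<kappa> * r ^ ?n \<le> V r" if "r > 0" for r
      unfolding \<kappa>_def by (rule growth_of_doubling[OF Vpos q assms(4) E step b(1,2) b' that])
    show ?thesis
    proof (rule Liminf_bounded)
      show "\<forall>\<^sub>F r in at_top. ennreal (\<kappa> / \<omega>) \<le> emeasure (rvol M) (geodesic_ball M x0 r) / emeasure lborel (ball (0 :: real ^ 'n) r)"
        using eventually_gt_at_top[of 0]
      proof eventually_elim
        case (elim r)
        have "\<kappa> / \<omega> \<le> V r / (\<omega> * r ^ ?n)"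
          using growth[OF elim] \<omega> elim by (simp add: field_simps)
        moreover have "emeasure lborel (ball (0 :: real ^ 'n) r) = ennreal (\<omega> * r ^ ?n)"
          using elim by (simp add: emeasure_ball \<omega>_def)
        moreover have "ennreal (V r) / ennreal (\<omega> * r ^ ?n) = ennreal (V r / (\<omega> * r ^ ?n))"
          using \<omega> elim Vpos[OF elim] by (intro divide_ennreal) auto
        ultimately show ?case by (simp add: geodesic_ball_eq em ennreal_leI)
      qed
    qed
  qed
  show ?thesis
    by (rule exI[of _ "\<kappa> / \<omega>"]) (use main \<omega> in \<open>auto simp: \<kappa>_def\<close>)
qed

end
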